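(* Let $\omega_\rho\in S_C(\mathfrak B)$, let $A\in\mathfrak B$, $\tilde A\in\mathfrak C$ and $\hat A_N\in B(\hat H_N)$ ($N\in\mathbb N$) satisfy $A\circ\iota=\iota\circ\tilde A$, $\lim_{N\to\infty}\|(\hat A_N\circ\iota_N-\iota_N\circ\tilde A)f\|_{\hat H_N}=0$ for all $f\in C(X)$, and $\|\hat A_N\|\le a$ for a constant $a$ independent of $N$. Let $q\in\mathbb N$ and $t_q=q\,\Delta t$. Then for $\mu$-a.e. initial state $x_0\in X$, $$\lim_{L\to\infty}\lim_{N\to\infty}(\mathcal P^{(q)}_{L,N}\omega_{\rho_{L,N}})A_{L,N}=\lim_{L\to\infty}(\mathcal P_L^{(t_q)}\omega_{\rho_L})A_L=(\mathcal P^{t_q}\omega_\rho)A.$$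
   Context: Dynamics: $\Phi^t:X\to X$, $t\in\mathbb R$, is a continuous flow on a compact metrizable space $X$, $\mu$ an invariant ergodic Borel probability measure, and $\Delta t>0$ is such that $\Phi^{\Delta t}$ is ergodic for $\mu$. For $x_0\in X$ let $x_n=\Phi^{n\Delta t}(x_0)$ (assumed distinct), $\mu_N=\frac1N\sum_{n=0}^{N-1}\delta_{x_n}$, $H=L^2(X,\mu)$, $\hat H_N=L^2(X,\mu_N)$, with inner products $\langle f,g\rangle=\int f^*g\,d\mu$, $\langle f,g\rangle_N=\int f^*g\,d\mu_N$. $\iota:C(X)\to H$, $\iota_N:C(X)\to\hat H_N$ are the canonical maps, $\mathfrak B=B(H)$, $\mathfrak C=B(C(X))$. Basis: $k:X\times X\to\mathbb R$ is a continuous symmetric kernel and $k_N$ are (possibly data-dependent) continuous symmetric real kernels converging uniformly to $k$. $Kf=\int_Xk(\cdot,x)f(x)\,d\mu(x)$ on $H$ has a real orthonormal eigenbasis $\{\phi_l\}_{l\ge0}$ of $H$, eigenvalues $\lambda_l$ in order of decreasing modulus; $K_Nf=\int_Xk_N(\cdot,x)f(x)\,d\mu_N(x)$ on $\hat H_N$ has a real orthonormal eigenbasis $\{\phi_{l,N}\}_{l=0}^{N-1}$, eigenvalues $\lambda_{l,N}$ ordered likewise. All $\lambda_l$ are nonzero. For nonzero eigenvalues, continuous representatives are $\varphi_l=\lambda_l^{-1}\int k(\cdot,x')\phi_l(x')\,d\mu(x')$, $\varphi_{l,N}=\lambda_{l,N}^{-1}\int k_N(\cdot,x')\phi_{l,N}(x')\,d\mu_N(x')$.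 It is known, and used as a standing convention, that for $\mu$-a.e. $x_0$, for each $l$ with $\lambda_l\ne0$, $\lambda_{l,N}\to\lambda_l$, and the $\phi_{l,N}$ are chosen so that $\varphi_{l,N}\to\varphi_l$ uniformly. Projections: $\Pi_L$ (on $H$) and $\Pi_{L,N}$ (on $\hat H_N$) are the orthogonal projections onto $H_L=\operatorname{span}\{\phi_0,\ldots,\phi_{L-1}\}$ and $H_{L,N}=\operatorname{span}\{\phi_{0,N},\ldots,\phi_{L-1,N}\}$. $\mathfrak B_L=B(H_L)$, $\mathfrak B_{L,N}=B(H_{L,N})$. $A_L=\Pi_LA\Pi_L$, $A_{L,N}=\Pi_{L,N}\hat A_N\Pi_{L,N}$. States: a density operator $\sigma$ (positive, trace 1) induces $\omega_\sigma B=\operatorname{tr}(\sigma B)$. $S_C(\mathfrak B)$ is the set of normal states $\omega_\rho$ whose density operator has a decomposition $\rho=\sum_{j\ge0}r_j\langle\xi_j,\cdot\rangle\xi_j$ (trace-norm convergence), $\{\xi_j\}$ an orthonormal basis of $H$, $(r_j)\in\ell^1$, $r_j\in[0,1]$, with $\xi_j=\iota\tilde\xi_j$, $\tilde\xi_j\in C(X)$, $\|\tilde\xi_j\|_{C(X)}\le b$ for a constant $b$. Put $\hat\xi_{j,N}=\iota_N\tilde\xi_j$, $\hat\sigma_N=\sum_jr_j\langle\hat\xi_{j,N},\cdot\rangle_N\hat\xi_{j,N}$, $\rho_L=\Pi_L\rho\Pi_L/\operatorname{tr}(\Pi_L\rho\Pi_L)$, $\rho_{L,N}=\Pi_{L,N}\hat\sigma_N\Pi_{L,N}/\operatorname{tr}(\Pi_{L,N}\hat\sigma_N\Pi_{L,N})$,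 defined whenever the traces are positive (which holds for $L$ large and then $N$ large). Evolution: $U^tf=f\circ\Phi^t$ on $H$; $\mathcal P^t\omega=\omega\circ\mathcal U^t$ with $\mathcal U^tB=U^tBU^{t*}$. $U_L^{(t)}=\Pi_LU^t\Pi_L$, $\mathcal P^{(t)}_L\omega=\omega\circ\mathcal U^{(t)}_L$ with $\mathcal U_L^{(t)}B=U_L^{(t)}BU_L^{(t)*}$ on $\mathfrak B_L$. $\hat U_N$ on $\hat H_N$ is the circular shift $\hat U_Nf(x_n)=f(x_{n+1})$ for $0\le n\le N-2$, $\hat U_Nf(x_{N-1})=f(x_0)$; $U^{(q)}_{L,N}=\Pi_{L,N}\hat U_N^q\Pi_{L,N}$; $\mathcal P^{(q)}_{L,N}\omega=\omega\circ\mathcal U^{(q)}_{L,N}$ with $\mathcal U^{(q)}_{L,N}B=U^{(q)}_{L,N}BU^{(q)*}_{L,N}$ on $\mathfrak B_{L,N}$. *)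

theory Defs
  imports "HOL-Probability.Probability"
begin

section \<open>The space of square-integrable functions\<close>

text \<open>
  Vectors of \<open>L\<^sup>2(M)\<close> are represented by square-integrable functions, two of them being the same
  vector when \<open>l2_eq\<close> holds. An operator is a map on representatives that is compatible with
  \<open>l2_eq\<close>. In particular the canonical maps from \<open>C(X)\<close> to \<open>L\<^sup>2(M)\<close> are
  \<^const>\<open>apply_bcontfun\<close>.
  Below, \<open>V\<close> always is a subspace of \<open>L\<^sup>2(M)\<close>, regarded as a Hilbert space in its own right.
\<close>

definition l2_space :: "'a measure \<Rightarrow> ('a \<Rightarrow> complex) set" where
  "l2_space M = {f \<in> borel_measurable M. integrable M (\<lambda>x. (norm (f x))\<^sup>2)}"

definition l2_eq :: "'a measure \<Rightarrow> ('a \<Rightarrow> complex) \<Rightarrow> ('a \<Rightarrow> complex) \<Rightarrow> bool" where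
  "l2_eq M f g \<longleftrightarrow> (AE x in M. f x = g x)"

definition l2_inner :: "'a measure \<Rightarrow> ('a \<Rightarrow> complex) \<Rightarrow> ('a \<Rightarrow> complex) \<Rightarrow> complex" where
  "l2_inner M f g = (\<integral>x. cnj (f x) * g x \<partial>M)"

definition l2_norm :: "'a measure \<Rightarrow> ('a \<Rightarrow> complex) \<Rightarrow> real" where
  "l2_norm M f = sqrt (\<integral>x. (norm (f x))\<^sup>2 \<partial>M)"

definition l2_onb ::
  "'a measure \<Rightarrow> ('a \<Rightarrow> complex) set \<Rightarrow> 'i set \<Rightarrow> ('i \<Rightarrow> 'a \<Rightarrow> complex) \<Rightarrow> bool" where
  "l2_onb M V I e \<longleftrightarrow>
     (\<forall>i\<in>I. e i \<in> V) \<and>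
     (\<forall>i\<in>I. \<forall>j\<in>I. l2_inner M (e i) (e j) = (if i = j then 1 else 0)) \<and>
     (\<forall>f\<in>V. \<forall>\<epsilon>>0. \<exists>F c. finite F \<and> F \<subseteq> I \<and> l2_norm M (\<lambda>x. f x - (\<Sum>i\<in>F. c i * e i x)) < \<epsilon>)"

section \<open>Operators, trace and states\<close>

type_synonym 'a l2_op = "('a \<Rightarrow> complex) \<Rightarrow> ('a \<Rightarrow> complex)"

definition l2_bounded_op :: "'a measure \<Rightarrow> ('a \<Rightarrow> complex) set \<Rightarrow> 'a l2_op \<Rightarrow> bool" where
  "l2_bounded_op M V T \<longleftrightarrow>
     (\<forall>f\<in>V. T f \<in> V) \<and>
     (\<forall>f\<in>V. \<forall>g\<in>V. l2_eq M f g \<longrightarrow> l2_eq M (T f) (T g)) \<and>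
     (\<forall>f\<in>V. \<forall>g\<in>V. l2_eq M (T (\<lambda>x. f x + g x)) (\<lambda>x. T f x + T g x)) \<and>
     (\<forall>c. \<forall>f\<in>V. l2_eq M (T (\<lambda>x. c * f x)) (\<lambda>x. c * T f x)) \<and>
     (\<exists>C. \<forall>f\<in>V. l2_norm M (T f) \<le> C * l2_norm M f)"

definition l2_onorm :: "'a measure \<Rightarrow> ('a \<Rightarrow> complex) set \<Rightarrow> 'a l2_op \<Rightarrow> real" where
  "l2_onorm M V T = (SUP f\<in>V. l2_norm M (T f) / l2_norm M f)"

definition l2_positive :: "'a measure \<Rightarrow> ('a \<Rightarrow> complex) set \<Rightarrow> 'a l2_op \<Rightarrow> bool" where
  "l2_positive M V T \<longleftrightarrow> (\<forall>f\<in>V. l2_inner M f (T f) \<in> \<real>\<^sub>\<ge>\<^sub>0)"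

definition l2_adjoint :: "'a measure \<Rightarrow> ('a \<Rightarrow> complex) set \<Rightarrow> 'a l2_op \<Rightarrow> 'a l2_op" where
  "l2_adjoint M V T =
     (\<lambda>f. SOME g. g \<in> V \<and> (\<forall>h\<in>V. l2_inner M g h = l2_inner M f (T h)))"

definition l2_proj :: "'a measure \<Rightarrow> ('a \<Rightarrow> complex) set \<Rightarrow> 'a l2_op" where
  "l2_proj M V =
     (\<lambda>f. SOME g. g \<in> V \<and> (\<forall>h\<in>V. l2_inner M h (\<lambda>x. f x - g x) = 0))"

text \<open>
  \<open>\<Sum>\<langle>e\<^sub>i, T e\<^sub>i\<rangle>\<close> converges (unconditionally, hence absolutely) to the same value for every
  orthonormal basis of the separable Hilbert space \<open>V\<close>; for a bounded operator this amounts to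
  being trace class. Indexing by subsets of \<^typ>\<open>nat\<close> covers finite dimension as well.
\<close>

definition l2_has_trace ::
  "'a measure \<Rightarrow> ('a \<Rightarrow> complex) set \<Rightarrow> 'a l2_op \<Rightarrow> complex \<Rightarrow> bool" where
  "l2_has_trace M V T c \<longleftrightarrow>
     (\<forall>(I :: nat set) e. l2_onb M V I e \<longrightarrow> ((\<lambda>i. l2_inner M (e i) (T (e i))) has_sum c) I)"

definition l2_trace :: "'a measure \<Rightarrow> ('a \<Rightarrow> complex) set \<Rightarrow> 'a l2_op \<Rightarrow> complex" where
  "l2_trace M V T = (THE c. l2_has_trace M V T c)"

text \<open>The trace norm of \<open>T\<close> is the trace of \<open>S = \<bar>T\<bar>\<close>, the positive square root of \<open>T\<^sup>* T\<close>.\<close>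

definition l2_has_trace_norm ::
  "'a measure \<Rightarrow> ('a \<Rightarrow> complex) set \<Rightarrow> 'a l2_op \<Rightarrow> real \<Rightarrow> bool" where
  "l2_has_trace_norm M V T c \<longleftrightarrow>
     (\<exists>S. l2_bounded_op M V S \<and> l2_positive M V S \<and>
          (\<forall>f\<in>V. l2_eq M (S (S f)) (l2_adjoint M V T (T f))) \<and>
          l2_has_trace M V S (complex_of_real c))"

definition density_op :: "'a measure \<Rightarrow> ('a \<Rightarrow> complex) set \<Rightarrow> 'a l2_op \<Rightarrow> bool" where
  "density_op M V \<sigma> \<longleftrightarrow> l2_bounded_op M V \<sigma> \<and> l2_positive M V \<sigma> \<and> l2_has_trace M V \<sigma> 1"

definition density_state ::
  "'a measure \<Rightarrow> ('a \<Rightarrow> complex) set \<Rightarrow> 'a l2_op \<Rightarrow> 'a l2_op \<Rightarrow> complex" where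
  "density_state M V \<sigma> B = l2_trace M V (\<sigma> \<circ> B)"

text \<open>The map \<open>B \<mapsto> U B U\<^sup>*\<close> on \<open>B(V)\<close>, and the map it induces on functionals on \<open>B(V)\<close>.\<close>

definition heisenberg :: "'a measure \<Rightarrow> ('a \<Rightarrow> complex) set \<Rightarrow> 'a l2_op \<Rightarrow> 'a l2_op \<Rightarrow> 'a l2_op" where
  "heisenberg M V U B = U \<circ> B \<circ> l2_adjoint M V U"

definition transfer_op ::
  "'a measure \<Rightarrow> ('a \<Rightarrow> complex) set \<Rightarrow> 'a l2_op \<Rightarrow> ('a l2_op \<Rightarrow> complex) \<Rightarrow> 'a l2_op \<Rightarrow> complex" where
  "transfer_op M V U \<omega> = \<omega> \<circ> heisenberg M V U"

definition compression :: "'a measure \<Rightarrow> ('a \<Rightarrow> complex) set \<Rightarrow> 'a l2_op \<Rightarrow> 'a l2_op" where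
  "compression M V T = l2_proj M V \<circ> T \<circ> l2_proj M V"

definition compressed_density ::
  "'a measure \<Rightarrow> ('a \<Rightarrow> complex) set \<Rightarrow> 'a l2_op \<Rightarrow> 'a l2_op" where
  "compressed_density M V \<sigma> =
     (\<lambda>f x. compression M V \<sigma> f x / l2_trace M V (compression M V \<sigma>))"

definition rank_one_sum ::
  "'a measure \<Rightarrow> (nat \<Rightarrow> real) \<Rightarrow> (nat \<Rightarrow> 'a \<Rightarrow> complex) \<Rightarrow> nat \<Rightarrow> 'a l2_op" where
  "rank_one_sum M r \<xi> n = (\<lambda>f x. \<Sum>j<n. complex_of_real (r j) * l2_inner M (\<xi> j) f * \<xi> j x)"

text \<open>
  \<open>S_C_decomposition \<mu> \<rho> r \<xi>\<close>: the operator \<open>\<rho>\<close> is a density operator on \<open>L\<^sup>2(\<mu>)\<close> for which \<open>r\<close> and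
  \<open>\<xi>\<close> (the continuous representatives of the basis) form a decomposition witnessing that the state
  of \<open>\<rho>\<close> belongs to \<open>S\<^sub>C\<close>.
\<close>

definition S_C_decomposition ::
  "'x::topological_space measure \<Rightarrow> 'x l2_op \<Rightarrow> (nat \<Rightarrow> real) \<Rightarrow> (nat \<Rightarrow> 'x \<Rightarrow>\<^sub>C complex) \<Rightarrow> bool" where
  "S_C_decomposition \<mu> \<rho> r \<xi> \<longleftrightarrow>
     density_op \<mu> (l2_space \<mu>) \<rho> \<and>
     l2_onb \<mu> (l2_space \<mu>) UNIV (\<lambda>j. apply_bcontfun (\<xi> j)) \<and>
     (\<forall>j. 0 \<le> r j \<and> r j \<le> 1) \<and> summable r \<and>
     (\<exists>b. \<forall>j. norm (\<xi> j) \<le> b) \<and>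
     (\<exists>d. (\<forall>n. l2_has_trace_norm \<mu> (l2_space \<mu>)
               (\<lambda>f x. \<rho> f x - rank_one_sum \<mu> r (\<lambda>j. apply_bcontfun (\<xi> j)) n f x) (d n)) \<and>
          d \<longlonglongrightarrow> 0)"

text \<open>
  The series \<open>\<Sum> r\<^sub>j \<langle>\<xi>\<^sub>j, \<cdot>\<rangle> \<xi>\<^sub>j\<close> summed pointwise. It is used on the finite-dimensional space
  \<open>L\<^sup>2(\<mu>\<^sub>N)\<close> only, where for bounded \<open>\<xi>\<close> and summable \<open>r\<close> it converges absolutely.
\<close>

definition sampled_density ::
  "'a measure \<Rightarrow> (nat \<Rightarrow> real) \<Rightarrow> (nat \<Rightarrow> 'a \<Rightarrow> complex) \<Rightarrow> 'a l2_op" where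
  "sampled_density M r \<xi> = (\<lambda>f x. \<Sum>j. complex_of_real (r j) * l2_inner M (\<xi> j) f * \<xi> j x)"

text \<open>\<^const>\<open>bounded_linear\<close> only covers real scalars.\<close>

definition bounded_clinear_C ::
  "(('x::topological_space \<Rightarrow>\<^sub>C complex) \<Rightarrow> ('x \<Rightarrow>\<^sub>C complex)) \<Rightarrow> bool" where
  "bounded_clinear_C T \<longleftrightarrow> bounded_linear T \<and>
     (\<forall>c f g. (\<forall>x. apply_bcontfun g x = c * apply_bcontfun f x) \<longrightarrow>
              (\<forall>x. apply_bcontfun (T g) x = c * apply_bcontfun (T f) x))"

section \<open>Flows and sampled orbits\<close>

definition continuous_flow :: "(real \<Rightarrow> 'x::topological_space \<Rightarrow> 'x) \<Rightarrow> bool" where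
  "continuous_flow \<Phi> \<longleftrightarrow>
     continuous_on UNIV (\<lambda>(t, x). \<Phi> t x) \<and> \<Phi> 0 = id \<and> (\<forall>s t. \<Phi> (s + t) = \<Phi> s \<circ> \<Phi> t)"

definition flow_invariant :: "'x measure \<Rightarrow> (real \<Rightarrow> 'x \<Rightarrow> 'x) \<Rightarrow> bool" where
  "flow_invariant \<mu> \<Phi> \<longleftrightarrow> (\<forall>t. distr \<mu> \<mu> (\<Phi> t) = \<mu>)"

definition flow_ergodic :: "'x measure \<Rightarrow> (real \<Rightarrow> 'x \<Rightarrow> 'x) \<Rightarrow> bool" where
  "flow_ergodic \<mu> \<Phi> \<longleftrightarrow>
     (\<forall>A\<in>sets \<mu>. (\<forall>t. \<Phi> t -` A \<inter> space \<mu> = A) \<longrightarrow> measure \<mu> A = 0 \<or> measure \<mu> A = 1)"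

definition map_ergodic :: "'x measure \<Rightarrow> ('x \<Rightarrow> 'x) \<Rightarrow> bool" where
  "map_ergodic \<mu> T \<longleftrightarrow>
     (\<forall>A\<in>sets \<mu>. T -` A \<inter> space \<mu> = A \<longrightarrow> measure \<mu> A = 0 \<or> measure \<mu> A = 1)"

definition orbit_pt :: "(real \<Rightarrow> 'x \<Rightarrow> 'x) \<Rightarrow> real \<Rightarrow> 'x \<Rightarrow> nat \<Rightarrow> 'x" where
  "orbit_pt \<Phi> \<Delta>t x0 n = \<Phi> (real n * \<Delta>t) x0"

definition sampling_measure ::
  "(real \<Rightarrow> 'x::topological_space \<Rightarrow> 'x) \<Rightarrow> real \<Rightarrow> 'x \<Rightarrow> nat \<Rightarrow> 'x measure" where
  "sampling_measure \<Phi> \<Delta>t x0 N =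
     distr (uniform_count_measure {..<N}) borel (orbit_pt \<Phi> \<Delta>t x0)"

definition koopman :: "(real \<Rightarrow> 'x \<Rightarrow> 'x) \<Rightarrow> real \<Rightarrow> 'x l2_op" where
  "koopman \<Phi> t f = f \<circ> \<Phi> t"

text \<open>
  The value \<open>0\<close> off the orbit segment is irrelevant, since the complement of the segment is null for
  the sampling measure. The index \<open>n\<close> is unique when the orbit points are distinct.
\<close>

definition shift_op :: "(real \<Rightarrow> 'x \<Rightarrow> 'x) \<Rightarrow> real \<Rightarrow> 'x \<Rightarrow> nat \<Rightarrow> 'x l2_op" where
  "shift_op \<Phi> \<Delta>t x0 N f = (\<lambda>x.
     if x \<in> orbit_pt \<Phi> \<Delta>t x0 ` {..<N}
     then let n = (THE n. n < N \<and> orbit_pt \<Phi> \<Delta>t x0 n = x)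
          in f (orbit_pt \<Phi> \<Delta>t x0 (if n = N - 1 then 0 else n + 1))
     else 0)"

section \<open>Kernel eigenbases\<close>

definition kernel_op :: "'a measure \<Rightarrow> ('a \<Rightarrow> 'a \<Rightarrow> real) \<Rightarrow> 'a l2_op" where
  "kernel_op M k f = (\<lambda>y. \<integral>x. complex_of_real (k y x) * f x \<partial>M)"

definition continuous_symmetric_kernel :: "('x::topological_space \<Rightarrow> 'x \<Rightarrow> real) \<Rightarrow> bool" where
  "continuous_symmetric_kernel k \<longleftrightarrow>
     continuous_on UNIV (\<lambda>(x, y). k x y) \<and> (\<forall>x y. k x y = k y x)"

definition kernel_eigenbasis ::
  "'a measure \<Rightarrow> ('a \<Rightarrow> 'a \<Rightarrow> real) \<Rightarrow> nat set \<Rightarrow> (nat \<Rightarrow> 'a \<Rightarrow> real) \<Rightarrow> (nat \<Rightarrow> real) \<Rightarrow> bool" where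
  "kernel_eigenbasis M k I \<phi> eig \<longleftrightarrow>
     l2_onb M (l2_space M) I (\<lambda>l x. complex_of_real (\<phi> l x)) \<and>
     (\<forall>l\<in>I. l2_eq M (kernel_op M k (\<lambda>x. complex_of_real (\<phi> l x)))
                    (\<lambda>x. complex_of_real (eig l) * complex_of_real (\<phi> l x))) \<and>
     (\<forall>l\<in>I. \<forall>m\<in>I. l \<le> m \<longrightarrow> \<bar>eig m\<bar> \<le> \<bar>eig l\<bar>)"

definition continuous_rep ::
  "'a measure \<Rightarrow> ('a \<Rightarrow> 'a \<Rightarrow> real) \<Rightarrow> real \<Rightarrow> ('a \<Rightarrow> real) \<Rightarrow> 'a \<Rightarrow> real" where
  "continuous_rep M k lam \<phi> = (\<lambda>x. (\<integral>x'. k x x' * \<phi> x' \<partial>M) / lam)"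

definition leading_span :: "(nat \<Rightarrow> 'a \<Rightarrow> real) \<Rightarrow> nat \<Rightarrow> ('a \<Rightarrow> complex) set" where
  "leading_span \<phi> L = {f. \<exists>c. f = (\<lambda>x. \<Sum>l<L. c l * complex_of_real (\<phi> l x))}"

end

theory Submission
  imports Defs
begin

text \<open>
  All expectations in the theorem are normalized traces of \<open>\<sigma> U A U\<^sup>*\<close>. Writing the density as
  \<open>\<Sum>\<^sub>j r\<^sub>j \<langle>\<xi>\<^sub>j, \<cdot>\<rangle> \<xi>\<^sub>j\<close> turns such a trace into \<open>\<Sum>\<^sub>j r\<^sub>j \<langle>w\<^sub>j, A w\<^sub>j\<rangle>\<close> with the evolved vectors
  \<open>w\<^sub>j = U\<^sup>* \<xi>\<^sub>j\<close>; for the compressions to the span of the first \<open>L\<close> eigenfunctions, with projection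
  \<open>P\<^sub>L\<close>, one has \<open>w\<^sub>j = P\<^sub>L U\<^sup>* P\<^sub>L \<xi>\<^sub>j\<close> and the normalization is \<open>\<Sum>\<^sub>j r\<^sub>j \<parallel>P\<^sub>L \<xi>\<^sub>j\<parallel>\<^sup>2\<close>. The trace in question
  does not depend on the basis (\<open>has_trace_nuclear\<close>), which yields the two formulas
  \<open>evolved_expectation\<close> and \<open>compressed_expectation\<close>.

  Limit in \<open>L\<close>: the eigenfunctions are a basis, so \<open>P\<^sub>L U\<^sup>* P\<^sub>L \<xi>\<^sub>j\<close> tends to \<open>U\<^sup>* \<xi>\<^sub>j\<close>, and the summable
  weights allow dominated convergence (\<open>compressed_expectation_tendsto\<close>).

  Limit in \<open>N\<close>: in coordinates the compressed expectation is one function, \<open>frame_expectation\<close>, of the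
  numbers \<open>\<langle>\<phi>\<^sub>l, \<xi>\<^sub>j\<rangle>\<close>, \<open>\<langle>\<phi>\<^sub>l, U \<phi>\<^sub>m\<rangle>\<close> and \<open>\<langle>\<phi>\<^sub>m, A \<phi>\<^sub>n\<rangle>\<close>, the same for the exact and for the sampled data, and it is
  continuous in them (\<open>frame_expectation_tendsto\<close>). The sampled numbers converge for three reasons.
  The sampled eigenfunctions are close to fixed continuous functions
  (\<open>sampled_eigenfunction_tendsto\<close>). On those, the shift is close to the flow
  (\<open>shift_power_approx_flow\<close>), and the sampled observable to the operator on continuous functions by
  hypothesis. Finally, orbit averages of continuous functions tend to integrals for almost
  every initial state, by the pointwise ergodic theorem (\<open>birkhoff_bounded_complex\<close>).
\<close>

section \<open>Square-integrable functions\<close>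

lemma l2_measurable: "f \<in> l2_space M \<Longrightarrow> f \<in> borel_measurable M"
  by (simp add: l2_space_def)

lemma l2_square_integrable: "f \<in> l2_space M \<Longrightarrow> integrable M (\<lambda>x. (norm (f x))\<^sup>2)"
  by (simp add: l2_space_def)

lemma measurable_cnj: "f \<in> borel_measurable M \<Longrightarrow> (\<lambda>x. cnj (f x)) \<in> borel_measurable M"
  by (rule measurable_compose[OF _ borel_measurable_continuous_onI]) (auto intro: continuous_intros)

lemma l2_product_integrable:
  assumes "f \<in> l2_space M" "g \<in> l2_space M"
  shows "integrable M (\<lambda>x. cnj (f x) * g x)"
proof (rule Bochner_Integration.integrable_bound)
  show "integrable M (\<lambda>x. (norm (f x))\<^sup>2 + (norm (g x))\<^sup>2)"
    using assms by (simp add: l2_square_integrable)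
  show "(\<lambda>x. cnj (f x) * g x) \<in> borel_measurable M"
    using assms[THEN l2_measurable] by (intro borel_measurable_times measurable_cnj)
  show "AE x in M. norm (cnj (f x) * g x) \<le> norm ((norm (f x))\<^sup>2 + (norm (g x))\<^sup>2)"
  proof (rule AE_I2)
    fix x
    have "2 * (norm (f x) * norm (g x)) \<le> (norm (f x))\<^sup>2 + (norm (g x))\<^sup>2"
      using sum_squares_bound[of "norm (f x)" "norm (g x)"] by (simp add: mult.assoc)
    moreover have "0 \<le> norm (f x) * norm (g x)" by simp
    ultimately show "norm (cnj (f x) * g x) \<le> norm ((norm (f x))\<^sup>2 + (norm (g x))\<^sup>2)"
      unfolding norm_mult complex_mod_cnj real_norm_def by linarith
  qed
qed

lemma l2_zero: "(\<lambda>x. 0) \<in> l2_space M"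
  by (simp add: l2_space_def)

lemma l2_scale:
  assumes "f \<in> l2_space M"
  shows "(\<lambda>x. c * f x) \<in> l2_space M"
  using l2_measurable[OF assms] l2_square_integrable[OF assms]
  by (auto simp: l2_space_def norm_mult power_mult_distrib)

lemma l2_add:
  assumes "f \<in> l2_space M" "g \<in> l2_space M"
  shows "(\<lambda>x. f x + g x) \<in> l2_space M"
proof -
  have "integrable M (\<lambda>x. (norm (f x + g x))\<^sup>2)"
  proof (rule Bochner_Integration.integrable_bound)
    show "integrable M (\<lambda>x. 2 * (norm (f x))\<^sup>2 + 2 * (norm (g x))\<^sup>2)"
      using assms by (simp add: l2_square_integrable)
    show "(\<lambda>x. (norm (f x + g x))\<^sup>2) \<in> borel_measurable M"
      using assms[THEN l2_measurable] by measurable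
    show "AE x in M. norm ((norm (f x + g x))\<^sup>2) \<le> norm (2 * (norm (f x))\<^sup>2 + 2 * (norm (g x))\<^sup>2)"
    proof (rule AE_I2)
      fix x
      have "(norm (f x + g x))\<^sup>2 \<le> (norm (f x) + norm (g x))\<^sup>2"
        by (rule power_mono) (auto simp: norm_triangle_ineq)
      also have "\<dots> \<le> 2 * (norm (f x))\<^sup>2 + 2 * (norm (g x))\<^sup>2"
        using sum_squares_bound[of "norm (f x)" "norm (g x)"] by (simp add: power2_sum)
      finally show "norm ((norm (f x + g x))\<^sup>2) \<le> norm (2 * (norm (f x))\<^sup>2 + 2 * (norm (g x))\<^sup>2)"
        by simp
    qed
  qed
  then show ?thesis
    using assms[THEN l2_measurable] by (simp add: l2_space_def)
qed

lemma l2_diff: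
  assumes "f \<in> l2_space M" "g \<in> l2_space M"
  shows "(\<lambda>x. f x - g x) \<in> l2_space M"
  using l2_add[OF assms(1) l2_scale[OF assms(2), of "-1"]] by simp

lemma l2_combination:
  assumes "finite F" "\<And>i. i \<in> F \<Longrightarrow> g i \<in> l2_space M"
  shows "(\<lambda>x. \<Sum>i\<in>F. c i * g i x) \<in> l2_space M"
  using assms by (induction F rule: finite_induct) (auto intro!: l2_zero l2_add l2_scale)

lemma bounded_in_l2:
  assumes "finite_measure M" "f \<in> borel_measurable M" "\<And>x. norm (f x) \<le> B"
  shows "f \<in> l2_space M"
proof -
  interpret finite_measure M by fact
  have "norm ((norm (f x))\<^sup>2) \<le> B\<^sup>2" for x
    using power_mono[OF assms(3)[of x], of 2] by simp
  then have "integrable M (\<lambda>x. (norm (f x))\<^sup>2)"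
    using assms(2) by (intro integrable_const_bound[where B="B\<^sup>2"]) auto
  then show ?thesis using assms(2) by (simp add: l2_space_def)
qed

lemma l2_inner_commute: "l2_inner M g f = cnj (l2_inner M f g)"
  unfolding l2_inner_def Bochner_Integration.integral_cnj[symmetric] by (simp add: mult.commute)

lemma l2_inner_add_right:
  assumes "f \<in> l2_space M" "g \<in> l2_space M" "h \<in> l2_space M"
  shows "l2_inner M f (\<lambda>x. g x + h x) = l2_inner M f g + l2_inner M f h"
  using assms by (simp add: l2_inner_def l2_product_integrable distrib_left)

lemma l2_inner_diff_right:
  assumes "f \<in> l2_space M" "g \<in> l2_space M" "h \<in> l2_space M"
  shows "l2_inner M f (\<lambda>x. g x - h x) = l2_inner M f g - l2_inner M f h"
  using assms by (simp add: l2_inner_def l2_product_integrable right_diff_distrib)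

lemma l2_inner_scale_right: "l2_inner M f (\<lambda>x. c * g x) = c * l2_inner M f g"
proof -
  have "l2_inner M f (\<lambda>x. c * g x) = (\<integral>x. c * (cnj (f x) * g x) \<partial>M)"
    by (simp add: l2_inner_def mult.left_commute)
  then show ?thesis by (simp add: l2_inner_def)
qed

lemma l2_inner_zero_right [simp]: "l2_inner M f (\<lambda>x. 0) = 0"
  by (simp add: l2_inner_def)

lemma l2_inner_combination_right:
  assumes "finite F" "f \<in> l2_space M" "\<And>i. i \<in> F \<Longrightarrow> g i \<in> l2_space M"
  shows "l2_inner M f (\<lambda>x. \<Sum>i\<in>F. c i * g i x) = (\<Sum>i\<in>F. c i * l2_inner M f (g i))"
  using assms(1,3)
proof (induction F rule: finite_induct)
  case (insert i F)
  then show ?case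
    using l2_inner_add_right[OF assms(2) l2_scale l2_combination, of "g i" F g "c i" c]
    by (simp add: l2_inner_scale_right)
qed simp

lemma l2_inner_add_left:
  assumes "f \<in> l2_space M" "g \<in> l2_space M" "h \<in> l2_space M"
  shows "l2_inner M (\<lambda>x. g x + h x) f = l2_inner M g f + l2_inner M h f"
  using l2_inner_add_right[OF assms] l2_inner_commute[of M _ f] by (metis complex_cnj_add)

lemma l2_inner_diff_left:
  assumes "f \<in> l2_space M" "g \<in> l2_space M" "h \<in> l2_space M"
  shows "l2_inner M (\<lambda>x. g x - h x) f = l2_inner M g f - l2_inner M h f"
  using l2_inner_diff_right[OF assms] l2_inner_commute[of M _ f] by (metis complex_cnj_diff)

lemma l2_inner_scale_left: "l2_inner M (\<lambda>x. c * g x) f = cnj c * l2_inner M g f"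
  using l2_inner_scale_right[of M f c g] l2_inner_commute[of M _ f] by (metis complex_cnj_mult)

lemma l2_inner_combination_left:
  assumes "finite F" "f \<in> l2_space M" "\<And>i. i \<in> F \<Longrightarrow> g i \<in> l2_space M"
  shows "l2_inner M (\<lambda>x. \<Sum>i\<in>F. c i * g i x) f = (\<Sum>i\<in>F. cnj (c i) * l2_inner M (g i) f)"
  using l2_inner_combination_right[OF assms, where c=c]
  by (subst l2_inner_commute) (simp add: l2_inner_commute[of M f])

lemma l2_inner_cong:
  assumes "l2_eq M g g'" "g \<in> l2_space M" "g' \<in> l2_space M" "f \<in> l2_space M"
  shows "l2_inner M f g = l2_inner M f g'"
  unfolding l2_inner_def
proof (rule integral_cong_AE)
  show "AE x in M. cnj (f x) * g x = cnj (f x) * g' x"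
    using assms(1) unfolding l2_eq_def by eventually_elim simp
qed (use assms(2-4)[THEN l2_measurable] in \<open>auto intro!: borel_measurable_times measurable_cnj\<close>)

lemma l2_inner_self: "l2_inner M f f = complex_of_real ((l2_norm M f)\<^sup>2)"
proof -
  have "l2_inner M f f = (\<integral>x. complex_of_real ((norm (f x))\<^sup>2) \<partial>M)"
    unfolding l2_inner_def by (rule Bochner_Integration.integral_cong) 
      (auto simp: complex_norm_square mult.commute simp del: of_real_power)
  then show ?thesis
    by (simp add: l2_norm_def del: of_real_power)
qed

lemma l2_norm_nonneg [simp]: "0 \<le> l2_norm M f"
  by (simp add: l2_norm_def)

lemma l2_norm_cong:
  assumes "l2_eq M g g'" "g \<in> borel_measurable M" "g' \<in> borel_measurable M"
  shows "l2_norm M g = l2_norm M g'"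
proof -
  have "(\<integral>x. (norm (g x))\<^sup>2 \<partial>M) = (\<integral>x. (norm (g' x))\<^sup>2 \<partial>M)"
  proof (rule integral_cong_AE)
    show "AE x in M. (norm (g x))\<^sup>2 = (norm (g' x))\<^sup>2"
      using assms(1) unfolding l2_eq_def by eventually_elim simp
  qed (use assms(2,3) in measurable)
  then show ?thesis by (simp add: l2_norm_def)
qed

lemma l2_norm_scale: "l2_norm M (\<lambda>x. c * f x) = norm c * l2_norm M f"
  by (simp add: l2_norm_def norm_mult power_mult_distrib real_sqrt_mult)

lemma l2_norm_diff_commute: "l2_norm M (\<lambda>x. f x - g x) = l2_norm M (\<lambda>x. g x - f x)"
  by (simp add: l2_norm_def norm_minus_commute)

text \<open>The discriminant argument behind every Cauchy--Schwarz inequality for a positive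
  semidefinite complex form; taking the form and not the inner product makes it available for
  \<open>\<langle>f, S g\<rangle>\<close> with \<open>S\<close> positive.\<close>

lemma cauchy_schwarz_form:
  fixes a :: complex and p q :: real
  assumes form: "\<And>c. 0 \<le> p + 2 * Re (c * a) + (norm c)\<^sup>2 * q" and "0 \<le> p" "0 \<le> q"
  shows "(norm a)\<^sup>2 \<le> p * q"
proof (cases "q = 0")
  case True
  have "a = 0"
  proof (rule ccontr)
    assume "a \<noteq> 0"
    then have pos: "(norm a)\<^sup>2 > 0" by simp
    have "Re (complex_of_real s * cnj a * a) = s * (norm a)\<^sup>2" for s
      unfolding cmod_power2 by (simp add: power2_eq_square algebra_simps)
    then have "0 \<le> p + 2 * (- (p + 1) / (2 * (norm a)\<^sup>2) * (norm a)\<^sup>2)"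
      using form[of "complex_of_real (- (p + 1) / (2 * (norm a)\<^sup>2)) * cnj a"] True by simp
    also have "\<dots> = - 1"
      using pos by (simp add: field_simps)
    finally show False by simp
  qed
  then show ?thesis using True by simp
next
  case False
  then have q: "q > 0" using assms by simp
  have "0 \<le> p + 2 * Re (- (cnj a / q) * a) + (norm (- (cnj a / q)))\<^sup>2 * q"
    by (rule form)
  also have "Re (- (cnj a / q) * a) = - ((norm a)\<^sup>2 / q)"
    unfolding cmod_power2 using q by (simp add: power2_eq_square field_simps)
  also have "(norm (- (cnj a / q)))\<^sup>2 * q = (norm a)\<^sup>2 / q"
    using q by (simp add: norm_divide power_divide power2_eq_square)
  finally show ?thesis using q by (simp add: field_simps)
qed

lemma l2_cauchy_schwarz:
  assumes "f \<in> l2_space M" "g \<in> l2_space M"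
  shows "norm (l2_inner M f g) \<le> l2_norm M f * l2_norm M g"
proof -
  have "(norm (l2_inner M f g))\<^sup>2 \<le> (l2_norm M f)\<^sup>2 * (l2_norm M g)\<^sup>2"
  proof (rule cauchy_schwarz_form)
    fix c
    let ?h = "\<lambda>x. f x + c * g x"
    have "l2_inner M ?h ?h = l2_inner M f f + c * l2_inner M f g + cnj c * cnj (l2_inner M f g)
        + c * cnj c * l2_inner M g g"
      using assms by (simp add: l2_inner_add_left l2_inner_add_right l2_scale l2_add
          l2_inner_scale_left l2_inner_scale_right algebra_simps flip: l2_inner_commute)
    also have "c * cnj c = complex_of_real ((norm c)\<^sup>2)"
      by (rule complex_norm_square[symmetric])
    also have "l2_inner M f f + c * l2_inner M f g + cnj c * cnj (l2_inner M f g)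
        + complex_of_real ((norm c)\<^sup>2) * l2_inner M g g
      = complex_of_real ((l2_norm M f)\<^sup>2 + 2 * Re (c * l2_inner M f g)
        + (norm c)\<^sup>2 * (l2_norm M g)\<^sup>2)"
      by (simp add: l2_inner_self complex_eq_iff)
    finally show "0 \<le> (l2_norm M f)\<^sup>2 + 2 * Re (c * l2_inner M f g)
        + (norm c)\<^sup>2 * (l2_norm M g)\<^sup>2"
      unfolding l2_inner_self of_real_eq_iff by (metis zero_le_power2)
  qed auto
  then show ?thesis
    by (metis l2_norm_nonneg mult_nonneg_nonneg norm_ge_zero power2_le_imp_le power_mult_distrib)
qed

lemma l2_triangle:
  assumes "f \<in> l2_space M" "g \<in> l2_space M"
  shows "l2_norm M (\<lambda>x. f x + g x) \<le> l2_norm M f + l2_norm M g"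
proof (rule power2_le_imp_le)
  let ?h = "\<lambda>x. f x + g x"
  have "l2_inner M ?h ?h = l2_inner M f f + l2_inner M f g + cnj (l2_inner M f g) + l2_inner M g g"
    using assms by (simp add: l2_inner_add_left l2_inner_add_right l2_add flip: l2_inner_commute)
  then have "(l2_norm M ?h)\<^sup>2 = (l2_norm M f)\<^sup>2 + 2 * Re (l2_inner M f g) + (l2_norm M g)\<^sup>2"
    by (simp add: l2_inner_self complex_eq_iff)
  also have "\<dots> \<le> (l2_norm M f)\<^sup>2 + 2 * (l2_norm M f * l2_norm M g) + (l2_norm M g)\<^sup>2"
    using l2_cauchy_schwarz[OF assms] complex_Re_le_cmod[of "l2_inner M f g"] by simp
  finally show "(l2_norm M ?h)\<^sup>2 \<le> (l2_norm M f + l2_norm M g)\<^sup>2"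
    by (simp add: power2_sum)
qed simp

lemma l2_triangle_diff:
  assumes "f \<in> l2_space M" "g \<in> l2_space M" "h \<in> l2_space M"
  shows "l2_norm M (\<lambda>x. f x - h x) \<le> l2_norm M (\<lambda>x. f x - g x) + l2_norm M (\<lambda>x. g x - h x)"
  using l2_triangle[OF l2_diff[OF assms(1,2)] l2_diff[OF assms(2,3)]] by simp

lemma l2_norm_le_approx:
  assumes "f \<in> l2_space M" "g \<in> l2_space M"
  shows "l2_norm M f \<le> l2_norm M (\<lambda>x. f x - g x) + l2_norm M g"
  using l2_triangle[OF l2_diff[OF assms] assms(2)] by simp

lemma l2_norm_combination_le:
  assumes "finite F" "\<And>i. i \<in> F \<Longrightarrow> g i \<in> l2_space M"
  shows "l2_norm M (\<lambda>x. \<Sum>i\<in>F. c i * g i x) \<le> (\<Sum>i\<in>F. norm (c i) * l2_norm M (g i))"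
  using assms
proof (induction F rule: finite_induct)
  case empty
  then show ?case by (simp add: l2_norm_def)
next
  case (insert i F)
  have "l2_norm M (\<lambda>x. c i * g i x + (\<Sum>i\<in>F. c i * g i x))
      \<le> l2_norm M (\<lambda>x. c i * g i x) + l2_norm M (\<lambda>x. \<Sum>i\<in>F. c i * g i x)"
    using insert by (intro l2_triangle l2_scale l2_combination) auto
  then show ?case using insert by (simp add: l2_norm_scale)
qed

lemma l2_norm_bounded:
  assumes "prob_space M" "f \<in> borel_measurable M" "AE x in M. norm (f x) \<le> B" "0 \<le> B"
  shows "l2_norm M f \<le> B"
proof -
  interpret prob_space M by fact
  have "(\<integral>x. (norm (f x))\<^sup>2 \<partial>M) \<le> (\<integral>x. B\<^sup>2 \<partial>M)"
  proof (rule integral_mono_AE)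
    show bd: "AE x in M. (norm (f x))\<^sup>2 \<le> B\<^sup>2"
      using assms(3) by eventually_elim (auto intro: power_mono)
    then show "integrable M (\<lambda>x. (norm (f x))\<^sup>2)"
      using assms(2) by (intro integrable_const_bound[where B="B\<^sup>2"]) auto
  qed simp
  then show ?thesis
    using assms(4) by (simp add: l2_norm_def prob_space real_le_lsqrt)
qed

text \<open>Inner products depend continuously on both arguments even when the measure varies with the
  index; this is what carries uniformly convergent eigenfunctions through the sampling limit.\<close>

lemma tendsto_l2_inner_perturb:
  fixes M :: "'i \<Rightarrow> 'a measure"
  assumes l2: "\<forall>\<^sub>F n in F. f n \<in> l2_space (M n) \<and> f' n \<in> l2_space (M n)
                         \<and> g n \<in> l2_space (M n) \<and> g' n \<in> l2_space (M n)"
    and df: "((\<lambda>n. l2_norm (M n) (\<lambda>x. f n x - f' n x)) \<longlongrightarrow> 0) F"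
    and dg: "((\<lambda>n. l2_norm (M n) (\<lambda>x. g n x - g' n x)) \<longlongrightarrow> 0) F"
    and bf: "\<forall>\<^sub>F n in F. l2_norm (M n) (f' n) \<le> B"
    and bg: "\<forall>\<^sub>F n in F. l2_norm (M n) (g' n) \<le> B"
    and lim: "((\<lambda>n. l2_inner (M n) (f' n) (g' n)) \<longlongrightarrow> c) F"
  shows "((\<lambda>n. l2_inner (M n) (f n) (g n)) \<longlongrightarrow> c) F"
proof -
  let ?d = "\<lambda>n. l2_norm (M n) (\<lambda>x. f n x - f' n x)"
  let ?e = "\<lambda>n. l2_norm (M n) (\<lambda>x. g n x - g' n x)"
  have "((\<lambda>n. l2_inner (M n) (f n) (g n) - l2_inner (M n) (f' n) (g' n)) \<longlongrightarrow> 0) F"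
  proof (rule Lim_null_comparison)
    show "((\<lambda>n. ?d n * ?e n + ?d n * B + B * ?e n) \<longlongrightarrow> 0) F"
      using df dg by (auto intro!: tendsto_eq_intros)
    show "\<forall>\<^sub>F n in F. norm (l2_inner (M n) (f n) (g n) - l2_inner (M n) (f' n) (g' n))
        \<le> ?d n * ?e n + ?d n * B + B * ?e n"
      using l2 bf bg
    proof eventually_elim
      case (elim n)
      let ?u = "\<lambda>x. f n x - f' n x" and ?v = "\<lambda>x. g n x - g' n x"
      have l2': "f' n \<in> l2_space (M n)" "g' n \<in> l2_space (M n)"
        and B: "l2_norm (M n) (f' n) \<le> B" "l2_norm (M n) (g' n) \<le> B"
        using elim by blast+
      have uv: "?u \<in> l2_space (M n)" "?v \<in> l2_space (M n)"
        using elim by (auto intro: l2_diff)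
      have split: "l2_inner (M n) (f n) (g n) - l2_inner (M n) (f' n) (g' n)
          = l2_inner (M n) ?u ?v + l2_inner (M n) ?u (g' n) + l2_inner (M n) (f' n) ?v"
        using elim uv by (simp add: l2_inner_diff_left l2_inner_diff_right)
      have "norm (l2_inner (M n) (f n) (g n) - l2_inner (M n) (f' n) (g' n))
          \<le> norm (l2_inner (M n) ?u ?v) + norm (l2_inner (M n) ?u (g' n))
          + norm (l2_inner (M n) (f' n) ?v)"
        unfolding split by (meson add_mono norm_triangle_ineq order_refl order_trans)
      also have "\<dots> \<le> ?d n * ?e n + ?d n * l2_norm (M n) (g' n) + l2_norm (M n) (f' n) * ?e n"
        using l2_cauchy_schwarz[OF uv] l2_cauchy_schwarz[OF uv(1) l2'(2)]
          l2_cauchy_schwarz[OF l2'(1) uv(2)] by (intro add_mono)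
      also have "\<dots> \<le> ?d n * ?e n + ?d n * B + B * ?e n"
        using B by (intro add_mono mult_left_mono mult_right_mono order_refl l2_norm_nonneg)
      finally show ?case .
    qed
  qed
  from tendsto_add[OF this lim] show ?thesis by simp
qed

text \<open>The part of \<^const>\<open>l2_bounded_op\<close> that traces over finite-dimensional subspaces depend on;
  continuity is automatic there.\<close>

definition l2_linear :: "'a measure \<Rightarrow> 'a l2_op \<Rightarrow> bool" where
  "l2_linear M T \<longleftrightarrow>
     (\<forall>f\<in>l2_space M. T f \<in> l2_space M) \<and>
     (\<forall>f\<in>l2_space M. \<forall>g\<in>l2_space M. l2_eq M (T (\<lambda>x. f x + g x)) (\<lambda>x. T f x + T g x)) \<and>
     (\<forall>c. \<forall>f\<in>l2_space M. l2_eq M (T (\<lambda>x. c * f x)) (\<lambda>x. c * T f x))"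

lemma l2_bounded_op_linear: "l2_bounded_op M (l2_space M) T \<Longrightarrow> l2_linear M T"
  by (simp add: l2_bounded_op_def l2_linear_def)

lemma l2_linear_closed: "l2_linear M T \<Longrightarrow> f \<in> l2_space M \<Longrightarrow> T f \<in> l2_space M"
  by (simp add: l2_linear_def)

lemma l2_linear_add:
  "l2_linear M T \<Longrightarrow> f \<in> l2_space M \<Longrightarrow> g \<in> l2_space M \<Longrightarrow>
    l2_eq M (T (\<lambda>x. f x + g x)) (\<lambda>x. T f x + T g x)"
  by (simp add: l2_linear_def)

lemma l2_linear_scale:
  "l2_linear M T \<Longrightarrow> f \<in> l2_space M \<Longrightarrow> l2_eq M (T (\<lambda>x. c * f x)) (\<lambda>x. c * T f x)"
  by (simp add: l2_linear_def)

lemma l2_linear_combination: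
  assumes T: "l2_linear M T" and "finite F" "\<And>i. i \<in> F \<Longrightarrow> g i \<in> l2_space M"
  shows "l2_eq M (T (\<lambda>x. \<Sum>i\<in>F. c i * g i x)) (\<lambda>x. \<Sum>i\<in>F. c i * T (g i) x)"
  using assms(2,3)
proof (induction F rule: finite_induct)
  case empty
  from l2_linear_scale[OF T l2_zero, of 0] show ?case by simp
next
  case (insert i F)
  have "l2_eq M (T (\<lambda>x. c i * g i x + (\<Sum>i\<in>F. c i * g i x)))
      (\<lambda>x. T (\<lambda>x. c i * g i x) x + T (\<lambda>x. \<Sum>i\<in>F. c i * g i x) x)"
    using insert by (intro l2_linear_add[OF T] l2_scale l2_combination) auto
  moreover have "l2_eq M (T (\<lambda>x. c i * g i x)) (\<lambda>x. c i * T (g i) x)"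
    using insert by (intro l2_linear_scale[OF T]) auto
  moreover have "l2_eq M (T (\<lambda>x. \<Sum>i\<in>F. c i * g i x)) (\<lambda>x. \<Sum>i\<in>F. c i * T (g i) x)"
    using insert by blast
  ultimately have "l2_eq M (T (\<lambda>x. c i * g i x + (\<Sum>i\<in>F. c i * g i x)))
      (\<lambda>x. c i * T (g i) x + (\<Sum>i\<in>F. c i * T (g i) x))"
    unfolding l2_eq_def by eventually_elim simp
  then show ?case using insert by simp
qed

lemma l2_linear_inner_combination:
  assumes T: "l2_linear M T" and "finite F" "\<And>i. i \<in> F \<Longrightarrow> g i \<in> l2_space M" "h \<in> l2_space M"
  shows "l2_inner M h (T (\<lambda>x. \<Sum>i\<in>F. c i * g i x)) = (\<Sum>i\<in>F. c i * l2_inner M h (T (g i)))"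
proof -
  have "l2_inner M h (T (\<lambda>x. \<Sum>i\<in>F. c i * g i x)) = l2_inner M h (\<lambda>x. \<Sum>i\<in>F. c i * T (g i) x)"
    using assms by (intro l2_inner_cong l2_linear_combination l2_combination l2_linear_closed[OF T])
  also have "\<dots> = (\<Sum>i\<in>F. c i * l2_inner M h (T (g i)))"
    using assms by (intro l2_inner_combination_right) (auto intro: l2_linear_closed[OF T])
  finally show ?thesis .
qed

section \<open>Orthonormal bases and traces\<close>

definition l2_subspace :: "'a measure \<Rightarrow> ('a \<Rightarrow> complex) set \<Rightarrow> bool" where
  "l2_subspace M V \<longleftrightarrow> V \<subseteq> l2_space M \<and> (\<lambda>x. 0) \<in> V \<and>
     (\<forall>f\<in>V. \<forall>g\<in>V. (\<lambda>x. f x + g x) \<in> V) \<and> (\<forall>c. \<forall>f\<in>V. (\<lambda>x. c * f x) \<in> V)"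

lemma l2_subspace_space: "l2_subspace M (l2_space M)"
  by (simp add: l2_subspace_def l2_zero l2_add l2_scale)

lemma l2_subspace_l2: "l2_subspace M V \<Longrightarrow> f \<in> V \<Longrightarrow> f \<in> l2_space M"
  by (auto simp: l2_subspace_def)

lemma l2_subspace_add: "l2_subspace M V \<Longrightarrow> f \<in> V \<Longrightarrow> g \<in> V \<Longrightarrow> (\<lambda>x. f x + g x) \<in> V"
  by (simp add: l2_subspace_def)

lemma l2_subspace_scale: "l2_subspace M V \<Longrightarrow> f \<in> V \<Longrightarrow> (\<lambda>x. c * f x) \<in> V"
  by (simp add: l2_subspace_def)

lemma l2_subspace_combination:
  assumes "l2_subspace M V" "finite F" "\<And>i. i \<in> F \<Longrightarrow> g i \<in> V"
  shows "(\<lambda>x. \<Sum>i\<in>F. c i * g i x) \<in> V"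
  using assms(2,3)
proof (induction F rule: finite_induct)
  case (insert i F)
  have "(\<lambda>x. c i * g i x) \<in> V" "(\<lambda>x. \<Sum>i\<in>F. c i * g i x) \<in> V"
    using insert assms(1) by (auto simp: l2_subspace_def)
  then show ?case
    using insert assms(1) by (simp add: l2_subspace_def)
qed (use assms(1) in \<open>simp add: l2_subspace_def\<close>)

lemma l2_subspace_diff:
  assumes "l2_subspace M V" "f \<in> V" "g \<in> V"
  shows "(\<lambda>x. f x - g x) \<in> V"
  using l2_subspace_add[OF assms(1,2) l2_subspace_scale[OF assms(1,3), of "-1"]] by simp

lemma l2_norm_le_of_orthogonal:
  assumes "u \<in> l2_space M" "v \<in> l2_space M" "l2_inner M u v = 0"
  shows "l2_norm M u \<le> l2_norm M (\<lambda>x. u x + v x)"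
proof (rule power2_le_imp_le)
  have "l2_inner M (\<lambda>x. u x + v x) (\<lambda>x. u x + v x) = l2_inner M u u + l2_inner M v v"
    using assms l2_inner_commute[of M v u] by (simp add: l2_inner_add_left l2_inner_add_right l2_add)
  then have "complex_of_real ((l2_norm M (\<lambda>x. u x + v x))\<^sup>2)
      = complex_of_real ((l2_norm M u)\<^sup>2 + (l2_norm M v)\<^sup>2)"
    by (simp add: l2_inner_self)
  then show "(l2_norm M u)\<^sup>2 \<le> (l2_norm M (\<lambda>x. u x + v x))\<^sup>2"
    unfolding of_real_eq_iff by simp
qed simp

lemma l2_onb_inner:
  "l2_onb M V I e \<Longrightarrow> i \<in> I \<Longrightarrow> j \<in> I \<Longrightarrow> l2_inner M (e i) (e j) = (if i = j then 1 else 0)"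
  unfolding l2_onb_def by blast

lemma l2_onb_in: "l2_onb M V I e \<Longrightarrow> i \<in> I \<Longrightarrow> e i \<in> V"
  unfolding l2_onb_def by blast

context
  fixes M :: "'a measure" and V I and e :: "'i \<Rightarrow> 'a \<Rightarrow> complex"
  assumes V: "V \<subseteq> l2_space M" and onb: "l2_onb M V I e"
begin

private lemma e_l2: "i \<in> I \<Longrightarrow> e i \<in> l2_space M"
  using V l2_onb_in[OF onb] by blast

private lemma partial_l2: "finite F \<Longrightarrow> F \<subseteq> I \<Longrightarrow> (\<lambda>x. \<Sum>i\<in>F. c i * e i x) \<in> l2_space M"
  by (rule l2_combination) (auto intro: e_l2)

lemma onb_inner_combination:
  assumes "finite F" "F \<subseteq> I" "j \<in> F"
  shows "l2_inner M (e j) (\<lambda>x. \<Sum>i\<in>F. c i * e i x) = c j"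
proof -
  have "l2_inner M (e j) (\<lambda>x. \<Sum>i\<in>F. c i * e i x) = (\<Sum>i\<in>F. c i * l2_inner M (e j) (e i))"
    using assms by (intro l2_inner_combination_right) (auto intro: e_l2)
  also have "\<dots> = (\<Sum>i\<in>F. if j = i then c i else 0)"
    using assms by (intro sum.cong) (auto simp: l2_onb_inner[OF onb] subset_iff)
  finally show ?thesis using assms by simp
qed

private lemma residual_orthogonal:
  assumes "finite F" "F \<subseteq> I" "f \<in> l2_space M"
  shows "l2_inner M (\<lambda>x. f x - (\<Sum>i\<in>F. l2_inner M (e i) f * e i x)) (\<lambda>x. \<Sum>i\<in>F. c i * e i x) = 0"
proof -
  let ?P = "\<lambda>x. \<Sum>i\<in>F. l2_inner M (e i) f * e i x"
  have res: "(\<lambda>x. f x - ?P x) \<in> l2_space M"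
    using assms by (intro l2_diff partial_l2)
  have "l2_inner M (\<lambda>x. f x - ?P x) (e j) = 0" if "j \<in> F" for j
  proof -
    have "l2_inner M (e j) (\<lambda>x. f x - ?P x) = 0"
      using assms that onb_inner_combination[OF assms(1,2) that]
      by (subst l2_inner_diff_right) (auto intro: e_l2 partial_l2)
    then show ?thesis by (subst l2_inner_commute) simp
  qed
  then show ?thesis
    using assms res by (subst l2_inner_combination_right) (auto intro: e_l2)
qed

lemma onb_best_approximation:
  assumes "finite F" "F \<subseteq> I" "f \<in> l2_space M"
  shows "l2_norm M (\<lambda>x. f x - (\<Sum>i\<in>F. l2_inner M (e i) f * e i x))
       \<le> l2_norm M (\<lambda>x. f x - (\<Sum>i\<in>F. c i * e i x))"
proof -
  let ?P = "\<lambda>x. \<Sum>i\<in>F. l2_inner M (e i) f * e i x"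
  let ?v = "\<lambda>x. \<Sum>i\<in>F. (l2_inner M (e i) f - c i) * e i x"
  have "l2_norm M (\<lambda>x. f x - ?P x) \<le> l2_norm M (\<lambda>x. (f x - ?P x) + ?v x)"
    using assms by (intro l2_norm_le_of_orthogonal residual_orthogonal l2_diff partial_l2)
  also have "(\<lambda>x. (f x - ?P x) + ?v x) = (\<lambda>x. f x - (\<Sum>i\<in>F. c i * e i x))"
    by (simp add: left_diff_distrib sum_subtractf)
  finally show ?thesis .
qed

lemma onb_partial_norm:
  assumes "finite F" "F \<subseteq> I" "f \<in> l2_space M"
  shows "l2_norm M (\<lambda>x. \<Sum>i\<in>F. l2_inner M (e i) f * e i x) \<le> l2_norm M f"
proof -
  let ?P = "\<lambda>x. \<Sum>i\<in>F. l2_inner M (e i) f * e i x"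
  have "l2_inner M ?P (\<lambda>x. f x - ?P x) = 0"
    using residual_orthogonal[OF assms, of "\<lambda>i. l2_inner M (e i) f"]
    by (subst l2_inner_commute) simp
  then have "l2_norm M ?P \<le> l2_norm M (\<lambda>x. ?P x + (f x - ?P x))"
    using assms by (intro l2_norm_le_of_orthogonal l2_diff partial_l2)
  then show ?thesis by simp
qed

lemma onb_partial_norm_square:
  assumes "finite F" "F \<subseteq> I" "f \<in> l2_space M"
  shows "(l2_norm M (\<lambda>x. \<Sum>i\<in>F. l2_inner M (e i) f * e i x))\<^sup>2
       = (\<Sum>i\<in>F. (norm (l2_inner M (e i) f))\<^sup>2)"
proof -
  let ?P = "\<lambda>x. \<Sum>i\<in>F. l2_inner M (e i) f * e i x"
  have "complex_of_real ((l2_norm M ?P)\<^sup>2) = l2_inner M ?P ?P"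
    by (simp add: l2_inner_self)
  also have "\<dots> = (\<Sum>i\<in>F. cnj (l2_inner M (e i) f) * l2_inner M (e i) ?P)"
    using assms by (intro l2_inner_combination_left partial_l2) (auto intro: e_l2)
  also have "\<dots> = (\<Sum>i\<in>F. complex_of_real ((norm (l2_inner M (e i) f))\<^sup>2))"
  proof (rule sum.cong)
    fix i assume "i \<in> F"
    then have "l2_inner M (e i) ?P = l2_inner M (e i) f"
      by (rule onb_inner_combination[OF assms(1,2)])
    then show "cnj (l2_inner M (e i) f) * l2_inner M (e i) ?P
        = complex_of_real ((norm (l2_inner M (e i) f))\<^sup>2)"
      by (simp only: complex_norm_square mult.commute)
  qed simp
  finally show ?thesis
    unfolding of_real_sum[symmetric] of_real_eq_iff .
qed

lemma onb_expansion:
  assumes f: "f \<in> V"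
  shows "((\<lambda>F. l2_norm M (\<lambda>x. f x - (\<Sum>i\<in>F. l2_inner M (e i) f * e i x))) \<longlongrightarrow> 0)
           (finite_subsets_at_top I)"
proof (rule tendstoI)
  fix \<epsilon> :: real assume "\<epsilon> > 0"
  have f2: "f \<in> l2_space M" using V f by blast
  obtain F c where F: "finite F" "F \<subseteq> I"
    and less: "l2_norm M (\<lambda>x. f x - (\<Sum>i\<in>F. c i * e i x)) < \<epsilon>"
    using onb f \<open>\<epsilon> > 0\<close> unfolding l2_onb_def by blast
  have "l2_norm M (\<lambda>x. f x - (\<Sum>i\<in>G. l2_inner M (e i) f * e i x)) < \<epsilon>"
    if G: "finite G" "F \<subseteq> G" "G \<subseteq> I" for G
  proof -
    have "(\<Sum>i\<in>G. (if i \<in> F then c i else 0) * e i x) = (\<Sum>i\<in>F. c i * e i x)" for x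
      using G by (intro sum.mono_neutral_cong_right) auto
    then show ?thesis
      using onb_best_approximation[OF G(1,3) f2, of "\<lambda>i. if i \<in> F then c i else 0"] less by simp
  qed
  then have "\<forall>\<^sub>F F in finite_subsets_at_top I.
      l2_norm M (\<lambda>x. f x - (\<Sum>i\<in>F. l2_inner M (e i) f * e i x)) < \<epsilon>"
    unfolding eventually_finite_subsets_at_top using F by (intro exI[of _ F] conjI allI impI) simp_all
  then show "\<forall>\<^sub>F F in finite_subsets_at_top I.
      dist (l2_norm M (\<lambda>x. f x - (\<Sum>i\<in>F. l2_inner M (e i) f * e i x))) 0 < \<epsilon>"
    by simp
qed

end

lemma onb_expansion_sequence:
  assumes "l2_onb M V (UNIV :: nat set) e" "V \<subseteq> l2_space M" "f \<in> V"
  shows "(\<lambda>n. l2_norm M (\<lambda>x. f x - (\<Sum>i<n. l2_inner M (e i) f * e i x))) \<longlonglongrightarrow> 0"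
proof -
  have "filterlim (\<lambda>n. {..<n}) (finite_subsets_at_top (UNIV :: nat set)) sequentially"
    by (rule filterlim_lessThan_at_top)
  from filterlim_compose[OF onb_expansion[OF assms(2,1,3)] this] show ?thesis .
qed

lemma eventually_in_finite_subsets: "\<forall>\<^sub>F F in finite_subsets_at_top I. finite F \<and> F \<subseteq> I"
  by (rule eventually_finite_subsets_at_top_weakI) simp

text \<open>The form in which dominated convergence is applied to every series over the weights of a state.\<close>

lemma tendsto_suminf_dominated:
  fixes a :: "'i \<Rightarrow> nat \<Rightarrow> complex"
  assumes "\<And>j. ((\<lambda>n. a n j) \<longlongrightarrow> b j) F" "\<forall>\<^sub>F n in F. \<forall>j. norm (a n j) \<le> h j" "summable h" "F \<noteq> bot"
  shows "((\<lambda>n. \<Sum>j. a n j) \<longlongrightarrow> (\<Sum>j. b j)) F" "summable (\<lambda>j. norm (b j))"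
proof -
  have ev: "eventually (\<lambda>(j, n). norm (a n j) \<le> h j) (at_top \<times>\<^sub>F F)"
    unfolding eventually_prod_filter using assms(2)
    by (intro exI[of _ "\<lambda>j. True"] exI[of _ "\<lambda>n. \<forall>j. norm (a n j) \<le> h j"]) auto
  show "((\<lambda>n. \<Sum>j. a n j) \<longlongrightarrow> (\<Sum>j. b j)) F" "summable (\<lambda>j. norm (b j))"
    using tannerys_theorem[of "\<lambda>j n. a n j" b F h, OF assms(1) ev assms(3,4)] by auto
qed

text \<open>Expanding \<open>\<langle>e\<^sub>i, T e\<^sub>i\<rangle>\<close> over a finite set \<open>F\<close> of basis indices gives
  \<open>\<Sum>\<^sub>j s\<^sub>j \<lambda>\<^sub>j (P\<^sub>F z\<^sub>j)\<close>, where \<open>P\<^sub>F\<close> is the orthogonal projection onto the span of those basis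
  vectors. Since \<open>P\<^sub>F z\<^sub>j\<close> tends to \<open>z\<^sub>j\<close> and the functionals are uniformly bounded, dominated
  convergence removes the basis from the limit, with no double series to rearrange.\<close>

lemma has_trace_nuclear:
  fixes s :: "nat \<Rightarrow> real" and lam :: "nat \<Rightarrow> ('a \<Rightarrow> complex) \<Rightarrow> complex"
  assumes V: "l2_subspace M V"
    and T: "\<And>f. f \<in> V \<Longrightarrow> (\<lambda>j. complex_of_real (s j) * l2_inner M f (z j) * lam j f) sums l2_inner M f (T f)"
    and add: "\<And>j f g. f \<in> V \<Longrightarrow> g \<in> V \<Longrightarrow> lam j (\<lambda>x. f x + g x) = lam j f + lam j g"
    and scale: "\<And>j c f. f \<in> V \<Longrightarrow> lam j (\<lambda>x. c * f x) = c * lam j f"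
    and bound: "\<And>j f. f \<in> V \<Longrightarrow> norm (lam j f) \<le> C * l2_norm M f"
    and z: "\<And>j. z j \<in> V" "\<And>j. l2_norm M (z j) \<le> D"
    and s: "summable (\<lambda>j. \<bar>s j\<bar>)" and C: "0 \<le> C"
  shows "l2_has_trace M V T (\<Sum>j. complex_of_real (s j) * lam j (z j))"
  unfolding l2_has_trace_def
proof (intro allI impI)
  fix I :: "nat set" and e assume onb: "l2_onb M V I e"
  have V2: "V \<subseteq> l2_space M" using V by (simp add: l2_subspace_def)
  define P where "P F f = (\<lambda>x. \<Sum>i\<in>F. l2_inner M (e i) f * e i x)" for F f
  have PV: "P F f \<in> V" if "finite F" "F \<subseteq> I" for F f
    unfolding P_def using that l2_onb_in[OF onb] by (intro l2_subspace_combination[OF V]) auto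
  have lam_P: "lam j (P F f) = (\<Sum>i\<in>F. l2_inner M (e i) f * lam j (e i))"
    if "finite F" "F \<subseteq> I" for j F f
    using that unfolding P_def
  proof (induction F rule: finite_induct)
    case empty
    show ?case using scale[of "\<lambda>x. 0" j 0] V by (simp add: l2_subspace_def)
  next
    case (insert i F)
    have "(\<lambda>x. l2_inner M (e i) f * e i x) \<in> V"
      using insert V l2_onb_in[OF onb, of i] by (simp add: l2_subspace_def)
    then show ?case
      using insert add[of "\<lambda>x. l2_inner M (e i) f * e i x" "P F f"] PV[of F f] l2_onb_in[OF onb, of i]
      by (simp add: P_def scale)
  qed
  have lam_diff: "lam j (\<lambda>x. f x - g x) = lam j f - lam j g" if "f \<in> V" "g \<in> V" for j f g
  proof -
    have "lam j (\<lambda>x. f x + -1 * g x) = lam j f + lam j (\<lambda>x. -1 * g x)"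
      by (intro add that l2_subspace_scale[OF V])
    then show ?thesis
      using scale[OF that(2), of j "-1"] by simp
  qed
  have "((\<lambda>F. \<Sum>j. complex_of_real (s j) * lam j (P F (z j)))
      \<longlongrightarrow> (\<Sum>j. complex_of_real (s j) * lam j (z j))) (finite_subsets_at_top I)"
  proof (rule tendsto_suminf_dominated)
    fix j
    have zj: "z j \<in> l2_space M" using z V2 by blast
    have "((\<lambda>F. lam j (P F (z j)) - lam j (z j)) \<longlongrightarrow> 0) (finite_subsets_at_top I)"
    proof (rule Lim_null_comparison)
      show "((\<lambda>F. C * l2_norm M (\<lambda>x. z j x - P F (z j) x)) \<longlongrightarrow> 0) (finite_subsets_at_top I)"
        using tendsto_mult_left[OF onb_expansion[OF V2 onb z(1)[of j]], of C] by (simp add: P_def)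
      show "\<forall>\<^sub>F F in finite_subsets_at_top I. norm (lam j (P F (z j)) - lam j (z j))
          \<le> C * l2_norm M (\<lambda>x. z j x - P F (z j) x)"
        using eventually_in_finite_subsets
      proof eventually_elim
        case (elim F)
        have PF: "P F (z j) \<in> V" using PV elim by blast
        have "norm (lam j (\<lambda>x. P F (z j) x - z j x)) \<le> C * l2_norm M (\<lambda>x. P F (z j) x - z j x)"
          using PF z(1) by (intro bound l2_subspace_diff[OF V])
        then show ?case
          using PF z(1) by (simp add: lam_diff l2_norm_diff_commute)
      qed
    qed
    then have "((\<lambda>F. lam j (P F (z j))) \<longlongrightarrow> lam j (z j)) (finite_subsets_at_top I)"
      by (rule LIM_zero_cancel)
    then show "((\<lambda>F. complex_of_real (s j) * lam j (P F (z j))) \<longlongrightarrow> complex_of_real (s j) * lam j (z j))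
        (finite_subsets_at_top I)"
      by (rule tendsto_mult_left)
  next
    show "\<forall>\<^sub>F F in finite_subsets_at_top I.
        \<forall>j. norm (complex_of_real (s j) * lam j (P F (z j))) \<le> \<bar>s j\<bar> * (C * D)"
      using eventually_in_finite_subsets
    proof eventually_elim
      case (elim F)
      have "norm (lam j (P F (z j))) \<le> C * D" for j
      proof -
        have "norm (lam j (P F (z j))) \<le> C * l2_norm M (P F (z j))"
          using elim by (intro bound PV) auto
        also have "l2_norm M (P F (z j)) \<le> l2_norm M (z j)"
          unfolding P_def using elim z(1) V2 by (intro onb_partial_norm[OF V2 onb]) auto
        also have "\<dots> \<le> D" by (rule z)
        finally show ?thesis using C by (simp add: mult_left_mono)
      qed
      then show ?case by (simp add: norm_mult mult_left_mono)
    qed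
    show "summable (\<lambda>j. \<bar>s j\<bar> * (C * D))" using s by (rule summable_mult2)
  qed simp
  moreover have "\<forall>\<^sub>F F in finite_subsets_at_top I. (\<Sum>j. complex_of_real (s j) * lam j (P F (z j)))
      = (\<Sum>i\<in>F. l2_inner M (e i) (T (e i)))"
    using eventually_in_finite_subsets
  proof eventually_elim
    case (elim F)
    have "(\<lambda>j. \<Sum>i\<in>F. complex_of_real (s j) * l2_inner M (e i) (z j) * lam j (e i))
        sums (\<Sum>i\<in>F. l2_inner M (e i) (T (e i)))"
      using elim l2_onb_in[OF onb] by (intro sums_sum T) auto
    moreover have "(\<Sum>i\<in>F. complex_of_real (s j) * l2_inner M (e i) (z j) * lam j (e i))
        = complex_of_real (s j) * lam j (P F (z j))" for j
      using elim by (simp add: lam_P sum_distrib_left mult.assoc)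
    ultimately show ?case by (simp add: sums_iff)
  qed
  ultimately show "((\<lambda>i. l2_inner M (e i) (T (e i))) has_sum (\<Sum>j. complex_of_real (s j) * lam j (z j))) I"
    unfolding has_sum_def by (rule Lim_transform_eventually)
qed

lemma l2_trace_eq:
  assumes "l2_has_trace M V T c" "l2_onb M V (I :: nat set) e"
  shows "l2_trace M V T = c"
  unfolding l2_trace_def
proof (rule the_equality)
  fix c' assume "l2_has_trace M V T c'"
  then show "c' = c"
    using assms has_sum_unique unfolding l2_has_trace_def by blast
qed fact

section \<open>Positive operators and the decomposition of the state\<close>

lemma l2_inner_cong_left:
  assumes "l2_eq M g g'" "g \<in> l2_space M" "g' \<in> l2_space M" "f \<in> l2_space M"
  shows "l2_inner M g f = l2_inner M g' f"
  using l2_inner_cong[OF assms] l2_inner_commute[of M _ f] by metis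

lemma l2_linear_form_expand:
  assumes S: "l2_linear M S" and f: "f \<in> l2_space M" and g: "g \<in> l2_space M"
  shows "l2_inner M (\<lambda>x. f x + c * g x) (S (\<lambda>x. f x + c * g x))
       = l2_inner M f (S f) + c * l2_inner M f (S g) + cnj c * l2_inner M g (S f)
         + c * cnj c * l2_inner M g (S g)"
proof -
  let ?h = "\<lambda>x. f x + c * g x"
  have l2: "?h \<in> l2_space M" "(\<lambda>x. c * g x) \<in> l2_space M" "S f \<in> l2_space M" "S g \<in> l2_space M"
    "(\<lambda>x. c * S g x) \<in> l2_space M" "S (\<lambda>x. c * g x) \<in> l2_space M"
    using assms by (auto intro!: l2_add l2_scale l2_linear_closed[OF S])
  have "l2_eq M (S ?h) (\<lambda>x. S f x + c * S g x)"
    using l2_linear_add[OF S f l2(2)] l2_linear_scale[OF S g, of c]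
    unfolding l2_eq_def by eventually_elim simp
  then have "l2_inner M ?h (S ?h) = l2_inner M ?h (\<lambda>x. S f x + c * S g x)"
    using l2 f g by (intro l2_inner_cong l2_linear_closed[OF S] l2_add)
  then show ?thesis
    using l2 f g by (simp add: l2_inner_add_left l2_inner_add_right l2_inner_scale_left
        l2_inner_scale_right algebra_simps)
qed

text \<open>Polarization: the numbers \<open>\<langle>f + c g, S (f + c g)\<rangle>\<close> being real for \<open>c = 1\<close> and \<open>c = \<i>\<close>
  already makes the form Hermitian.\<close>

lemma l2_positive_symmetric:
  assumes S: "l2_linear M S" and pos: "l2_positive M (l2_space M) S"
    and f: "f \<in> l2_space M" and g: "g \<in> l2_space M"
  shows "l2_inner M (S f) g = l2_inner M f (S g)"
proof -
  have real: "Im (l2_inner M h (S h)) = 0" if "h \<in> l2_space M" for h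
    using pos that by (simp add: l2_positive_def complex_nonneg_Reals_iff)
  have "Im (c * l2_inner M f (S g) + cnj c * l2_inner M g (S f)) = 0" if c: "c * cnj c = 1" for c
    using real[of "\<lambda>x. f x + c * g x"] real[OF f] real[OF g] l2_linear_form_expand[OF S f g, of c]
      l2_add[OF f l2_scale[OF g, of c]] c
    by simp
  from this[of 1] this[of \<i>] have "l2_inner M g (S f) = cnj (l2_inner M f (S g))"
    by (simp add: complex_eq_iff)
  then show ?thesis by (subst l2_inner_commute) simp
qed

lemma l2_positive_cauchy_schwarz:
  assumes S: "l2_linear M S" and pos: "l2_positive M (l2_space M) S"
    and f: "f \<in> l2_space M" and g: "g \<in> l2_space M"
  shows "(norm (l2_inner M f (S g)))\<^sup>2 \<le> Re (l2_inner M f (S f)) * Re (l2_inner M g (S g))"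
proof (rule cauchy_schwarz_form)
  have nonneg: "0 \<le> Re (l2_inner M h (S h))" "Im (l2_inner M h (S h)) = 0" if "h \<in> l2_space M" for h
    using pos that by (simp_all add: l2_positive_def complex_nonneg_Reals_iff)
  then show "0 \<le> Re (l2_inner M f (S f))" "0 \<le> Re (l2_inner M g (S g))"
    using f g by blast+
  fix c
  have "l2_inner M g (S f) = cnj (l2_inner M f (S g))"
    using l2_positive_symmetric[OF S pos f g] l2_inner_commute[of M g "S f"] by simp
  then have "l2_inner M (\<lambda>x. f x + c * g x) (S (\<lambda>x. f x + c * g x))
       = l2_inner M f (S f) + c * l2_inner M f (S g) + cnj (c * l2_inner M f (S g))
         + complex_of_real ((norm c)\<^sup>2) * l2_inner M g (S g)"
    by (simp only: l2_linear_form_expand[OF S f g] complex_norm_square complex_cnj_mult)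
  moreover have "0 \<le> Re (l2_inner M (\<lambda>x. f x + c * g x) (S (\<lambda>x. f x + c * g x)))"
    by (intro nonneg l2_add l2_scale f g)
  ultimately show "0 \<le> Re (l2_inner M f (S f)) + 2 * Re (c * l2_inner M f (S g))
      + (norm c)\<^sup>2 * Re (l2_inner M g (S g))"
    by (simp only: plus_complex.sel Re_complex_of_real Im_complex_of_real times_complex.sel
        complex_cnj) (simp add: algebra_simps)
qed

text \<open>Summing \<open>\<bar>\<langle>e\<^sub>i, S f\<rangle>\<bar>\<^sup>2 \<le> \<langle>e\<^sub>i, S e\<^sub>i\<rangle> \<langle>f, S f\<rangle>\<close> over the basis gives
  \<open>\<parallel>S f\<parallel>\<^sup>2 \<le> tr S \<langle>f, S f\<rangle>\<close>: a positive operator is dominated by its trace, without square roots of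
  operators.\<close>

lemma l2_positive_norm_le_trace:
  assumes S: "l2_linear M S" and pos: "l2_positive M (l2_space M) S"
    and tr: "l2_has_trace M (l2_space M) S (complex_of_real c)"
    and onb: "l2_onb M (l2_space M) (UNIV :: nat set) e"
    and f: "f \<in> l2_space M"
  shows "l2_norm M (S f) \<le> c * l2_norm M f"
proof -
  have e: "e i \<in> l2_space M" for i using l2_onb_in[OF onb] by blast
  have Sf: "S f \<in> l2_space M" using l2_linear_closed[OF S f] .
  define s where "s i = Re (l2_inner M (e i) (S (e i)))" for i
  define p where "p = Re (l2_inner M f (S f))"
  have nonneg: "0 \<le> Re (l2_inner M h (S h))" if "h \<in> l2_space M" for h
    using pos that by (simp add: l2_positive_def complex_nonneg_Reals_iff)
  have "((\<lambda>i. l2_inner M (e i) (S (e i))) has_sum complex_of_real c) UNIV"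
    using tr onb unfolding l2_has_trace_def by blast
  then have "s sums c"
    unfolding s_def using sums_Re[OF has_sum_imp_sums] by fastforce
  then have s_le: "(\<Sum>i<n. s i) \<le> c" for n
    using sum_le_suminf[of s "{..<n}"] nonneg[OF e] by (auto simp: sums_iff s_def)
  have c: "0 \<le> c" using s_le[of 0] by simp
  have p0: "0 \<le> p" unfolding p_def by (rule nonneg[OF f])
  define P where "P n = (\<lambda>x. \<Sum>i<n. l2_inner M (e i) (S f) * e i x)" for n
  have P_le: "(l2_norm M (P n))\<^sup>2 \<le> c * p" for n
  proof -
    have "(l2_norm M (P n))\<^sup>2 = (\<Sum>i<n. (norm (l2_inner M (e i) (S f)))\<^sup>2)"
      unfolding P_def by (rule onb_partial_norm_square[OF _ onb _ _ Sf]) auto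
    also have "\<dots> \<le> (\<Sum>i<n. s i * p)"
      unfolding s_def p_def by (intro sum_mono l2_positive_cauchy_schwarz[OF S pos e f])
    also have "\<dots> = (\<Sum>i<n. s i) * p" by (simp add: sum_distrib_right)
    also have "\<dots> \<le> c * p" using s_le p0 by (rule mult_right_mono)
    finally show ?thesis .
  qed
  have P_lim: "(\<lambda>n. l2_norm M (\<lambda>x. S f x - P n x)) \<longlonglongrightarrow> 0"
    unfolding P_def by (rule onb_expansion_sequence[OF onb _ Sf]) simp
  have "l2_norm M (S f) \<le> sqrt (c * p)"
  proof (rule LIMSEQ_le_const)
    show "(\<lambda>n. l2_norm M (\<lambda>x. S f x - P n x) + sqrt (c * p)) \<longlonglongrightarrow> sqrt (c * p)"
      using tendsto_add[OF P_lim tendsto_const[of "sqrt (c * p)"]] by simp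
    have "l2_norm M (S f) \<le> l2_norm M (\<lambda>x. S f x - P n x) + sqrt (c * p)" for n
    proof -
      have "P n \<in> l2_space M" unfolding P_def by (intro l2_combination e) auto
      from l2_norm_le_approx[OF Sf this] real_le_rsqrt[OF P_le[of n]] show ?thesis by linarith
    qed
    then show "\<exists>N. \<forall>n\<ge>N. l2_norm M (S f) \<le> l2_norm M (\<lambda>x. S f x - P n x) + sqrt (c * p)"
      by blast
  qed
  then have "(l2_norm M (S f))\<^sup>2 \<le> c * p"
    using c p0 by (metis l2_norm_nonneg mult_nonneg_nonneg power_mono real_sqrt_pow2)
  also have "p \<le> l2_norm M f * l2_norm M (S f)"
    unfolding p_def using l2_cauchy_schwarz[OF f Sf] complex_Re_le_cmod order_trans by blast
  finally have "l2_norm M (S f) * l2_norm M (S f) \<le> (c * l2_norm M f) * l2_norm M (S f)"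
    using c by (simp add: power2_eq_square mult_left_mono mult.assoc)
  then show ?thesis
    using c l2_norm_nonneg[of M "S f"] l2_norm_nonneg[of M f]
    by (cases "l2_norm M (S f) = 0") (auto simp: mult_le_cancel_right)
qed

text \<open>For symmetric \<open>T\<close> the function \<open>T (T f)\<close> itself witnesses that \<open>T\<close> has an adjoint at \<open>T f\<close>, so no
  representation theorem for functionals is needed, and \<open>\<parallel>T f\<parallel> = \<parallel>\<bar>T\<bar> f\<parallel>\<close> reduces the claim to the
  positive operator \<open>\<bar>T\<bar>\<close>.\<close>

lemma symmetric_norm_le_trace_norm:
  assumes T: "\<And>f. f \<in> l2_space M \<Longrightarrow> T f \<in> l2_space M"
    and sym: "\<And>f g. f \<in> l2_space M \<Longrightarrow> g \<in> l2_space M \<Longrightarrow> l2_inner M (T f) g = l2_inner M f (T g)"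
    and tn: "l2_has_trace_norm M (l2_space M) T c"
    and onb: "l2_onb M (l2_space M) (UNIV :: nat set) e"
    and f: "f \<in> l2_space M"
  shows "l2_norm M (T f) \<le> c * l2_norm M f"
proof -
  let ?H = "l2_space M"
  obtain S where S: "l2_bounded_op M ?H S" and pos: "l2_positive M ?H S"
    and sq: "\<forall>f\<in>?H. l2_eq M (S (S f)) (l2_adjoint M ?H T (T f))"
    and tr: "l2_has_trace M ?H S (complex_of_real c)"
    using tn unfolding l2_has_trace_norm_def by blast
  note lin = l2_bounded_op_linear[OF S]
  note SH = l2_linear_closed[OF lin]
  let ?g = "l2_adjoint M ?H T (T f)"
  have "\<exists>g. g \<in> ?H \<and> (\<forall>h\<in>?H. l2_inner M g h = l2_inner M (T f) (T h))"
    using sym T f by (intro exI[of _ "T (T f)"]) auto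
  then have g: "?g \<in> ?H \<and> (\<forall>h\<in>?H. l2_inner M ?g h = l2_inner M (T f) (T h))"
    unfolding l2_adjoint_def by (rule someI_ex)
  have "l2_inner M (S f) (S f) = l2_inner M (S (S f)) f"
    using l2_positive_symmetric[OF lin pos SH[OF f] f] by simp
  also have "\<dots> = l2_inner M ?g f"
    using sq f g SH by (intro l2_inner_cong_left) auto
  also have "\<dots> = l2_inner M (T f) (T f)" using g f by blast
  finally have "(l2_norm M (S f))\<^sup>2 = (l2_norm M (T f))\<^sup>2"
    unfolding l2_inner_self of_real_eq_iff .
  then have "l2_norm M (T f) = l2_norm M (S f)" by simp
  then show ?thesis
    using l2_positive_norm_le_trace[OF lin pos tr onb f] by simp
qed

text \<open>Convergence of the partial sums in trace norm bounds the error in operator norm, which is enough to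
  identify all matrix elements of the density operator; traces are computed from these alone.\<close>

lemma S_C_decomposition_weak:
  fixes \<xi> :: "nat \<Rightarrow> 'x::topological_space \<Rightarrow>\<^sub>C complex"
  assumes dec: "S_C_decomposition \<mu> \<rho> r \<xi>"
    and f: "f \<in> l2_space \<mu>" and g: "g \<in> l2_space \<mu>"
  shows "(\<lambda>j. complex_of_real (r j) * l2_inner \<mu> g (\<xi> j) * l2_inner \<mu> (\<xi> j) f) sums l2_inner \<mu> g (\<rho> f)"
proof -
  let ?H = "l2_space \<mu>" and ?R = "rank_one_sum \<mu> r (\<lambda>j. apply_bcontfun (\<xi> j))"
  have \<rho>: "l2_bounded_op \<mu> ?H \<rho>" "l2_positive \<mu> ?H \<rho>"
    and onb: "l2_onb \<mu> ?H UNIV (\<lambda>j. apply_bcontfun (\<xi> j))"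
    using dec by (auto simp: S_C_decomposition_def density_op_def)
  obtain d where d: "\<And>n. l2_has_trace_norm \<mu> ?H (\<lambda>f x. \<rho> f x - ?R n f x) (d n)" "d \<longlonglongrightarrow> 0"
    using dec unfolding S_C_decomposition_def by blast
  note lin = l2_bounded_op_linear[OF \<rho>(1)]
  note \<rho>H = l2_linear_closed[OF lin]
  have \<xi>: "apply_bcontfun (\<xi> j) \<in> ?H" for j using l2_onb_in[OF onb] by blast
  have RH: "?R n h \<in> ?H" for n h
    unfolding rank_one_sum_def by (intro l2_combination \<xi>) simp
  have inner_R: "l2_inner \<mu> h (?R n h')
      = (\<Sum>j<n. complex_of_real (r j) * l2_inner \<mu> h (\<xi> j) * l2_inner \<mu> (\<xi> j) h')"
    if "h \<in> ?H" for n h h'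
    unfolding rank_one_sum_def using that \<xi>
    by (subst l2_inner_combination_right) (auto intro!: sum.cong)
  have sym_R: "l2_inner \<mu> (?R n h) h' = l2_inner \<mu> h (?R n h')" if "h \<in> ?H" "h' \<in> ?H" for n h h'
    using inner_R[OF that(1), of n h'] inner_R[OF that(2), of n h]
      l2_inner_commute[of \<mu> "?R n h" h'] l2_inner_commute[of \<mu> "\<xi> _"]
    by (simp add: mult_ac)
  have "(\<lambda>n. l2_inner \<mu> g (\<lambda>x. \<rho> f x - ?R n f x)) \<longlonglongrightarrow> 0"
  proof (rule Lim_null_comparison)
    show "(\<lambda>n. l2_norm \<mu> g * (d n * l2_norm \<mu> f)) \<longlonglongrightarrow> 0"
      using d(2) by (auto intro!: tendsto_eq_intros)
    have "norm (l2_inner \<mu> g (\<lambda>x. \<rho> f x - ?R n f x)) \<le> l2_norm \<mu> g * (d n * l2_norm \<mu> f)" for n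
    proof -
      have "l2_norm \<mu> (\<lambda>x. \<rho> f x - ?R n f x) \<le> d n * l2_norm \<mu> f"
        using d(1)[of n]
        by (rule symmetric_norm_le_trace_norm[where T="\<lambda>f x. \<rho> f x - ?R n f x", rotated 2, OF _ onb f])
          (simp_all add: l2_diff \<rho>H RH l2_inner_diff_left l2_inner_diff_right sym_R
            l2_positive_symmetric[OF lin \<rho>(2)])
      moreover have "norm (l2_inner \<mu> g (\<lambda>x. \<rho> f x - ?R n f x))
          \<le> l2_norm \<mu> g * l2_norm \<mu> (\<lambda>x. \<rho> f x - ?R n f x)"
        by (intro l2_cauchy_schwarz l2_diff g \<rho>H RH f)
      ultimately show ?thesis
        using mult_left_mono[OF _ l2_norm_nonneg] order_trans by blast
    qed
    then show "\<forall>\<^sub>F n in sequentially. norm (l2_inner \<mu> g (\<lambda>x. \<rho> f x - ?R n f x))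
        \<le> l2_norm \<mu> g * (d n * l2_norm \<mu> f)" by simp
  qed
  then have "(\<lambda>n. l2_inner \<mu> g (\<rho> f) - l2_inner \<mu> g (?R n f)) \<longlonglongrightarrow> 0"
    using f g by (simp add: l2_inner_diff_right \<rho>H RH)
  then have "(\<lambda>n. l2_inner \<mu> g (?R n f)) \<longlonglongrightarrow> l2_inner \<mu> g (\<rho> f)"
    using tendsto_diff[OF tendsto_const[of "l2_inner \<mu> g (\<rho> f)"]] by force
  then show ?thesis
    using g by (simp add: sums_def inner_R)
qed

text \<open>The trace of the density operator, evaluated in the basis that diagonalizes it; the total weight is
  the limit of the normalizing traces of the compressed densities.\<close>

lemma S_C_decomposition_weights:
  assumes dec: "S_C_decomposition \<mu> \<rho> r \<xi>"
  shows "r sums 1"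
proof -
  let ?H = "l2_space \<mu>"
  have onb: "l2_onb \<mu> ?H UNIV (\<lambda>j. apply_bcontfun (\<xi> j))" and tr: "l2_has_trace \<mu> ?H \<rho> 1"
    using dec by (auto simp: S_C_decomposition_def density_op_def)
  have \<xi>: "apply_bcontfun (\<xi> j) \<in> ?H" for j using l2_onb_in[OF onb] by blast
  have "l2_inner \<mu> (\<xi> i) (\<rho> (\<xi> i)) = complex_of_real (r i)" for i
  proof (rule sums_unique2[OF S_C_decomposition_weak[OF dec \<xi> \<xi>]])
    have "(\<lambda>j. complex_of_real (r j) * l2_inner \<mu> (\<xi> i) (\<xi> j) * l2_inner \<mu> (\<xi> j) (\<xi> i))
        = (\<lambda>j. if j = i then complex_of_real (r i) else 0)"
      by (auto simp: l2_onb_inner[OF onb])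
    then show "(\<lambda>j. complex_of_real (r j) * l2_inner \<mu> (\<xi> i) (\<xi> j) * l2_inner \<mu> (\<xi> j) (\<xi> i))
        sums complex_of_real (r i)"
      using sums_single[of i "\<lambda>j. complex_of_real (r i)"] by simp
  qed
  moreover have "((\<lambda>i. l2_inner \<mu> (\<xi> i) (\<rho> (\<xi> i))) has_sum 1) UNIV"
    using tr onb unfolding l2_has_trace_def by blast
  ultimately have "(\<lambda>i. complex_of_real (r i)) sums complex_of_real 1"
    using has_sum_imp_sums by fastforce
  then show ?thesis unfolding sums_of_real_iff .
qed

section \<open>Compressions to the span of an orthonormal frame\<close>

text \<open>
  The projections and adjoints of the definitions are choices up to null sets. On the span of
  finitely many orthonormal functions they are unique as functions, because the coefficients of an
  element are its inner products with the frame, so they can be replaced by explicit formulas.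
\<close>

locale real_frame =
  fixes M :: "'a measure" and \<phi> :: "nat \<Rightarrow> 'a \<Rightarrow> real" and L :: nat
  assumes frame_l2: "\<And>l. l < L \<Longrightarrow> (\<lambda>x. complex_of_real (\<phi> l x)) \<in> l2_space M"
    and frame_orthonormal: "\<And>l m. l < L \<Longrightarrow> m < L \<Longrightarrow>
      l2_inner M (\<lambda>x. complex_of_real (\<phi> l x)) (\<lambda>x. complex_of_real (\<phi> m x)) = (if l = m then 1 else 0)"
begin

abbreviation "e \<equiv> \<lambda>l x. complex_of_real (\<phi> l x)"
abbreviation "V \<equiv> leading_span \<phi> L"

definition frame_proj :: "('a \<Rightarrow> complex) \<Rightarrow> 'a \<Rightarrow> complex" where
  "frame_proj f = (\<lambda>x. \<Sum>l<L. l2_inner M (e l) f * e l x)"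

text \<open>\<open>frame_adj U f\<close> is the adjoint of the compression of \<open>U\<close>, applied to an element \<open>f\<close> of the span.\<close>

definition frame_adj :: "'a l2_op \<Rightarrow> ('a \<Rightarrow> complex) \<Rightarrow> 'a \<Rightarrow> complex" where
  "frame_adj U f = (\<lambda>x. \<Sum>m<L. cnj (l2_inner M f (U (e m))) * e m x)"

lemma combination_in_V: "(\<lambda>x. \<Sum>l<L. c l * e l x) \<in> V"
  unfolding leading_span_def by blast

lemma inner_combination_e:
  assumes "h \<in> l2_space M"
  shows "l2_inner M (\<lambda>x. \<Sum>l<L. c l * e l x) h = (\<Sum>l<L. cnj (c l) * l2_inner M (e l) h)"
  by (rule l2_inner_combination_left) (use assms frame_l2 in auto)

lemma V_cases:
  assumes "f \<in> V" obtains c where "f = (\<lambda>x. \<Sum>l<L. c l * e l x)"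
  using assms unfolding leading_span_def by blast

lemma V_subspace: "l2_subspace M V"
  unfolding l2_subspace_def
proof (intro conjI ballI allI subsetI)
  fix f assume "f \<in> V"
  then show "f \<in> l2_space M" by (elim V_cases) (auto intro!: l2_combination frame_l2)
next
  show "(\<lambda>x. 0) \<in> V" using combination_in_V[of "\<lambda>l. 0"] by simp
next
  fix f g assume "f \<in> V" "g \<in> V"
  then obtain c d where "f = (\<lambda>x. \<Sum>l<L. c l * e l x)" "g = (\<lambda>x. \<Sum>l<L. d l * e l x)"
    by (elim V_cases)
  then show "(\<lambda>x. f x + g x) \<in> V"
    using combination_in_V[of "\<lambda>l. c l + d l"] by (simp add: distrib_right sum.distrib)
next
  fix a f assume "f \<in> V"
  then obtain c where "f = (\<lambda>x. \<Sum>l<L. c l * e l x)" by (elim V_cases)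
  then show "(\<lambda>x. a * f x) \<in> V"
    using combination_in_V[of "\<lambda>l. a * c l"] by (simp add: sum_distrib_left mult.assoc)
qed

lemma V_l2: "f \<in> V \<Longrightarrow> f \<in> l2_space M"
  by (rule l2_subspace_l2[OF V_subspace])

lemma V_sub: "V \<subseteq> l2_space M"
  using V_l2 by blast

lemma e_in_V: "l < L \<Longrightarrow> e l \<in> V"
  using combination_in_V[of "\<lambda>m. if m = l then 1 else 0"]
  by (simp add: if_distrib[of "\<lambda>z. z * _"] sum.delta cong: if_cong)

lemma V_onb: "l2_onb M V {..<L} e"
  unfolding l2_onb_def
proof (intro conjI ballI allI impI)
  fix f and \<epsilon> :: real assume "f \<in> V" "\<epsilon> > 0"
  from \<open>f \<in> V\<close> obtain c where "f = (\<lambda>x. \<Sum>l<L. c l * e l x)" by (rule V_cases)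
  then have "l2_norm M (\<lambda>x. f x - (\<Sum>i\<in>{..<L}. c i * e i x)) < \<epsilon>"
    using \<open>\<epsilon> > 0\<close> by (simp add: l2_norm_def)
  then show "\<exists>F c. finite F \<and> F \<subseteq> {..<L} \<and> l2_norm M (\<lambda>x. f x - (\<Sum>i\<in>F. c i * e i x)) < \<epsilon>"
    by (intro exI[of _ "{..<L}"] exI[of _ c]) simp
qed (simp_all add: e_in_V frame_orthonormal)

lemma frame_proj_in_V: "frame_proj f \<in> V"
  unfolding frame_proj_def by (rule combination_in_V)

lemma frame_adj_in_V: "frame_adj U f \<in> V"
  unfolding frame_adj_def by (rule combination_in_V)

lemma inner_e_frame_proj: "l < L \<Longrightarrow> l2_inner M (e l) (frame_proj f) = l2_inner M (e l) f"
  unfolding frame_proj_def by (rule onb_inner_combination[OF V_sub V_onb]) auto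

lemma frame_proj_id: "f \<in> V \<Longrightarrow> frame_proj f = f"
proof (elim V_cases)
  fix c assume f: "f = (\<lambda>x. \<Sum>l<L. c l * e l x)"
  have "l2_inner M (e l) f = c l" if "l < L" for l
    unfolding f using that by (intro onb_inner_combination[OF V_sub V_onb]) auto
  then show "frame_proj f = f" unfolding frame_proj_def by (subst (2) f) (auto intro: sum.cong)
qed

lemma inner_frame_proj_right:
  assumes "h \<in> V" "f \<in> l2_space M"
  shows "l2_inner M h (frame_proj f) = l2_inner M h f"
proof -
  obtain c where h: "h = (\<lambda>x. \<Sum>l<L. c l * e l x)" using assms(1) by (rule V_cases)
  show ?thesis
    unfolding h inner_combination_e[OF assms(2)] inner_combination_e[OF V_l2[OF frame_proj_in_V]]
    by (simp add: inner_e_frame_proj)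
qed

lemma inner_frame_proj_left:
  assumes "h \<in> V" "f \<in> l2_space M"
  shows "l2_inner M (frame_proj f) h = l2_inner M f h"
  using inner_frame_proj_right[OF assms] l2_inner_commute[of M _ h] by metis

lemma frame_proj_norm: "f \<in> l2_space M \<Longrightarrow> l2_norm M (frame_proj f) \<le> l2_norm M f"
  unfolding frame_proj_def by (rule onb_partial_norm[OF V_sub V_onb]) auto

lemma l2_proj_eq:
  assumes f: "f \<in> l2_space M"
  shows "l2_proj M V f = frame_proj f"
  unfolding l2_proj_def
proof (rule some_equality)
  show "frame_proj f \<in> V \<and> (\<forall>h\<in>V. l2_inner M h (\<lambda>x. f x - frame_proj f x) = 0)"
    using f by (simp add: frame_proj_in_V l2_inner_diff_right V_l2 inner_frame_proj_right)
next
  fix g assume g: "g \<in> V \<and> (\<forall>h\<in>V. l2_inner M h (\<lambda>x. f x - g x) = 0)"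
  then have "l2_inner M (e l) g = l2_inner M (e l) f" if "l < L" for l
    using f e_in_V[OF that] by (auto simp: l2_inner_diff_right V_l2)
  then have "frame_proj g = frame_proj f" unfolding frame_proj_def by (auto intro: sum.cong)
  then show "g = frame_proj f" using g frame_proj_id by simp
qed

lemma compression_eq:
  assumes "l2_linear M T" "f \<in> l2_space M"
  shows "compression M V T f = frame_proj (T (frame_proj f))"
  using assms by (simp add: compression_def l2_proj_eq V_l2 frame_proj_in_V l2_linear_closed)

lemma inner_op_frame_proj:
  assumes T: "l2_linear M T" and g: "g \<in> l2_space M"
  shows "l2_inner M g (T (frame_proj h)) = (\<Sum>m<L. l2_inner M (e m) h * l2_inner M g (T (e m)))"
  unfolding frame_proj_def using g by (intro l2_linear_inner_combination[OF T]) (auto intro: frame_l2)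

lemma inner_frame_adj_left:
  assumes "g \<in> l2_space M" "h \<in> l2_space M" and U: "l2_linear M U"
  shows "l2_inner M (frame_adj U g) h = l2_inner M g (U (frame_proj h))"
  unfolding frame_adj_def inner_combination_e[OF assms(2)] inner_op_frame_proj[OF U assms(1)]
  by (simp add: mult.commute)

lemma l2_adjoint_compression:
  assumes U: "l2_linear M U" and f: "f \<in> V"
  shows "l2_adjoint M V (compression M V U) f = frame_adj U f"
  unfolding l2_adjoint_def
proof (rule some_equality)
  have comp: "l2_inner M f (compression M V U h) = l2_inner M f (U (frame_proj h))" if "h \<in> V" for h
    using U f that by (simp add: compression_eq V_l2 inner_frame_proj_right l2_linear_closed frame_proj_in_V)
  show "frame_adj U f \<in> V \<and> (\<forall>h\<in>V. l2_inner M (frame_adj U f) h = l2_inner M f (compression M V U h))"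
    using f by (simp add: frame_adj_in_V comp inner_frame_adj_left[OF _ _ U] V_l2)
  fix g assume g: "g \<in> V \<and> (\<forall>h\<in>V. l2_inner M g h = l2_inner M f (compression M V U h))"
  have "l2_inner M (e m) g = cnj (l2_inner M f (U (e m)))" if "m < L" for m
  proof -
    have "l2_inner M g (e m) = l2_inner M f (U (frame_proj (e m)))"
      using g comp e_in_V[OF that] by auto
    then show ?thesis
      using frame_proj_id[OF e_in_V[OF that]] by (subst l2_inner_commute) simp
  qed
  then have "frame_proj g = frame_adj U f" unfolding frame_proj_def frame_adj_def by (auto intro: sum.cong)
  then show "g = frame_adj U f" using g frame_proj_id by simp
qed

context
  fixes U A \<sigma> :: "'a l2_op" and r :: "nat \<Rightarrow> real" and \<xi> :: "nat \<Rightarrow> 'a \<Rightarrow> complex" and D :: real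
  assumes U: "l2_linear M U" and A: "l2_linear M A"
    and \<sigma>_l2: "\<And>f. f \<in> l2_space M \<Longrightarrow> \<sigma> f \<in> l2_space M"
    and \<sigma>_weak: "\<And>f g. f \<in> l2_space M \<Longrightarrow> g \<in> l2_space M \<Longrightarrow>
      (\<lambda>j. complex_of_real (r j) * l2_inner M g (\<xi> j) * l2_inner M (\<xi> j) f) sums l2_inner M g (\<sigma> f)"
    and \<xi>: "\<And>j. \<xi> j \<in> l2_space M" "\<And>j. l2_norm M (\<xi> j) \<le> D"
    and r: "summable (\<lambda>j. \<bar>r j\<bar>)"
begin

private lemma frame_proj\<xi>_norm: "l2_norm M (frame_proj (\<xi> j)) \<le> D"
  using frame_proj_norm[OF \<xi>(1)] \<xi>(2) order_trans by blast

private lemma D_nonneg: "0 \<le> D"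
  using \<xi>(2)[of 0] l2_norm_nonneg order_trans by blast

private lemma \<sigma>_weak_P:
  assumes "f \<in> V" "g \<in> V"
  shows "(\<lambda>j. complex_of_real (r j) * l2_inner M g (frame_proj (\<xi> j)) * l2_inner M (frame_proj (\<xi> j)) f) sums l2_inner M g (\<sigma> f)"
  using \<sigma>_weak[of f g] assms by (simp add: V_l2 inner_frame_proj_left inner_frame_proj_right \<xi>)

lemma compressed_trace:
  "l2_trace M V (compression M V \<sigma>) = (\<Sum>j. complex_of_real (r j) * l2_inner M (frame_proj (\<xi> j)) (frame_proj (\<xi> j)))"
proof (rule l2_trace_eq[OF has_trace_nuclear[OF V_subspace,
        where z="\<lambda>j. frame_proj (\<xi> j)" and lam="\<lambda>j. l2_inner M (frame_proj (\<xi> j))" and C=D and D=D] V_onb])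
  fix f assume f: "f \<in> V"
  have "compression M V \<sigma> f = frame_proj (\<sigma> f)"
    using f by (simp add: compression_def l2_proj_eq V_l2 frame_proj_id \<sigma>_l2)
  then have "l2_inner M f (compression M V \<sigma> f) = l2_inner M f (\<sigma> f)"
    using f by (simp add: inner_frame_proj_right V_l2 \<sigma>_l2)
  then show "(\<lambda>j. complex_of_real (r j) * l2_inner M f (frame_proj (\<xi> j)) * l2_inner M (frame_proj (\<xi> j)) f)
      sums l2_inner M f (compression M V \<sigma> f)"
    using \<sigma>_weak_P[OF f f] by simp
next
  fix j f assume f: "f \<in> V"
  have "norm (l2_inner M (frame_proj (\<xi> j)) f) \<le> l2_norm M (frame_proj (\<xi> j)) * l2_norm M f"
    using f by (intro l2_cauchy_schwarz V_l2 frame_proj_in_V)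
  also have "\<dots> \<le> D * l2_norm M f"
    using frame_proj\<xi>_norm by (rule mult_right_mono) simp
  finally show "norm (l2_inner M (frame_proj (\<xi> j)) f) \<le> D * l2_norm M f" .
qed (auto simp: l2_inner_add_right l2_inner_scale_right V_l2 frame_proj_in_V frame_proj\<xi>_norm r D_nonneg)

private lemma functional_eq:
  assumes "v \<in> l2_space M" "f \<in> l2_space M"
  shows "l2_inner M v (A (frame_adj U f)) = (\<Sum>m<L. l2_inner M (U (e m)) f * l2_inner M v (A (e m)))"
proof -
  have "l2_inner M v (A (frame_adj U f)) = (\<Sum>m<L. cnj (l2_inner M f (U (e m))) * l2_inner M v (A (e m)))"
    unfolding frame_adj_def using assms by (intro l2_linear_inner_combination[OF A]) (auto intro: frame_l2)
  then show ?thesis by (simp flip: l2_inner_commute)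
qed

text \<open>On a finite-dimensional span linearity already forces boundedness. The constant may depend on the
  frame, but not on \<open>j\<close>.\<close>

private lemma functional_bound:
  obtains C where "0 \<le> C"
    "\<And>j f. f \<in> l2_space M \<Longrightarrow> norm (l2_inner M (frame_adj U (frame_proj (\<xi> j))) (A (frame_adj U f))) \<le> C * l2_norm M f"
proof
  let ?S = "\<Sum>m<L. l2_norm M (U (e m)) * l2_norm M (e m)"
  let ?C = "\<Sum>m<L. l2_norm M (U (e m)) * (D * ?S * l2_norm M (A (e m)))"
  show "0 \<le> ?C"
    using D_nonneg by (auto intro!: sum_nonneg mult_nonneg_nonneg)
  fix j f assume f: "f \<in> l2_space M"
  let ?v = "frame_adj U (frame_proj (\<xi> j))"
  have v: "?v \<in> l2_space M" by (intro V_l2 frame_adj_in_V)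
  have Ue: "U (e m) \<in> l2_space M" and Ae: "A (e m) \<in> l2_space M" if "m < L" for m
    using that by (auto intro: l2_linear_closed[OF U] l2_linear_closed[OF A] frame_l2)
  have coeff: "norm (l2_inner M (frame_proj (\<xi> j)) (U (e m))) \<le> D * l2_norm M (U (e m))" if "m < L" for m
    using l2_cauchy_schwarz[OF V_l2[OF frame_proj_in_V] Ue[OF that], of "\<xi> j"]
      mult_right_mono[OF frame_proj\<xi>_norm, of "l2_norm M (U (e m))" j] by simp
  have "l2_norm M ?v \<le> (\<Sum>m<L. norm (cnj (l2_inner M (frame_proj (\<xi> j)) (U (e m)))) * l2_norm M (e m))"
    unfolding frame_adj_def by (rule l2_norm_combination_le) (auto intro: frame_l2)
  also have "\<dots> \<le> (\<Sum>m<L. D * l2_norm M (U (e m)) * l2_norm M (e m))"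
    using coeff by (intro sum_mono mult_right_mono) auto
  also have "\<dots> = D * ?S" by (simp add: sum_distrib_left mult.assoc)
  finally have v_norm: "l2_norm M ?v \<le> D * ?S" .
  have "norm (l2_inner M ?v (A (frame_adj U f)))
      \<le> (\<Sum>m<L. norm (l2_inner M (U (e m)) f) * norm (l2_inner M ?v (A (e m))))"
    unfolding functional_eq[OF v f] by (rule order_trans[OF norm_sum]) (simp add: norm_mult)
  also have "\<dots> \<le> (\<Sum>m<L. (l2_norm M (U (e m)) * l2_norm M f) * (D * ?S * l2_norm M (A (e m))))"
  proof (intro sum_mono mult_mono)
    fix m assume "m \<in> {..<L}"
    then have m: "m < L" by simp
    show "norm (l2_inner M (U (e m)) f) \<le> l2_norm M (U (e m)) * l2_norm M f"
      by (intro l2_cauchy_schwarz Ue m f)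
    have "norm (l2_inner M ?v (A (e m))) \<le> l2_norm M ?v * l2_norm M (A (e m))"
      by (intro l2_cauchy_schwarz Ae m v)
    also have "\<dots> \<le> D * ?S * l2_norm M (A (e m))"
      using v_norm by (rule mult_right_mono) simp
    finally show "norm (l2_inner M ?v (A (e m))) \<le> D * ?S * l2_norm M (A (e m))" .
  qed auto
  also have "\<dots> = ?C * l2_norm M f"
    unfolding sum_distrib_right[of _ "{..<L}" "l2_norm M f"] by (rule sum.cong) (simp_all add: mult_ac)
  finally show "norm (l2_inner M ?v (A (frame_adj U f))) \<le> ?C * l2_norm M f" .
qed

text \<open>Moving the compressed \<open>U\<close> to the other side turns the trace of \<open>\<sigma> U A U\<^sup>*\<close> into expectation values of
  \<open>A\<close> in the evolved vectors of the state.\<close>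

lemma compressed_expectation:
  "transfer_op M V (compression M V U) (density_state M V (compressed_density M V \<sigma>)) (compression M V A)
   = (\<Sum>j. complex_of_real (r j) * l2_inner M (frame_adj U (frame_proj (\<xi> j))) (A (frame_adj U (frame_proj (\<xi> j)))))
     / (\<Sum>j. complex_of_real (r j) * l2_inner M (frame_proj (\<xi> j)) (frame_proj (\<xi> j)))"
proof -
  define \<tau> where "\<tau> = l2_trace M V (compression M V \<sigma>)"
  define B where "B f = frame_proj (U (frame_proj (A (frame_adj U f))))" for f
  define lam where "lam j f = l2_inner M (frame_adj U (frame_proj (\<xi> j))) (A (frame_adj U f)) / \<tau>" for j f
  let ?T = "compressed_density M V \<sigma> \<circ> heisenberg M V (compression M V U) (compression M V A)"
  obtain C where C: "0 \<le> C"
    "\<And>j f. f \<in> l2_space M \<Longrightarrow> norm (l2_inner M (frame_adj U (frame_proj (\<xi> j))) (A (frame_adj U f))) \<le> C * l2_norm M f"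
    using functional_bound by blast
  have AW: "A (frame_adj U f) \<in> l2_space M" for f
    by (intro l2_linear_closed[OF A] V_l2 frame_adj_in_V)
  have UP: "U (frame_proj f) \<in> l2_space M" for f
    by (intro l2_linear_closed[OF U] V_l2 frame_proj_in_V)
  have lam_bound: "norm (lam j f) \<le> C / norm \<tau> * l2_norm M f" if "f \<in> V" for j f
    using C(2)[OF V_l2[OF that], of j] by (simp add: lam_def norm_divide divide_right_mono)
  have "l2_has_trace M V ?T (\<Sum>j. complex_of_real (r j) * lam j (frame_proj (\<xi> j)))"
  proof (rule has_trace_nuclear[OF V_subspace _ _ _ lam_bound frame_proj_in_V frame_proj\<xi>_norm r])
    fix f assume f: "f \<in> V"
    have "heisenberg M V (compression M V U) (compression M V A) f = B f"
      using f by (simp add: heisenberg_def B_def l2_adjoint_compression[OF U] compression_eq[OF U]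
          compression_eq[OF A] V_l2 frame_proj_in_V frame_adj_in_V frame_proj_id)
    moreover have BV: "B f \<in> V" unfolding B_def by (rule frame_proj_in_V)
    ultimately have T: "?T f = (\<lambda>x. (1 / \<tau>) * frame_proj (\<sigma> (B f)) x)"
      by (simp add: compressed_density_def \<tau>_def compression_def l2_proj_eq V_l2 frame_proj_id \<sigma>_l2)
    have "l2_inner M f (?T f) = (1 / \<tau>) * l2_inner M f (\<sigma> (B f))"
      unfolding T l2_inner_scale_right using f BV by (simp add: inner_frame_proj_right V_l2 \<sigma>_l2)
    moreover have "l2_inner M (frame_proj (\<xi> j)) (B f) = l2_inner M (frame_adj U (frame_proj (\<xi> j))) (A (frame_adj U f))" for j
      unfolding B_def by (simp add: inner_frame_proj_right frame_proj_in_V UP inner_frame_adj_left[OF _ _ U] V_l2 AW)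
    ultimately show "(\<lambda>j. complex_of_real (r j) * l2_inner M f (frame_proj (\<xi> j)) * lam j f) sums l2_inner M f (?T f)"
      using sums_mult[OF \<sigma>_weak_P[OF BV f], of "1 / \<tau>"] by (simp add: lam_def)
  next
    fix j f g assume "f \<in> V" "g \<in> V"
    then show "lam j (\<lambda>x. f x + g x) = lam j f + lam j g"
      unfolding lam_def
      by (simp add: functional_eq V_l2 frame_adj_in_V l2_add l2_inner_add_right l2_linear_closed[OF U] frame_l2
          distrib_right sum.distrib add_divide_distrib)
  next
    fix j c f assume "f \<in> V"
    then show "lam j (\<lambda>x. c * f x) = c * lam j f"
      unfolding lam_def
      by (simp add: functional_eq V_l2 frame_adj_in_V l2_scale l2_inner_scale_right sum_distrib_left mult.assoc)
  qed (use C in auto)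
  from l2_trace_eq[OF this V_onb]
  have "l2_trace M V ?T = (\<Sum>j. complex_of_real (r j) * lam j (frame_proj (\<xi> j)))" .
  also have "\<dots> = (\<Sum>j. complex_of_real (r j) * l2_inner M (frame_adj U (frame_proj (\<xi> j))) (A (frame_adj U (frame_proj (\<xi> j)))) / \<tau>)"
    by (simp add: lam_def)
  also have "\<dots> = (\<Sum>j. complex_of_real (r j) * l2_inner M (frame_adj U (frame_proj (\<xi> j))) (A (frame_adj U (frame_proj (\<xi> j))))) / \<tau>"
  proof (rule suminf_divide, rule summable_comparison_test')
    show "summable (\<lambda>j. \<bar>r j\<bar> * (C * D))" using r by (rule summable_mult2)
    fix j :: nat
    have "norm (l2_inner M (frame_adj U (frame_proj (\<xi> j))) (A (frame_adj U (frame_proj (\<xi> j))))) \<le> C * D"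
      using C(2)[OF V_l2[OF frame_proj_in_V], of j "\<xi> j"] mult_left_mono[OF frame_proj\<xi>_norm C(1), of j] by simp
    then show "norm (complex_of_real (r j) * l2_inner M (frame_adj U (frame_proj (\<xi> j))) (A (frame_adj U (frame_proj (\<xi> j))))) \<le> \<bar>r j\<bar> * (C * D)"
      by (simp add: norm_mult mult_left_mono)
  qed
  finally show ?thesis
    by (simp add: transfer_op_def density_state_def \<tau>_def compressed_trace)
qed

end

end

text \<open>The same number written with the coordinates \<open>x\<close> of the vectors of the state and the matrices
  \<open>u\<close> and \<open>a\<close> of the two operators: it makes sense without reference to a measure, so the data-driven
  and the exact value are one function evaluated at different matrices.\<close>

definition frame_coord :: "nat \<Rightarrow> (nat \<Rightarrow> nat \<Rightarrow> complex) \<Rightarrow> (nat \<Rightarrow> nat \<Rightarrow> complex) \<Rightarrow> nat \<Rightarrow> nat \<Rightarrow> complex" where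
  "frame_coord L x u j m = (\<Sum>l<L. x j l * cnj (u l m))"

definition frame_weight :: "nat \<Rightarrow> (nat \<Rightarrow> real) \<Rightarrow> (nat \<Rightarrow> nat \<Rightarrow> complex) \<Rightarrow> complex" where
  "frame_weight L r x = (\<Sum>j. complex_of_real (r j) * (\<Sum>l<L. cnj (x j l) * x j l))"

definition frame_expectation ::
  "nat \<Rightarrow> (nat \<Rightarrow> real) \<Rightarrow> (nat \<Rightarrow> nat \<Rightarrow> complex) \<Rightarrow> (nat \<Rightarrow> nat \<Rightarrow> complex) \<Rightarrow> (nat \<Rightarrow> nat \<Rightarrow> complex) \<Rightarrow> complex" where
  "frame_expectation L r x u a =
     (\<Sum>j. complex_of_real (r j) *
        (\<Sum>m<L. \<Sum>n<L. cnj (frame_coord L x u j m) * (frame_coord L x u j n * a m n)))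
     / frame_weight L r x"

lemma (in real_frame) frame_weight_eq:
  "frame_weight L r (\<lambda>j l. l2_inner M (e l) (\<xi> j)) = (\<Sum>j. complex_of_real (r j) * l2_inner M (frame_proj (\<xi> j)) (frame_proj (\<xi> j)))"
proof -
  have "l2_inner M (frame_proj (\<xi> j)) (frame_proj (\<xi> j)) = (\<Sum>l<L. cnj (l2_inner M (e l) (\<xi> j)) * l2_inner M (e l) (\<xi> j))" for j
  proof -
    have "l2_inner M (frame_proj (\<xi> j)) (frame_proj (\<xi> j)) = (\<Sum>l<L. cnj (l2_inner M (e l) (\<xi> j)) * l2_inner M (e l) (frame_proj (\<xi> j)))"
      by (subst (1) frame_proj_def, rule inner_combination_e[OF V_l2[OF frame_proj_in_V]])
    then show ?thesis by (simp add: inner_e_frame_proj)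
  qed
  then show ?thesis by (simp add: frame_weight_def)
qed

lemma (in real_frame) frame_expectation_eq:
  assumes U: "l2_linear M U" and A: "l2_linear M A" and \<xi>: "\<And>j. \<xi> j \<in> l2_space M"
  shows "frame_expectation L r (\<lambda>j l. l2_inner M (e l) (\<xi> j)) (\<lambda>l m. l2_inner M (e l) (U (e m)))
      (\<lambda>m n. l2_inner M (e m) (A (e n)))
    = (\<Sum>j. complex_of_real (r j) * l2_inner M (frame_adj U (frame_proj (\<xi> j))) (A (frame_adj U (frame_proj (\<xi> j)))))
     / (\<Sum>j. complex_of_real (r j) * l2_inner M (frame_proj (\<xi> j)) (frame_proj (\<xi> j)))"
proof -
  let ?x = "\<lambda>j l. l2_inner M (e l) (\<xi> j)" and ?u = "\<lambda>l m. l2_inner M (e l) (U (e m))"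
  have coord: "cnj (l2_inner M (frame_proj (\<xi> j)) (U (e m))) = frame_coord L ?x ?u j m" if "m < L" for j m
    unfolding frame_proj_def frame_coord_def using that
    by (subst inner_combination_e) (simp_all add: frame_l2 l2_linear_closed[OF U])
  have frame_adj: "frame_adj U (frame_proj (\<xi> j)) = (\<lambda>x. \<Sum>m<L. frame_coord L ?x ?u j m * e m x)" for j
    unfolding frame_adj_def by (intro ext sum.cong) (auto simp: coord)
  have AW: "A (frame_adj U f) \<in> l2_space M" for f
    by (intro l2_linear_closed[OF A] V_l2 frame_adj_in_V)
  have inner_A: "l2_inner M (e m) (A (frame_adj U (frame_proj (\<xi> j))))
      = (\<Sum>n<L. frame_coord L ?x ?u j n * l2_inner M (e m) (A (e n)))" if "m < L" for j m
    unfolding frame_adj using that by (intro l2_linear_inner_combination[OF A]) (auto intro: frame_l2)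
  have "l2_inner M (frame_adj U (frame_proj (\<xi> j))) (A (frame_adj U (frame_proj (\<xi> j)))) = (\<Sum>m<L. cnj (frame_coord L ?x ?u j m)
      * l2_inner M (e m) (A (frame_adj U (frame_proj (\<xi> j)))))" for j
    by (subst (1) frame_adj, rule inner_combination_e[OF AW])
  then have "l2_inner M (frame_adj U (frame_proj (\<xi> j))) (A (frame_adj U (frame_proj (\<xi> j)))) = (\<Sum>m<L. \<Sum>n<L.
      cnj (frame_coord L ?x ?u j m) * (frame_coord L ?x ?u j n * l2_inner M (e m) (A (e n))))" for j
    by (simp add: inner_A sum_distrib_left)
  then show ?thesis unfolding frame_expectation_def frame_weight_eq by simp
qed

section \<open>Evolved states and growing frames\<close>

lemma l2_linear_diff:
  assumes T: "l2_linear M T" and f: "f \<in> l2_space M" and g: "g \<in> l2_space M"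
  shows "l2_eq M (T (\<lambda>x. f x - g x)) (\<lambda>x. T f x - T g x)"
proof -
  have "l2_eq M (T (\<lambda>x. f x + -1 * g x)) (\<lambda>x. T f x + T (\<lambda>x. -1 * g x) x)"
    by (intro l2_linear_add[OF T] f l2_scale g)
  then have "l2_eq M (T (\<lambda>x. f x + -1 * g x)) (\<lambda>x. T f x + -1 * T g x)"
    using l2_linear_scale[OF T g, of "-1"] unfolding l2_eq_def by eventually_elim simp
  then show ?thesis by simp
qed

lemma l2_bounded_op_lipschitz:
  assumes T: "l2_bounded_op M (l2_space M) T"
  obtains C where "0 \<le> C" "\<And>f. f \<in> l2_space M \<Longrightarrow> l2_norm M (T f) \<le> C * l2_norm M f"
    "\<And>f g. f \<in> l2_space M \<Longrightarrow> g \<in> l2_space M \<Longrightarrow>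
      l2_norm M (\<lambda>x. T f x - T g x) \<le> C * l2_norm M (\<lambda>x. f x - g x)"
proof -
  note lin = l2_bounded_op_linear[OF T]
  obtain C where C: "\<And>f. f \<in> l2_space M \<Longrightarrow> l2_norm M (T f) \<le> C * l2_norm M f"
    using T unfolding l2_bounded_op_def by blast
  have C': "l2_norm M (T f) \<le> \<bar>C\<bar> * l2_norm M f" if "f \<in> l2_space M" for f
    using C[OF that] mult_right_mono[OF abs_ge_self l2_norm_nonneg] order_trans by blast
  have "l2_norm M (\<lambda>x. T f x - T g x) \<le> \<bar>C\<bar> * l2_norm M (\<lambda>x. f x - g x)"
    if f: "f \<in> l2_space M" and g: "g \<in> l2_space M" for f g
  proof -
    have "l2_norm M (T (\<lambda>x. f x - g x)) = l2_norm M (\<lambda>x. T f x - T g x)"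
      using l2_linear_diff[OF lin f g] f g
      by (intro l2_norm_cong l2_measurable l2_diff l2_linear_closed[OF lin])
    then show ?thesis using C'[OF l2_diff[OF f g]] by simp
  qed
  with C' show thesis by (intro that[of "\<bar>C\<bar>"]) auto
qed

lemma l2_bounded_op_cong:
  "l2_bounded_op M V T \<Longrightarrow> f \<in> V \<Longrightarrow> g \<in> V \<Longrightarrow> l2_eq M f g \<Longrightarrow> l2_eq M (T f) (T g)"
  unfolding l2_bounded_op_def by blast

lemma l2_linear_comp:
  assumes T: "l2_bounded_op M (l2_space M) T" and S: "l2_linear M S"
  shows "l2_linear M (\<lambda>f. T (S f))"
proof -
  note lin = l2_bounded_op_linear[OF T]
  note SH = l2_linear_closed[OF S]
  have "l2_eq M (T (S (\<lambda>x. f x + g x))) (\<lambda>x. T (S f) x + T (S g) x)"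
    if f: "f \<in> l2_space M" and g: "g \<in> l2_space M" for f g
  proof -
    have "l2_eq M (T (S (\<lambda>x. f x + g x))) (T (\<lambda>x. S f x + S g x))"
      using f g by (intro l2_bounded_op_cong[OF T] SH l2_add l2_linear_add[OF S])
    moreover have "l2_eq M (T (\<lambda>x. S f x + S g x)) (\<lambda>x. T (S f) x + T (S g) x)"
      using f g by (intro l2_linear_add[OF lin] SH)
    ultimately show ?thesis unfolding l2_eq_def by eventually_elim simp
  qed
  moreover have "l2_eq M (T (S (\<lambda>x. c * f x))) (\<lambda>x. c * T (S f) x)"
    if f: "f \<in> l2_space M" for c f
  proof -
    have "l2_eq M (T (S (\<lambda>x. c * f x))) (T (\<lambda>x. c * S f x))"
      using f by (intro l2_bounded_op_cong[OF T] SH l2_scale l2_linear_scale[OF S])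
    moreover have "l2_eq M (T (\<lambda>x. c * S f x)) (\<lambda>x. c * T (S f) x)"
      using f by (intro l2_linear_scale[OF lin] SH)
    ultimately show ?thesis unfolding l2_eq_def by eventually_elim simp
  qed
  ultimately show ?thesis
    unfolding l2_linear_def using SH l2_linear_closed[OF lin] by blast
qed

lemma l2_adjoint_unique:
  assumes U': "\<And>f. f \<in> l2_space M \<Longrightarrow> U' f \<in> l2_space M"
    and adj: "\<And>f g. f \<in> l2_space M \<Longrightarrow> g \<in> l2_space M \<Longrightarrow> l2_inner M (U' f) g = l2_inner M f (U g)"
    and f: "f \<in> l2_space M"
  shows "l2_adjoint M (l2_space M) U f \<in> l2_space M"
    "l2_norm M (\<lambda>x. l2_adjoint M (l2_space M) U f x - U' f x) = 0"
proof -
  let ?g = "l2_adjoint M (l2_space M) U f"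
  have "\<exists>g. g \<in> l2_space M \<and> (\<forall>h\<in>l2_space M. l2_inner M g h = l2_inner M f (U h))"
    by (intro exI[of _ "U' f"]) (simp add: U' adj f)
  then have "?g \<in> l2_space M \<and> (\<forall>h\<in>l2_space M. l2_inner M ?g h = l2_inner M f (U h))"
    unfolding l2_adjoint_def by (rule someI_ex)
  then have g: "?g \<in> l2_space M" "\<And>h. h \<in> l2_space M \<Longrightarrow> l2_inner M ?g h = l2_inner M (U' f) h"
    using adj f by auto
  then show "?g \<in> l2_space M" by blast
  let ?d = "\<lambda>x. ?g x - U' f x"
  have d: "?d \<in> l2_space M" by (intro l2_diff g U' f)
  have "l2_inner M ?d ?d = 0"
    using g(2)[OF d] by (subst l2_inner_diff_left[OF d g(1) U'[OF f]]) simp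
  then show "l2_norm M ?d = 0" by (simp add: l2_inner_self)
qed

context
  fixes M :: "'a measure" and U U' A \<rho> :: "'a l2_op" and r :: "nat \<Rightarrow> real"
    and \<xi> :: "nat \<Rightarrow> 'a \<Rightarrow> complex" and D :: real
  assumes U: "l2_bounded_op M (l2_space M) U" and U': "l2_bounded_op M (l2_space M) U'"
    and adj: "\<And>f g. f \<in> l2_space M \<Longrightarrow> g \<in> l2_space M \<Longrightarrow> l2_inner M (U' f) g = l2_inner M f (U g)"
    and A: "l2_bounded_op M (l2_space M) A"
    and \<rho>_l2: "\<And>f. f \<in> l2_space M \<Longrightarrow> \<rho> f \<in> l2_space M"
    and \<rho>_weak: "\<And>f g. f \<in> l2_space M \<Longrightarrow> g \<in> l2_space M \<Longrightarrow>
      (\<lambda>j. complex_of_real (r j) * l2_inner M g (\<xi> j) * l2_inner M (\<xi> j) f) sums l2_inner M g (\<rho> f)"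
    and \<xi>: "\<And>j. \<xi> j \<in> l2_space M" "\<And>j. l2_norm M (\<xi> j) \<le> D"
    and r: "summable (\<lambda>j. \<bar>r j\<bar>)"
begin

private lemma D_nonneg: "0 \<le> D"
  using \<xi>(2)[of 0] l2_norm_nonneg order_trans by blast

private lemmas U_lin = l2_bounded_op_linear[OF U]
private lemmas U'_lin = l2_bounded_op_linear[OF U']
private lemmas A_lin = l2_bounded_op_linear[OF A]

text \<open>The chosen adjoint of \<open>U\<close> agrees with \<open>U'\<close> only almost everywhere. As \<open>A\<close> is bounded, a difference
  of norm zero does not change any inner product.\<close>

lemma evolved_expectation:
  assumes onb: "l2_onb M (l2_space M) (I :: nat set) b"
  shows "transfer_op M (l2_space M) U (density_state M (l2_space M) \<rho>) A
     = (\<Sum>j. complex_of_real (r j) * l2_inner M (U' (\<xi> j)) (A (U' (\<xi> j))))"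
proof -
  let ?H = "l2_space M" and ?T = "\<rho> \<circ> heisenberg M (l2_space M) U A"
  note AU'_lin = l2_linear_comp[OF A U'_lin]
  note clos = l2_linear_closed[OF U_lin] l2_linear_closed[OF U'_lin] l2_linear_closed[OF A_lin]
  obtain CA where CA: "0 \<le> CA" "\<And>f. f \<in> ?H \<Longrightarrow> l2_norm M (A f) \<le> CA * l2_norm M f"
    "\<And>f g. f \<in> ?H \<Longrightarrow> g \<in> ?H \<Longrightarrow> l2_norm M (\<lambda>x. A f x - A g x) \<le> CA * l2_norm M (\<lambda>x. f x - g x)"
    by (rule l2_bounded_op_lipschitz[OF A]) (blast intro: that)
  obtain CU where CU: "0 \<le> CU" "\<And>f. f \<in> ?H \<Longrightarrow> l2_norm M (U' f) \<le> CU * l2_norm M f"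
    by (rule l2_bounded_op_lipschitz[OF U']) (blast intro: that)
  have "l2_has_trace M ?H ?T (\<Sum>j. complex_of_real (r j) * l2_inner M (U' (\<xi> j)) (A (U' (\<xi> j))))"
  proof (rule has_trace_nuclear[OF l2_subspace_space,
        where z=\<xi> and lam="\<lambda>j f. l2_inner M (U' (\<xi> j)) (A (U' f))" and C="CU * D * (CA * CU)"])
    fix f assume f: "f \<in> ?H"
    let ?g = "l2_adjoint M ?H U f"
    note g = l2_adjoint_unique[of M U' U f, OF clos(2) adj f]
    have "l2_inner M (\<xi> j) (U (A ?g)) = l2_inner M (U' (\<xi> j)) (A (U' f))" for j
    proof -
      have "l2_norm M (\<lambda>x. A ?g x - A (U' f) x) \<le> 0"
        using CA(3)[OF g(1) clos(2)[OF f]] g(2) by simp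
      then have "norm (l2_inner M (U' (\<xi> j)) (\<lambda>x. A ?g x - A (U' f) x)) \<le> 0"
        using l2_cauchy_schwarz[OF clos(2)[OF \<xi>(1)[of j]] l2_diff[OF clos(3)[OF g(1)] clos(3)[OF clos(2)[OF f]]]]
        by (metis l2_norm_nonneg mult_zero_right order_antisym)
      then have "l2_inner M (U' (\<xi> j)) (A ?g) = l2_inner M (U' (\<xi> j)) (A (U' f))"
        using g(1) f \<xi>(1)[of j] by (simp add: l2_inner_diff_right clos)
      then show ?thesis using adj[OF \<xi>(1) clos(3)[OF g(1)], of j] by simp
    qed
    then show "(\<lambda>j. complex_of_real (r j) * l2_inner M f (\<xi> j) * l2_inner M (U' (\<xi> j)) (A (U' f)))
        sums l2_inner M f (?T f)"
      using \<rho>_weak[OF clos(1)[OF clos(3)[OF g(1)]] f] by (simp add: heisenberg_def)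
  next
    fix j f g assume f: "f \<in> ?H" and g: "g \<in> ?H"
    have "l2_inner M (U' (\<xi> j)) (A (U' (\<lambda>x. f x + g x)))
        = l2_inner M (U' (\<xi> j)) (\<lambda>x. A (U' f) x + A (U' g) x)"
      using f g \<xi> by (intro l2_inner_cong l2_linear_add[OF AU'_lin] clos l2_add)
    then show "l2_inner M (U' (\<xi> j)) (A (U' (\<lambda>x. f x + g x)))
        = l2_inner M (U' (\<xi> j)) (A (U' f)) + l2_inner M (U' (\<xi> j)) (A (U' g))"
      using f g \<xi> by (simp add: l2_inner_add_right clos)
  next
    fix j c f assume f: "f \<in> ?H"
    have "l2_inner M (U' (\<xi> j)) (A (U' (\<lambda>x. c * f x))) = l2_inner M (U' (\<xi> j)) (\<lambda>x. c * A (U' f) x)"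
      using f \<xi> by (intro l2_inner_cong l2_linear_scale[OF AU'_lin] clos l2_scale)
    then show "l2_inner M (U' (\<xi> j)) (A (U' (\<lambda>x. c * f x))) = c * l2_inner M (U' (\<xi> j)) (A (U' f))"
      by (simp add: l2_inner_scale_right)
  next
    fix j f assume f: "f \<in> ?H"
    have "norm (l2_inner M (U' (\<xi> j)) (A (U' f))) \<le> l2_norm M (U' (\<xi> j)) * l2_norm M (A (U' f))"
      using f \<xi> by (intro l2_cauchy_schwarz clos)
    also have "\<dots> \<le> (CU * D) * (CA * (CU * l2_norm M f))"
    proof (rule mult_mono)
      show "l2_norm M (U' (\<xi> j)) \<le> CU * D"
        using CU(2)[OF \<xi>(1)[of j]] mult_left_mono[OF \<xi>(2)[of j] CU(1)] by simp
      show "l2_norm M (A (U' f)) \<le> CA * (CU * l2_norm M f)"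
        using CA(2)[OF clos(2)[OF f]] mult_left_mono[OF CU(2)[OF f] CA(1)] by simp
    qed (use CU(1) D_nonneg in simp_all)
    finally show "norm (l2_inner M (U' (\<xi> j)) (A (U' f))) \<le> CU * D * (CA * CU) * l2_norm M f"
      by (simp add: mult.assoc)
  qed (use \<xi> r CU(1) CA(1) D_nonneg in auto)
  from l2_trace_eq[OF this onb] show ?thesis
    by (simp add: transfer_op_def density_state_def)
qed

context
  fixes \<phi> :: "nat \<Rightarrow> 'a \<Rightarrow> real"
  assumes onb: "l2_onb M (l2_space M) UNIV (\<lambda>l x. complex_of_real (\<phi> l x))"
begin

lemma real_frame_of_onb: "real_frame M \<phi> L"
  using l2_onb_in[OF onb] l2_onb_inner[OF onb] by unfold_locales auto

lemma frame_projection_tendsto: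
  assumes f: "f \<in> l2_space M"
  shows "(\<lambda>L. l2_norm M (\<lambda>x. real_frame.frame_proj M \<phi> L f x - f x)) \<longlonglongrightarrow> 0"
  using onb_expansion_sequence[OF onb order_refl f]
  by (simp add: real_frame.frame_proj_def[OF real_frame_of_onb] l2_norm_diff_commute)

lemma frame_weight_tendsto:
  assumes total: "(\<Sum>j. complex_of_real (r j) * l2_inner M (\<xi> j) (\<xi> j)) = 1"
  shows "(\<lambda>L. \<Sum>j. complex_of_real (r j)
      * l2_inner M (real_frame.frame_proj M \<phi> L (\<xi> j)) (real_frame.frame_proj M \<phi> L (\<xi> j))) \<longlonglongrightarrow> 1"
proof -
  let ?P = "real_frame.frame_proj M \<phi>"
  note P_l2 = real_frame.V_l2[OF real_frame_of_onb real_frame.frame_proj_in_V[OF real_frame_of_onb]]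
  have lim: "(\<lambda>L. l2_inner M (?P L (\<xi> j)) (?P L (\<xi> j))) \<longlonglongrightarrow> l2_inner M (\<xi> j) (\<xi> j)" for j
    by (rule tendsto_l2_inner_perturb[where f'="\<lambda>_. \<xi> j" and g'="\<lambda>_. \<xi> j" and B=D])
      (auto simp: \<xi> P_l2 frame_projection_tendsto)
  have "norm (l2_inner M (?P L (\<xi> j)) (?P L (\<xi> j))) \<le> D * D" for L j
  proof -
    have "l2_norm M (?P L (\<xi> j)) \<le> D"
      using real_frame.frame_proj_norm[OF real_frame_of_onb \<xi>(1)] \<xi>(2) order_trans by blast
    then have "l2_norm M (?P L (\<xi> j)) * l2_norm M (?P L (\<xi> j)) \<le> D * D"
      by (intro mult_mono) (auto simp: D_nonneg)
    then show ?thesis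
      using l2_cauchy_schwarz[OF P_l2[of L "\<xi> j"] P_l2[of L "\<xi> j"]] by linarith
  qed
  then have "\<forall>\<^sub>F L in sequentially. \<forall>j. norm (complex_of_real (r j)
      * l2_inner M (?P L (\<xi> j)) (?P L (\<xi> j))) \<le> \<bar>r j\<bar> * (D * D)"
    by (intro always_eventually) (simp add: norm_mult mult_left_mono)
  from tendsto_suminf_dominated(1)[OF tendsto_mult_left[OF lim] this summable_mult2[OF r] sequentially_bot]
  show ?thesis unfolding total .
qed

text \<open>The evolved vectors at level \<open>L\<close> are \<open>P\<^sub>L U' P\<^sub>L \<xi>\<^sub>j\<close>. They converge to \<open>U' \<xi>\<^sub>j\<close> and stay bounded
  uniformly in \<open>j\<close> and \<open>L\<close>, so the summable weights dominate the series.\<close>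

lemma compressed_expectation_tendsto:
  assumes total: "(\<Sum>j. complex_of_real (r j) * l2_inner M (\<xi> j) (\<xi> j)) = 1"
  shows "(\<lambda>L. transfer_op M (leading_span \<phi> L) (compression M (leading_span \<phi> L) U)
            (density_state M (leading_span \<phi> L) (compressed_density M (leading_span \<phi> L) \<rho>))
            (compression M (leading_span \<phi> L) A))
     \<longlonglongrightarrow> transfer_op M (l2_space M) U (density_state M (l2_space M) \<rho>) A"
proof -
  let ?H = "l2_space M"
  let ?P = "real_frame.frame_proj M \<phi>" and ?W = "real_frame.frame_adj M \<phi>"
  note frame = real_frame_of_onb
  note P_l2 = real_frame.V_l2[OF frame real_frame.frame_proj_in_V[OF frame]]
  note W_l2 = real_frame.V_l2[OF frame real_frame.frame_adj_in_V[OF frame]]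
  note clos = l2_linear_closed[OF U_lin] l2_linear_closed[OF U'_lin] l2_linear_closed[OF A_lin]
  obtain CA where CA: "0 \<le> CA" "\<And>f. f \<in> ?H \<Longrightarrow> l2_norm M (A f) \<le> CA * l2_norm M f"
    "\<And>f g. f \<in> ?H \<Longrightarrow> g \<in> ?H \<Longrightarrow> l2_norm M (\<lambda>x. A f x - A g x) \<le> CA * l2_norm M (\<lambda>x. f x - g x)"
    by (rule l2_bounded_op_lipschitz[OF A]) (blast intro: that)
  obtain CU where CU: "0 \<le> CU" "\<And>f. f \<in> ?H \<Longrightarrow> l2_norm M (U' f) \<le> CU * l2_norm M f"
    "\<And>f g. f \<in> ?H \<Longrightarrow> g \<in> ?H \<Longrightarrow> l2_norm M (\<lambda>x. U' f x - U' g x) \<le> CU * l2_norm M (\<lambda>x. f x - g x)"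
    by (rule l2_bounded_op_lipschitz[OF U']) (blast intro: that)
  have W_eq: "?W L U f = ?P L (U' f)" if f: "f \<in> ?H" for L f
  proof -
    have "cnj (l2_inner M f (U (\<lambda>x. complex_of_real (\<phi> m x)))) = l2_inner M (\<lambda>x. complex_of_real (\<phi> m x)) (U' f)" for m
      using adj[OF f l2_onb_in[OF onb, of m]] l2_inner_commute[of M "\<lambda>x. complex_of_real (\<phi> m x)" "U' f"] by simp
    then show ?thesis
      by (simp add: real_frame.frame_adj_def[OF frame] real_frame.frame_proj_def[OF frame])
  qed
  define w where "w L j = ?W L U (?P L (\<xi> j))" for L j
  have w_l2: "w L j \<in> ?H" for L j unfolding w_def by (rule W_l2)
  have w_norm: "l2_norm M (w L j) \<le> CU * D" for L j
  proof -
    have "l2_norm M (?P L (\<xi> j)) \<le> D"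
      using real_frame.frame_proj_norm[OF frame \<xi>(1)] \<xi>(2) order_trans by blast
    then have "CU * l2_norm M (?P L (\<xi> j)) \<le> CU * D" using CU(1) by (rule mult_left_mono)
    moreover have "l2_norm M (w L j) \<le> l2_norm M (U' (?P L (\<xi> j)))"
      unfolding w_def W_eq[OF P_l2] by (intro real_frame.frame_proj_norm[OF frame] clos P_l2)
    moreover have "l2_norm M (U' (?P L (\<xi> j))) \<le> CU * l2_norm M (?P L (\<xi> j))"
      by (intro CU P_l2)
    ultimately show ?thesis by linarith
  qed
  have w_lim: "(\<lambda>L. l2_norm M (\<lambda>x. w L j x - U' (\<xi> j) x)) \<longlonglongrightarrow> 0" for j
  proof (rule Lim_null_comparison)
    show "(\<lambda>L. CU * l2_norm M (\<lambda>x. ?P L (\<xi> j) x - \<xi> j x)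
        + l2_norm M (\<lambda>x. ?P L (U' (\<xi> j)) x - U' (\<xi> j) x)) \<longlonglongrightarrow> 0"
      using frame_projection_tendsto[OF \<xi>(1)[of j]] frame_projection_tendsto[OF clos(2)[OF \<xi>(1)[of j]]]
      by (auto intro!: tendsto_eq_intros)
    have "l2_norm M (\<lambda>x. w L j x - U' (\<xi> j) x) \<le> CU * l2_norm M (\<lambda>x. ?P L (\<xi> j) x - \<xi> j x)
        + l2_norm M (\<lambda>x. ?P L (U' (\<xi> j)) x - U' (\<xi> j) x)" for L
    proof -
      interpret real_frame M \<phi> L by (rule frame)
      have "frame_proj (\<lambda>x. U' (frame_proj (\<xi> j)) x - U' (\<xi> j) x) = (\<lambda>x. frame_proj (U' (frame_proj (\<xi> j))) x - frame_proj (U' (\<xi> j)) x)"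
        unfolding frame_proj_def[of "\<lambda>x. U' (frame_proj (\<xi> j)) x - U' (\<xi> j) x"] frame_proj_def[of "U' (frame_proj (\<xi> j))"] frame_proj_def[of "U' (\<xi> j)"]
        by (subst l2_inner_diff_right)
          (auto simp: clos \<xi> P_l2 l2_onb_in[OF onb] left_diff_distrib sum_subtractf)
      then have "l2_norm M (\<lambda>x. frame_proj (U' (frame_proj (\<xi> j))) x - frame_proj (U' (\<xi> j)) x)
          \<le> l2_norm M (\<lambda>x. U' (frame_proj (\<xi> j)) x - U' (\<xi> j) x)"
        using frame_proj_norm[of "\<lambda>x. U' (frame_proj (\<xi> j)) x - U' (\<xi> j) x"] by (simp add: l2_diff clos \<xi> P_l2)
      also have "\<dots> \<le> CU * l2_norm M (\<lambda>x. frame_proj (\<xi> j) x - \<xi> j x)"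
        by (intro CU P_l2 \<xi>)
      finally show ?thesis
        using l2_triangle_diff[OF w_l2[of L j] P_l2[of L "U' (\<xi> j)"] clos(2)[OF \<xi>(1)[of j]]]
        by (simp add: w_def W_eq P_l2)
    qed
    then show "\<forall>\<^sub>F L in sequentially. norm (l2_norm M (\<lambda>x. w L j x - U' (\<xi> j) x))
        \<le> CU * l2_norm M (\<lambda>x. ?P L (\<xi> j) x - \<xi> j x) + l2_norm M (\<lambda>x. ?P L (U' (\<xi> j)) x - U' (\<xi> j) x)"
      by simp
  qed
  have inner_lim: "(\<lambda>L. l2_inner M (w L j) (A (w L j))) \<longlonglongrightarrow> l2_inner M (U' (\<xi> j)) (A (U' (\<xi> j)))" for j
  proof (rule tendsto_l2_inner_perturb[where f'="\<lambda>_. U' (\<xi> j)" and g'="\<lambda>_. A (U' (\<xi> j))"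
        and B="max (l2_norm M (U' (\<xi> j))) (l2_norm M (A (U' (\<xi> j))))"])
    show "(\<lambda>L. l2_norm M (\<lambda>x. A (w L j) x - A (U' (\<xi> j)) x)) \<longlonglongrightarrow> 0"
    proof (rule Lim_null_comparison)
      show "(\<lambda>L. CA * l2_norm M (\<lambda>x. w L j x - U' (\<xi> j) x)) \<longlonglongrightarrow> 0"
        using tendsto_mult_left[OF w_lim, of CA j] by simp
      show "\<forall>\<^sub>F L in sequentially. norm (l2_norm M (\<lambda>x. A (w L j) x - A (U' (\<xi> j)) x))
          \<le> CA * l2_norm M (\<lambda>x. w L j x - U' (\<xi> j) x)"
        using CA(3) w_l2 clos(2)[OF \<xi>(1)] by simp
    qed
  qed (auto simp: w_lim w_l2 clos \<xi>)
  have "norm (l2_inner M (w L j) (A (w L j))) \<le> (CU * D) * (CA * (CU * D))" for L j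
  proof -
    have "norm (l2_inner M (w L j) (A (w L j))) \<le> l2_norm M (w L j) * l2_norm M (A (w L j))"
      by (intro l2_cauchy_schwarz clos w_l2)
    also have "\<dots> \<le> (CU * D) * (CA * (CU * D))"
      using CA(2)[OF w_l2[of L j]] mult_left_mono[OF w_norm[of L j] CA(1)] w_norm[of L j] CU(1) D_nonneg
      by (intro mult_mono) auto
    finally show ?thesis .
  qed
  then have "\<forall>\<^sub>F L in sequentially. \<forall>j. norm (complex_of_real (r j) * l2_inner M (w L j) (A (w L j)))
      \<le> \<bar>r j\<bar> * ((CU * D) * (CA * (CU * D)))"
    by (intro always_eventually) (simp add: norm_mult mult_left_mono)
  from tendsto_suminf_dominated(1)[OF tendsto_mult_left[OF inner_lim] this summable_mult2[OF r] sequentially_bot]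
  have num: "(\<lambda>L. \<Sum>j. complex_of_real (r j) * l2_inner M (w L j) (A (w L j)))
      \<longlonglongrightarrow> (\<Sum>j. complex_of_real (r j) * l2_inner M (U' (\<xi> j)) (A (U' (\<xi> j))))" .
  have "transfer_op M (leading_span \<phi> L) (compression M (leading_span \<phi> L) U)
            (density_state M (leading_span \<phi> L) (compressed_density M (leading_span \<phi> L) \<rho>))
            (compression M (leading_span \<phi> L) A)
      = (\<Sum>j. complex_of_real (r j) * l2_inner M (w L j) (A (w L j)))
        / (\<Sum>j. complex_of_real (r j) * l2_inner M (?P L (\<xi> j)) (?P L (\<xi> j)))" for L
    unfolding w_def
    by (rule real_frame.compressed_expectation[OF frame U_lin A_lin \<rho>_l2 \<rho>_weak \<xi> r])
  then show ?thesis
    using tendsto_divide[OF num frame_weight_tendsto[OF total]] by (simp add: evolved_expectation[OF onb])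
qed

end

end

section \<open>The pointwise ergodic theorem\<close>

context
  fixes M :: "'a measure" and T :: "'a \<Rightarrow> 'a"
  assumes prob: "prob_space M" and T: "T \<in> measurable M M" and preserving: "distr M M T = M"
    and ergodic: "map_ergodic M T"
begin

interpretation prob_space M by (rule prob)

private lemma integral_compose:
  fixes g :: "'a \<Rightarrow> real"
  assumes "g \<in> borel_measurable M"
  shows "(\<integral>x. g (T x) \<partial>M) = (\<integral>x. g x \<partial>M)"
  using integral_distr[OF T assms] preserving by simp

private lemma iterate_measurable: "T ^^ k \<in> measurable M M"
proof (induction k)
  case (Suc k)
  then show ?case using T by (auto intro: measurable_comp)
qed (auto simp: id_def)

text \<open>The event \<open>E\<close> that the Birkhoff sums \<open>S\<^sub>n\<close> of \<open>f\<close> are unbounded above is invariant, so by ergodicity it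
  has measure \<open>0\<close> or \<open>1\<close>. The running maxima \<open>F\<^sub>n = max {S\<^sub>1, \<dots>, S\<^sub>n\<^sub>+\<^sub>1}\<close> satisfy
  \<open>F\<^sub>n\<^sub>+\<^sub>1 - F\<^sub>n \<circ> T = f + max 0 (- F\<^sub>n \<circ> T)\<close>, whose integral is nonnegative because \<open>F\<^sub>n \<le> F\<^sub>n\<^sub>+\<^sub>1\<close> and
  \<open>T\<close> preserves the measure. It is eventually equal to \<open>f\<close> at every point of \<open>E\<close>. If \<open>E\<close> had
  measure \<open>1\<close>, dominated convergence would give \<open>0 \<le> \<integral>f\<close>.\<close>

lemma birkhoff_sums_bounded_above:
  fixes f :: "'a \<Rightarrow> real"
  assumes f: "f \<in> borel_measurable M" and B: "\<And>x. \<bar>f x\<bar> \<le> B" and neg: "(\<integral>x. f x \<partial>M) < 0"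
  shows "AE x in M. \<exists>C. \<forall>n. (\<Sum>k<n. f ((T ^^ k) x)) \<le> C"
proof -
  define S where "S n x = (\<Sum>k<n. f ((T ^^ k) x))" for n x
  have S_Suc: "S (Suc n) x = f x + S n (T x)" for n x
    unfolding S_def by (subst sum.lessThan_Suc_shift) (simp add: funpow_swap1)
  have S_meas [measurable]: "S n \<in> borel_measurable M" for n
    unfolding S_def using measurable_compose[OF iterate_measurable f] by simp
  define E where "E = {x \<in> space M. \<forall>c::nat. \<exists>n. real c < S n x}"
  have E_sets: "E \<in> sets M" unfolding E_def by measurable
  have E_iff: "x \<in> E \<longleftrightarrow> x \<in> space M \<and> (\<forall>C. \<exists>n. C < S n x)" for x
  proof -
    have "\<exists>n. C < S n x" if "\<forall>c::nat. \<exists>n. real c < S n x" for C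
    proof -
      obtain c :: nat where "C < real c" using reals_Archimedean2 by blast
      then show ?thesis using that by (meson less_trans)
    qed
    then show ?thesis unfolding E_def by blast
  qed
  have E_shift: "(\<forall>C. \<exists>n. C < S n (T x)) \<longleftrightarrow> (\<forall>C. \<exists>n. C < S n x)" for x
  proof (intro iffI allI)
    fix C assume "\<forall>C. \<exists>n. C < S n (T x)"
    then obtain n where "C - f x < S n (T x)" by blast
    then show "\<exists>n. C < S n x" by (intro exI[of _ "Suc n"]) (simp add: S_Suc)
  next
    fix C assume "\<forall>C. \<exists>n. C < S n x"
    then obtain n where n: "max 0 (C + f x) < S n x" by blast
    then obtain m where "n = Suc m" by (cases n) (auto simp: S_def)
    with n show "\<exists>n. C < S n (T x)" by (intro exI[of _ m]) (simp add: S_Suc)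
  qed
  have E_invariant: "T -` E \<inter> space M = E"
    using measurable_space[OF T] E_shift by (auto simp: E_iff)
  define F where "F = rec_nat f (\<lambda>n g x. f x + max 0 (g (T x)))"
  have F_0: "F 0 = f" and F_Suc: "F (Suc n) x = f x + max 0 (F n (T x))" for n x
    by (simp_all add: F_def)
  have F_meas [measurable]: "F n \<in> borel_measurable M" for n
  proof (induction n)
    case (Suc n)
    have "(\<lambda>x. F n (T x)) \<in> borel_measurable M" using measurable_compose[OF T Suc] .
    then have "(\<lambda>x. f x + max 0 (F n (T x))) \<in> borel_measurable M" using f by measurable
    then show ?case by (simp add: F_Suc[abs_def])
  qed (simp add: F_0 f)
  have F_bound: "\<bar>F n x\<bar> \<le> real (Suc n) * B" for n x
  proof (induction n arbitrary: x)
    case (Suc n)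
    have "\<bar>F (Suc n) x\<bar> \<le> \<bar>f x\<bar> + \<bar>F n (T x)\<bar>" by (simp add: F_Suc)
    also have "\<dots> \<le> B + real (Suc n) * B" using B[of x] Suc[of "T x"] by (rule add_mono)
    finally show ?case by (simp add: algebra_simps)
  qed (simp add: F_0 B)
  have F_lower: "f x \<le> F n x" for n x by (cases n) (simp_all add: F_0 F_Suc)
  have F_mono: "F n x \<le> F (Suc n) x" for n x
  proof (induction n arbitrary: x)
    case (Suc n)
    then show ?case using Suc[of "T x"] by (simp add: F_Suc max.coboundedI2)
  qed (simp add: F_0 F_Suc)
  have S_le_F: "S (Suc k) x \<le> F n x" if "k \<le> n" for k n x
    using that
  proof (induction n arbitrary: k x)
    case 0
    then show ?case by (simp add: S_def F_0)
  next
    case (Suc n)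
    have "S k (T x) \<le> max 0 (F n (T x))"
    proof (cases k)
      case (Suc j)
      then show ?thesis using Suc.IH[of j "T x"] Suc.prems by simp
    qed (simp add: S_def)
    then show ?case by (simp add: S_Suc F_Suc)
  qed
  have F_int: "integrable M (F n)" for n
    by (rule integrable_const_bound[where B="real (Suc n) * B"]) (use F_bound in auto)
  have FT_meas: "(\<lambda>x. F n (T x)) \<in> borel_measurable M" for n
    using measurable_compose[OF T F_meas] .
  have FT_int: "integrable M (\<lambda>x. F n (T x))" for n
    by (rule integrable_const_bound[where B="real (Suc n) * B"]) (use F_bound FT_meas in auto)
  define D where "D n x = F (Suc n) x - F n (T x)" for n x
  have D_eq: "D n x = f x + max 0 (- F n (T x))" for n x
    by (simp add: D_def F_Suc)
  have D_nonneg: "0 \<le> (\<integral>x. D n x \<partial>M)" for n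
  proof -
    have "(\<integral>x. D n x \<partial>M) = (\<integral>x. F (Suc n) x \<partial>M) - (\<integral>x. F n x \<partial>M)"
      unfolding D_def using F_int FT_int integral_compose[OF F_meas] by simp
    moreover have "(\<integral>x. F n x \<partial>M) \<le> (\<integral>x. F (Suc n) x \<partial>M)"
      by (intro integral_mono F_int F_mono)
    ultimately show ?thesis by simp
  qed
  have "measure M E \<noteq> 1"
  proof
    assume "measure M E = 1"
    then have E_full: "AE x in M. x \<in> E"
      using E_sets by (simp add: prob_eq_1)
    have "(\<lambda>n. \<integral>x. D n x \<partial>M) \<longlonglongrightarrow> (\<integral>x. f x \<partial>M)"
    proof (rule integral_dominated_convergence[where w="\<lambda>_. 2 * B"])
      show "f \<in> borel_measurable M" by (rule f)
      show "D n \<in> borel_measurable M" for n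
        unfolding D_def[abs_def] using FT_meas by measurable
      show "AE x in M. (\<lambda>n. D n x) \<longlonglongrightarrow> f x"
        using E_full
      proof eventually_elim
        fix x assume "x \<in> E"
        then have "\<forall>C. \<exists>n. C < S n (T x)" using E_shift by (simp add: E_iff)
        then obtain m where m: "0 < S m (T x)" by blast
        then obtain k where "m = Suc k" by (cases m) (auto simp: S_def)
        with m S_le_F[of k] have F_pos: "0 < F n (T x)" if "k \<le> n" for n
          using that less_le_trans by blast
        then have "\<forall>\<^sub>F n in sequentially. D n x = f x"
          unfolding D_eq eventually_sequentially by (intro exI[of _ k] allI impI) (drule F_pos, simp)
        then show "(\<lambda>n. D n x) \<longlonglongrightarrow> f x" by (rule tendsto_eventually)
      qed
      have "\<bar>D n x\<bar> \<le> 2 * B" for n x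
        using B[of x] B[of "T x"] F_lower[of "T x" n] by (simp add: D_eq)
      then show "AE x in M. norm (D n x) \<le> 2 * B" for n by simp
    qed simp
    then have "0 \<le> (\<integral>x. f x \<partial>M)"
      by (rule LIMSEQ_le_const) (use D_nonneg in blast)
    then show False using neg by simp
  qed
  then have "measure M E = 0"
    using ergodic E_sets E_invariant unfolding map_ergodic_def by blast
  then have "AE x in M. x \<notin> E"
    using E_sets by (simp add: AE_iff_measurable prob_eq_0)
  then show ?thesis
    using AE_space
  proof eventually_elim
    fix x assume "x \<notin> E" "x \<in> space M"
    then show "\<exists>C. \<forall>n. (\<Sum>k<n. f ((T ^^ k) x)) \<le> C"
      unfolding E_iff S_def by (auto simp: not_less)
  qed
qed

private lemma birkhoff_upper:
  fixes f :: "'a \<Rightarrow> real"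
  assumes f: "f \<in> borel_measurable M" and B: "\<And>x. \<bar>f x\<bar> \<le> B"
  shows "AE x in M. \<forall>\<epsilon>>0. \<forall>\<^sub>F n in sequentially. (\<Sum>k<n. f ((T ^^ k) x)) / real n < (\<integral>x. f x \<partial>M) + \<epsilon>"
proof -
  let ?I = "\<integral>x. f x \<partial>M"
  define g where "g i x = f x - (?I + 1 / real (Suc i))" for i x
  have f_int: "integrable M f"
    by (rule integrable_const_bound[where B=B]) (use B f in auto)
  have "AE x in M. \<exists>C. \<forall>n. (\<Sum>k<n. g i ((T ^^ k) x)) \<le> C" for i
  proof (rule birkhoff_sums_bounded_above)
    show "g i \<in> borel_measurable M" unfolding g_def[abs_def] using f by measurable
    show "\<bar>g i x\<bar> \<le> B + \<bar>?I + 1 / real (Suc i)\<bar>" for x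
      unfolding g_def using B[of x] by linarith
    show "(\<integral>x. g i x \<partial>M) < 0"
      unfolding g_def using f_int by (simp add: prob_space)
  qed
  then have "AE x in M. \<forall>i. \<exists>C. \<forall>n. (\<Sum>k<n. g i ((T ^^ k) x)) \<le> C"
    by (simp add: AE_all_countable)
  then show ?thesis
  proof eventually_elim
    fix x assume bd: "\<forall>i. \<exists>C. \<forall>n. (\<Sum>k<n. g i ((T ^^ k) x)) \<le> C"
    show "\<forall>\<epsilon>>0. \<forall>\<^sub>F n in sequentially. (\<Sum>k<n. f ((T ^^ k) x)) / real n < ?I + \<epsilon>"
    proof (intro allI impI)
      fix \<epsilon> :: real assume "\<epsilon> > 0"
      then obtain i where i: "1 / real (Suc i) < \<epsilon>" using nat_approx_posE by blast
      obtain C where C: "\<And>n. (\<Sum>k<n. g i ((T ^^ k) x)) \<le> C" using bd by blast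
      have "(\<lambda>n. C / real n) \<longlonglongrightarrow> 0" by (rule lim_const_over_n)
      then have "\<forall>\<^sub>F n in sequentially. C / real n < \<epsilon> - 1 / real (Suc i)"
        using i by (intro order_tendstoD) auto
      then show "\<forall>\<^sub>F n in sequentially. (\<Sum>k<n. f ((T ^^ k) x)) / real n < ?I + \<epsilon>"
        using eventually_gt_at_top[of 0]
      proof eventually_elim
        fix n :: nat assume less: "C / real n < \<epsilon> - 1 / real (Suc i)" and n: "0 < n"
        have "(\<Sum>k<n. f ((T ^^ k) x)) \<le> C + real n * (?I + 1 / real (Suc i))"
          using C[of n] by (simp add: g_def sum_subtractf)
        then have "(\<Sum>k<n. f ((T ^^ k) x)) / real n \<le> (C + real n * (?I + 1 / real (Suc i))) / real n"
          by (rule divide_right_mono) simp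
        also have "\<dots> = C / real n + (?I + 1 / real (Suc i))"
          using n by (simp add: add_divide_distrib)
        finally show "(\<Sum>k<n. f ((T ^^ k) x)) / real n < ?I + \<epsilon>" using less by linarith
      qed
    qed
  qed
qed

lemma birkhoff_bounded_real:
  fixes f :: "'a \<Rightarrow> real"
  assumes f: "f \<in> borel_measurable M" and B: "\<And>x. \<bar>f x\<bar> \<le> B"
  shows "AE x in M. (\<lambda>n. (\<Sum>k<n. f ((T ^^ k) x)) / real n) \<longlonglongrightarrow> (\<integral>x. f x \<partial>M)"
proof -
  have "AE x in M. \<forall>\<epsilon>>0. \<forall>\<^sub>F n in sequentially.
      (\<Sum>k<n. - f ((T ^^ k) x)) / real n < (\<integral>x. - f x \<partial>M) + \<epsilon>"
    using f B by (intro birkhoff_upper[where B=B]) auto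
  with birkhoff_upper[OF f B] show ?thesis
  proof eventually_elim
    case (elim x)
    show ?case
    proof (rule tendstoI)
      fix \<epsilon> :: real assume "\<epsilon> > 0"
      show "\<forall>\<^sub>F n in sequentially. dist ((\<Sum>k<n. f ((T ^^ k) x)) / real n) (\<integral>x. f x \<partial>M) < \<epsilon>"
        using elim[rule_format, OF \<open>\<epsilon> > 0\<close>]
        by eventually_elim (auto simp: sum_negf dist_real_def abs_if)
    qed
  qed
qed

text \<open>The pointwise ergodic theorem for bounded functions: subtracting from \<open>f\<close> a little more than its mean
  leaves a function of negative mean, whose Birkhoff sums are bounded above and hence negligible
  after division by \<open>n\<close>; the same applies to \<open>- f\<close>.\<close>

lemma birkhoff_bounded_complex:
  fixes f :: "'a \<Rightarrow> complex"
  assumes f: "f \<in> borel_measurable M" and B: "\<And>x. norm (f x) \<le> B"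
  shows "AE x in M. (\<lambda>n. (\<Sum>k<n. f ((T ^^ k) x)) / of_nat n) \<longlonglongrightarrow> (\<integral>x. f x \<partial>M)"
proof -
  have f_int: "integrable M f"
    by (rule integrable_const_bound[where B=B]) (use B f in auto)
  have "AE x in M. (\<lambda>n. (\<Sum>k<n. Re (f ((T ^^ k) x))) / real n) \<longlonglongrightarrow> (\<integral>x. Re (f x) \<partial>M)"
    using f B abs_Re_le_cmod order_trans by (intro birkhoff_bounded_real[where B=B]) (auto, blast)
  moreover have "AE x in M. (\<lambda>n. (\<Sum>k<n. Im (f ((T ^^ k) x))) / real n) \<longlonglongrightarrow> (\<integral>x. Im (f x) \<partial>M)"
    using f B abs_Im_le_cmod order_trans by (intro birkhoff_bounded_real[where B=B]) (auto, blast)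
  ultimately show ?thesis
  proof eventually_elim
    case (elim x)
    then show ?case
      using f_int by (simp add: tendsto_complex_iff)
  qed
qed

end

section \<open>The Koopman operators of a flow\<close>

lemma flow_continuous:
  assumes "continuous_flow \<Phi>" shows "continuous_on UNIV (\<Phi> t)"
proof -
  have "continuous_on UNIV ((\<lambda>(t, x). \<Phi> t x) \<circ> (\<lambda>x. (t, x)))"
    using assms unfolding continuous_flow_def
    by (intro continuous_on_compose continuous_intros) (auto intro: continuous_on_subset)
  then show ?thesis by (simp add: o_def)
qed

lemma flow_add: "continuous_flow \<Phi> \<Longrightarrow> \<Phi> (s + t) x = \<Phi> s (\<Phi> t x)"
  by (simp add: continuous_flow_def)

lemma flow_zero: "continuous_flow \<Phi> \<Longrightarrow> \<Phi> 0 x = x"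
  by (simp add: continuous_flow_def)

lemma flow_iterate:
  assumes "continuous_flow \<Phi>"
  shows "(\<Phi> t ^^ n) x = \<Phi> (real n * t) x"
  by (induction n) (simp_all add: flow_zero[OF assms] distrib_right flow_add[OF assms])

lemma flow_measurable:
  assumes "continuous_flow \<Phi>" "sets \<mu> = sets borel"
  shows "\<Phi> t \<in> measurable \<mu> \<mu>"
  using borel_measurable_continuous_onI[OF flow_continuous[OF assms(1)]] assms(2)
  by (simp cong: measurable_cong_sets)

lemma koopman_inner:
  assumes flow: "continuous_flow \<Phi>" and sets: "sets \<mu> = sets borel" and inv: "flow_invariant \<mu> \<Phi>"
    and f: "f \<in> l2_space \<mu>" and g: "g \<in> l2_space \<mu>"
  shows "l2_inner \<mu> (koopman \<Phi> t f) (koopman \<Phi> t g) = l2_inner \<mu> f g"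
proof -
  have "l2_inner \<mu> f g = (\<integral>x. cnj (f x) * g x \<partial>(distr \<mu> \<mu> (\<Phi> t)))"
    using inv by (simp add: l2_inner_def flow_invariant_def)
  also have "\<dots> = (\<integral>x. cnj (f (\<Phi> t x)) * g (\<Phi> t x) \<partial>\<mu>)"
    using f g by (intro integral_distr flow_measurable[OF flow sets] borel_measurable_times
        measurable_cnj l2_measurable)
  finally show ?thesis by (simp add: l2_inner_def koopman_def)
qed

lemma koopman_l2:
  assumes flow: "continuous_flow \<Phi>" and sets: "sets \<mu> = sets borel" and inv: "flow_invariant \<mu> \<Phi>"
    and f: "f \<in> l2_space \<mu>"
  shows "koopman \<Phi> t f \<in> l2_space \<mu>"
proof -
  have "integrable (distr \<mu> \<mu> (\<Phi> t)) (\<lambda>x. (norm (f x))\<^sup>2)"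
    using inv l2_square_integrable[OF f] by (simp add: flow_invariant_def)
  then have "integrable \<mu> (\<lambda>x. (norm (f (\<Phi> t x)))\<^sup>2)"
    by (rule integrable_distr[OF flow_measurable[OF flow sets]])
  then show ?thesis
    using measurable_compose[OF flow_measurable[OF flow sets] l2_measurable[OF f]]
    by (simp add: l2_space_def koopman_def o_def)
qed

lemma koopman_bounded_op:
  assumes flow: "continuous_flow \<Phi>" and sets: "sets \<mu> = sets borel" and inv: "flow_invariant \<mu> \<Phi>"
  shows "l2_bounded_op \<mu> (l2_space \<mu>) (koopman \<Phi> t)"
  unfolding l2_bounded_op_def
proof (intro conjI ballI allI impI)
  fix f g assume f: "f \<in> l2_space \<mu>" and g: "g \<in> l2_space \<mu>" and eq: "l2_eq \<mu> f g"
  have "distr \<mu> \<mu> (\<Phi> t) = \<mu>" using inv by (simp add: flow_invariant_def)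
  then have "AE x in distr \<mu> \<mu> (\<Phi> t). f x = g x"
    using eq by (simp only: l2_eq_def)
  from AE_distrD[OF flow_measurable[OF flow sets] this]
  show "l2_eq \<mu> (koopman \<Phi> t f) (koopman \<Phi> t g)" by (simp add: l2_eq_def koopman_def)
next
  have "l2_norm \<mu> (koopman \<Phi> t f) \<le> 1 * l2_norm \<mu> f" if "f \<in> l2_space \<mu>" for f
  proof -
    have "(l2_norm \<mu> (koopman \<Phi> t f))\<^sup>2 = (l2_norm \<mu> f)\<^sup>2"
      using koopman_inner[OF assms that that, of t] unfolding l2_inner_self of_real_eq_iff .
    then show ?thesis by simp
  qed
  then show "\<exists>C. \<forall>f\<in>l2_space \<mu>. l2_norm \<mu> (koopman \<Phi> t f) \<le> C * l2_norm \<mu> f" by blast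
qed (simp_all add: koopman_l2[OF assms], simp_all add: l2_eq_def koopman_def)

lemma koopman_adjoint:
  assumes flow: "continuous_flow \<Phi>" and sets: "sets \<mu> = sets borel" and inv: "flow_invariant \<mu> \<Phi>"
    and f: "f \<in> l2_space \<mu>" and g: "g \<in> l2_space \<mu>"
  shows "l2_inner \<mu> (koopman \<Phi> (- t) f) g = l2_inner \<mu> f (koopman \<Phi> t g)"
proof -
  have "koopman \<Phi> t (koopman \<Phi> (- t) f) = f"
    using flow_add[OF flow, of "- t" t] flow_zero[OF flow] by (auto simp: koopman_def)
  then show ?thesis
    using koopman_inner[OF flow sets inv koopman_l2[OF flow sets inv f] g, of t "- t"] by simp
qed

section \<open>The sampling measure and the circular shift\<close>

context
  fixes \<Phi> :: "real \<Rightarrow> 'x::metric_space \<Rightarrow> 'x" and \<Delta>t :: real and x0 :: 'x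
begin

private abbreviation (input) "X \<equiv> orbit_pt \<Phi> \<Delta>t x0"
private abbreviation (input) "\<nu> \<equiv> sampling_measure \<Phi> \<Delta>t x0"

private lemma orbit_measurable: "X \<in> measurable (uniform_count_measure {..<N}) borel"
  by (simp add: measurable_def space_uniform_count_measure sets_uniform_count_measure)

lemma sets_sampling [simp]: "sets (\<nu> N) = sets borel"
  by (simp add: sampling_measure_def)

lemma measurable_sampling [simp]: "borel_measurable (\<nu> N) = borel_measurable borel"
  by (rule measurable_cong_sets) simp_all

lemma prob_space_sampling:
  assumes "N \<ge> 1" shows "prob_space (\<nu> N)"
proof -
  have "{..<N} \<noteq> {}" using assms by (simp add: lessThan_empty_iff)
  then show ?thesis
    unfolding sampling_measure_def
    by (rule prob_space.prob_space_distr[OF prob_space_uniform_count_measure[OF finite_lessThan] orbit_measurable])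
qed

lemma integral_sampling:
  fixes f :: "'x \<Rightarrow> 'b::{banach, second_countable_topology}"
  assumes "f \<in> borel_measurable borel"
  shows "(\<integral>x. f x \<partial>\<nu> N) = (\<Sum>n<N. f (X n)) /\<^sub>R real N"
proof -
  have "(\<integral>x. f x \<partial>\<nu> N) = (\<integral>n. f (X n) \<partial>uniform_count_measure {..<N})"
    unfolding sampling_measure_def by (rule integral_distr[OF orbit_measurable assms])
  also have "\<dots> = (\<Sum>n<N. (1 / real N) *\<^sub>R f (X n))"
    unfolding uniform_count_measure_def by (subst lebesgue_integral_point_measure_finite) auto
  also have "\<dots> = (\<Sum>n<N. f (X n)) /\<^sub>R real N"
    by (simp only: scaleR_sum_right inverse_eq_divide)
  finally show ?thesis .
qed

lemma sampling_l2:
  assumes "f \<in> borel_measurable borel"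
  shows "f \<in> l2_space (\<nu> N)"
proof -
  have "integrable (\<nu> N) (\<lambda>x. (norm (f x))\<^sup>2)"
    unfolding sampling_measure_def
    by (subst integrable_distr_eq[OF orbit_measurable])
      (use assms in \<open>simp_all add: uniform_count_measure_def integrable_point_measure_finite\<close>)
  then show ?thesis using assms by (simp add: l2_space_def)
qed

lemma sampling_l2_iff: "f \<in> l2_space (\<nu> N) \<longleftrightarrow> f \<in> borel_measurable borel"
proof
  show "f \<in> borel_measurable borel" if "f \<in> l2_space (\<nu> N)"
    using l2_measurable[OF that] by simp
qed (rule sampling_l2)

lemma sampling_inner:
  assumes "f \<in> borel_measurable borel" "g \<in> borel_measurable borel"
  shows "l2_inner (\<nu> N) f g = (\<Sum>n<N. cnj (f (X n)) * g (X n)) / of_nat N"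
proof -
  have "l2_inner (\<nu> N) f g = (\<Sum>n<N. cnj (f (X n)) * g (X n)) /\<^sub>R real N"
    unfolding l2_inner_def by (intro integral_sampling borel_measurable_times measurable_cnj assms)
  then show ?thesis by (simp add: scaleR_conv_of_real field_simps)
qed

lemma sampling_norm:
  assumes "f \<in> borel_measurable borel"
  shows "l2_norm (\<nu> N) f = sqrt ((\<Sum>n<N. (norm (f (X n)))\<^sup>2) / real N)"
proof -
  have "(\<integral>x. (norm (f x))\<^sup>2 \<partial>\<nu> N) = (\<Sum>n<N. (norm (f (X n)))\<^sup>2) /\<^sub>R real N"
    using assms by (intro integral_sampling) simp
  then show ?thesis by (simp add: l2_norm_def field_simps)
qed

lemma sampled_density_l2:
  assumes "\<And>j. \<xi> j \<in> borel_measurable borel"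
  shows "sampled_density (\<nu> N) r \<xi> f \<in> l2_space (\<nu> N)"
  unfolding sampled_density_def
proof (rule sampling_l2, rule borel_measurable_suminf)
  fix j
  show "(\<lambda>x. complex_of_real (r j) * l2_inner (\<nu> N) (\<xi> j) f * \<xi> j x) \<in> borel_measurable borel"
    by (rule borel_measurable_times[OF borel_measurable_const assms])
qed

text \<open>The sampled vectors need not be orthonormal; only their uniform bound enters, and inner products
  are finite averages, so summation over the state and integration commute.\<close>

lemma sampled_density_weak:
  assumes N: "N \<ge> 1" and \<xi>: "\<And>j. \<xi> j \<in> borel_measurable borel" "\<And>j x. norm (\<xi> j x) \<le> b"
    and r: "summable (\<lambda>j. \<bar>r j\<bar>)"
    and f: "f \<in> l2_space (\<nu> N)" and g: "g \<in> l2_space (\<nu> N)"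
  shows "(\<lambda>j. complex_of_real (r j) * l2_inner (\<nu> N) g (\<xi> j) * l2_inner (\<nu> N) (\<xi> j) f)
     sums l2_inner (\<nu> N) g (sampled_density (\<nu> N) r \<xi> f)"
proof -
  have b: "0 \<le> b" using \<xi>(2)[of 0 x0] norm_ge_zero order_trans by blast
  have \<xi>_norm: "l2_norm (\<nu> N) (\<xi> j) \<le> b" for j
    using N \<xi> b by (intro l2_norm_bounded prob_space_sampling) auto
  have meas: "f \<in> borel_measurable borel" "g \<in> borel_measurable borel"
    using f g by (simp_all add: sampling_l2_iff)
  have sd: "sampled_density (\<nu> N) r \<xi> f \<in> borel_measurable borel"
    using sampled_density_l2[OF \<xi>(1)] unfolding sampling_l2_iff .
  have "summable (\<lambda>j. complex_of_real (r j) * l2_inner (\<nu> N) (\<xi> j) f * \<xi> j x)" for x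
  proof (rule summable_comparison_test')
    show "summable (\<lambda>j. \<bar>r j\<bar> * (b * l2_norm (\<nu> N) f * b))" by (rule summable_mult2[OF r])
    fix j :: nat
    have "norm (l2_inner (\<nu> N) (\<xi> j) f) \<le> b * l2_norm (\<nu> N) f"
      using l2_cauchy_schwarz[OF sampling_l2[OF \<xi>(1)] f, of j] mult_right_mono[OF \<xi>_norm[of j] l2_norm_nonneg]
        order_trans by blast
    then have "norm (l2_inner (\<nu> N) (\<xi> j) f) * norm (\<xi> j x) \<le> b * l2_norm (\<nu> N) f * b"
      using \<xi>(2) b by (intro mult_mono) auto
    then show "norm (complex_of_real (r j) * l2_inner (\<nu> N) (\<xi> j) f * \<xi> j x) \<le> \<bar>r j\<bar> * (b * l2_norm (\<nu> N) f * b)"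
      by (simp add: norm_mult mult.assoc mult_left_mono)
  qed
  then have "(\<lambda>j. complex_of_real (r j) * l2_inner (\<nu> N) (\<xi> j) f * \<xi> j x)
      sums sampled_density (\<nu> N) r \<xi> f x" for x
    unfolding sampled_density_def by (rule summable_sums)
  then have "(\<lambda>j. (\<Sum>n<N. cnj (g (X n)) * (complex_of_real (r j) * l2_inner (\<nu> N) (\<xi> j) f * \<xi> j (X n))) / of_nat N)
      sums ((\<Sum>n<N. cnj (g (X n)) * sampled_density (\<nu> N) r \<xi> f (X n)) / of_nat N)"
    by (intro sums_divide sums_sum sums_mult)
  moreover have "(\<Sum>n<N. cnj (g (X n)) * (complex_of_real (r j) * l2_inner (\<nu> N) (\<xi> j) f * \<xi> j (X n))) / of_nat N
      = complex_of_real (r j) * l2_inner (\<nu> N) g (\<xi> j) * l2_inner (\<nu> N) (\<xi> j) f" for j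
    unfolding sampling_inner[OF meas(2) \<xi>(1)]
    by (simp add: sum_distrib_left sum_distrib_right mult_ac)
  ultimately show ?thesis
    using sampling_inner[OF meas(2) sd] by simp
qed

lemma shift_op_orbit:
  assumes "inj X" "n < N"
  shows "shift_op \<Phi> \<Delta>t x0 N f (X n) = f (X (if n = N - 1 then 0 else n + 1))"
proof -
  have "(THE m. m < N \<and> X m = X n) = n"
    using assms by (intro the_equality) (auto dest: injD)
  then show ?thesis
    using assms(2) by (simp add: shift_op_def)
qed

lemma shift_op_measurable: "shift_op \<Phi> \<Delta>t x0 N f \<in> borel_measurable borel"
proof -
  let ?S = "X ` {..<N}"
  have "shift_op \<Phi> \<Delta>t x0 N f = (\<lambda>x. \<Sum>s\<in>?S. indicator {s} x * shift_op \<Phi> \<Delta>t x0 N f s)"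
  proof
    fix x
    have "(\<Sum>s\<in>?S. indicator {s} x * shift_op \<Phi> \<Delta>t x0 N f s)
        = (\<Sum>s\<in>?S. if s = x then shift_op \<Phi> \<Delta>t x0 N f x else 0)"
      by (intro sum.cong) (auto simp: indicator_def)
    also have "\<dots> = shift_op \<Phi> \<Delta>t x0 N f x"
      by (simp add: shift_op_def)
    finally show "shift_op \<Phi> \<Delta>t x0 N f x = (\<Sum>s\<in>?S. indicator {s} x * shift_op \<Phi> \<Delta>t x0 N f s)" ..
  qed
  moreover have "(\<lambda>x. \<Sum>s\<in>?S. indicator {s} x * shift_op \<Phi> \<Delta>t x0 N f s) \<in> borel_measurable borel"
    by (intro borel_measurable_sum borel_measurable_times borel_measurable_indicator
        borel_measurable_const) simp
  ultimately show ?thesis by simp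
qed

lemma shift_power_measurable:
  "f \<in> borel_measurable borel \<Longrightarrow> (shift_op \<Phi> \<Delta>t x0 N ^^ q) f \<in> borel_measurable borel"
  by (cases q) (simp_all add: shift_op_measurable)

lemma shift_op_add:
  "shift_op \<Phi> \<Delta>t x0 N (\<lambda>x. f x + g x) = (\<lambda>x. shift_op \<Phi> \<Delta>t x0 N f x + shift_op \<Phi> \<Delta>t x0 N g x)"
  and shift_op_diff:
  "shift_op \<Phi> \<Delta>t x0 N (\<lambda>x. f x - g x) = (\<lambda>x. shift_op \<Phi> \<Delta>t x0 N f x - shift_op \<Phi> \<Delta>t x0 N g x)"
  and shift_op_scale:
  "shift_op \<Phi> \<Delta>t x0 N (\<lambda>x. c * f x) = (\<lambda>x. c * shift_op \<Phi> \<Delta>t x0 N f x)"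
  unfolding fun_eq_iff shift_op_def Let_def by auto

lemma shift_power_linear: "l2_linear (\<nu> N) (shift_op \<Phi> \<Delta>t x0 N ^^ q)"
proof -
  have "(shift_op \<Phi> \<Delta>t x0 N ^^ q) (\<lambda>x. f x + g x)
      = (\<lambda>x. (shift_op \<Phi> \<Delta>t x0 N ^^ q) f x + (shift_op \<Phi> \<Delta>t x0 N ^^ q) g x)" for f g
    by (induction q) (simp_all add: shift_op_add shift_op_scale)
  moreover have "(shift_op \<Phi> \<Delta>t x0 N ^^ q) (\<lambda>x. c * f x) = (\<lambda>x. c * (shift_op \<Phi> \<Delta>t x0 N ^^ q) f x)" for c f
    by (induction q) (simp_all add: shift_op_add shift_op_scale)
  ultimately show ?thesis
    by (simp add: l2_linear_def sampling_l2_iff shift_power_measurable l2_eq_def)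
qed

lemma shift_op_norm:
  assumes inj: "inj X" and f: "f \<in> borel_measurable borel"
  shows "l2_norm (\<nu> N) (shift_op \<Phi> \<Delta>t x0 N f) = l2_norm (\<nu> N) f"
proof (cases N)
  case (Suc m)
  have "(\<Sum>n<N. (norm (shift_op \<Phi> \<Delta>t x0 N f (X n)))\<^sup>2)
      = (\<Sum>n<N. (norm (f (X (if n = m then 0 else n + 1))))\<^sup>2)"
    using inj Suc by (intro sum.cong refl) (auto simp: shift_op_orbit)
  also have "\<dots> = (\<Sum>n<m. (norm (f (X (Suc n))))\<^sup>2) + (norm (f (X 0)))\<^sup>2"
    unfolding Suc by simp
  also have "\<dots> = (\<Sum>n<N. (norm (f (X n)))\<^sup>2)"
    unfolding Suc by (subst sum.lessThan_Suc_shift) simp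
  finally show ?thesis
    by (simp add: sampling_norm shift_op_measurable f)
qed (simp add: sampling_norm shift_op_measurable f)

context
  assumes flow: "continuous_flow \<Phi>" and inj: "inj X"
begin

lemma orbit_Suc: "X (Suc n) = \<Phi> \<Delta>t (X n)"
  using flow_add[OF flow, of \<Delta>t "real n * \<Delta>t" x0] by (simp add: orbit_pt_def distrib_right)

text \<open>The circular shift agrees with the flow at every sample point except the last one, whose
  weight \<open>1 / N\<close> vanishes in the limit.\<close>

lemma shift_op_approx_flow:
  assumes g: "g \<in> borel_measurable borel" "\<And>x. norm (g x) \<le> B"
    and gN: "\<And>N. N \<ge> N0 \<Longrightarrow> gN N \<in> borel_measurable borel"
    and lim: "(\<lambda>N. l2_norm (\<nu> N) (\<lambda>x. gN N x - g x)) \<longlonglongrightarrow> 0"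
  shows "(\<lambda>N. l2_norm (\<nu> N) (\<lambda>x. shift_op \<Phi> \<Delta>t x0 N (gN N) x - koopman \<Phi> \<Delta>t g x)) \<longlonglongrightarrow> 0"
proof (rule Lim_null_comparison)
  have "(\<lambda>N. (2 * B)\<^sup>2 / real N) \<longlonglongrightarrow> 0" by (rule lim_const_over_n)
  from tendsto_add[OF lim tendsto_real_sqrt[OF this]]
  show "(\<lambda>N. l2_norm (\<nu> N) (\<lambda>x. gN N x - g x) + sqrt ((2 * B)\<^sup>2 / real N)) \<longlonglongrightarrow> 0" by simp
  have koop: "koopman \<Phi> \<Delta>t g \<in> borel_measurable borel"
    unfolding koopman_def o_def
    by (rule measurable_compose[OF borel_measurable_continuous_onI[OF flow_continuous[OF flow]] g(1)])
  show "\<forall>\<^sub>F N in sequentially.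
      norm (l2_norm (\<nu> N) (\<lambda>x. shift_op \<Phi> \<Delta>t x0 N (gN N) x - koopman \<Phi> \<Delta>t g x))
      \<le> l2_norm (\<nu> N) (\<lambda>x. gN N x - g x) + sqrt ((2 * B)\<^sup>2 / real N)"
    using eventually_ge_at_top[of "max 1 N0"]
  proof eventually_elim
    fix N assume N: "max 1 N0 \<le> N"
    let ?s = "shift_op \<Phi> \<Delta>t x0 N"
    have gN': "gN N \<in> borel_measurable borel" using gN N by simp
    have "(\<lambda>x. ?s (gN N) x - ?s g x) = ?s (\<lambda>x. gN N x - g x)"
      by (rule shift_op_diff[symmetric])
    then have 1: "l2_norm (\<nu> N) (\<lambda>x. ?s (gN N) x - ?s g x) = l2_norm (\<nu> N) (\<lambda>x. gN N x - g x)"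
      using shift_op_norm[OF inj, of "\<lambda>x. gN N x - g x" N] gN' g(1) by simp
    have "(\<Sum>n<N. (norm (?s g (X n) - koopman \<Phi> \<Delta>t g (X n)))\<^sup>2)
        \<le> (\<Sum>n<N. if n = N - 1 then (2 * B)\<^sup>2 else 0)"
    proof (rule sum_mono)
      fix n assume "n \<in> {..<N}"
      then have "?s g (X n) = g (X (if n = N - 1 then 0 else n + 1))"
        using inj by (simp add: shift_op_orbit)
      moreover have "koopman \<Phi> \<Delta>t g (X n) = g (X (Suc n))"
        by (simp add: koopman_def orbit_Suc)
      moreover have "norm (g (X 0) - g (X (Suc n))) \<le> 2 * B"
        using norm_triangle_ineq4[of "g (X 0)" "g (X (Suc n))"] g(2)[of "X 0"] g(2)[of "X (Suc n)"]
        by linarith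
      ultimately show "(norm (?s g (X n) - koopman \<Phi> \<Delta>t g (X n)))\<^sup>2 \<le> (if n = N - 1 then (2 * B)\<^sup>2 else 0)"
        using power_mono[of "norm (g (X 0) - g (X (Suc n)))" "2 * B" 2]
        by (cases "n = N - 1") (simp_all del: power_mult_distrib)
    qed
    also have "\<dots> = (2 * B)\<^sup>2" using N by (simp add: sum.delta)
    finally have 2: "l2_norm (\<nu> N) (\<lambda>x. ?s g x - koopman \<Phi> \<Delta>t g x) \<le> sqrt ((2 * B)\<^sup>2 / real N)"
      using koop by (subst sampling_norm) (auto intro: borel_measurable_diff shift_op_measurable divide_right_mono)
    have tri: "l2_norm (\<nu> N) (\<lambda>x. ?s (gN N) x - koopman \<Phi> \<Delta>t g x)
        \<le> l2_norm (\<nu> N) (\<lambda>x. ?s (gN N) x - ?s g x) + l2_norm (\<nu> N) (\<lambda>x. ?s g x - koopman \<Phi> \<Delta>t g x)"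
      by (intro l2_triangle_diff sampling_l2 shift_op_measurable koop)
    show "norm (l2_norm (\<nu> N) (\<lambda>x. ?s (gN N) x - koopman \<Phi> \<Delta>t g x))
        \<le> l2_norm (\<nu> N) (\<lambda>x. gN N x - g x) + sqrt ((2 * B)\<^sup>2 / real N)"
      using tri 1 2 by simp
  qed
qed

lemma shift_power_approx_flow:
  assumes g: "continuous_on UNIV g" "\<And>x. norm (g x) \<le> B"
    and gN: "\<And>N. N \<ge> N0 \<Longrightarrow> gN N \<in> borel_measurable borel"
    and lim: "(\<lambda>N. l2_norm (\<nu> N) (\<lambda>x. gN N x - g x)) \<longlonglongrightarrow> 0"
  shows "(\<lambda>N. l2_norm (\<nu> N) (\<lambda>x. (shift_op \<Phi> \<Delta>t x0 N ^^ q) (gN N) x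
      - koopman \<Phi> (real q * \<Delta>t) g x)) \<longlonglongrightarrow> 0"
proof (induction q)
  case 0
  then show ?case using lim by (simp add: koopman_def flow_zero[OF flow])
next
  case (Suc q)
  have "koopman \<Phi> (real q * \<Delta>t) g \<in> borel_measurable borel"
    unfolding koopman_def
    by (intro borel_measurable_continuous_onI continuous_on_compose flow_continuous[OF flow]
        continuous_on_subset[OF g(1)]) simp
  moreover have "norm (koopman \<Phi> (real q * \<Delta>t) g x) \<le> B" for x
    by (simp add: koopman_def g(2))
  moreover have "koopman \<Phi> \<Delta>t (koopman \<Phi> (real q * \<Delta>t) g) = koopman \<Phi> (real (Suc q) * \<Delta>t) g"
    using flow_add[OF flow, of "real q * \<Delta>t" \<Delta>t] by (auto simp: koopman_def distrib_right add.commute)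
  ultimately show ?case
    using shift_op_approx_flow[of "koopman \<Phi> (real q * \<Delta>t) g" B N0
        "\<lambda>N. (shift_op \<Phi> \<Delta>t x0 N ^^ q) (gN N)"] Suc gN
    by (simp add: shift_power_measurable)
qed

end

end

section \<open>Continuous representatives of eigenfunctions\<close>

lemma eigenfunction_representative:
  assumes "kernel_eigenbasis M k I \<phi> eig" "l \<in> I" "eig l \<noteq> 0"
  shows "l2_eq M (\<lambda>x. complex_of_real (\<phi> l x))
    (\<lambda>x. complex_of_real (continuous_rep M k (eig l) (\<phi> l) x))"
proof -
  have "AE x in M. kernel_op M k (\<lambda>x. complex_of_real (\<phi> l x)) x
      = complex_of_real (eig l) * complex_of_real (\<phi> l x)"
    using assms unfolding kernel_eigenbasis_def l2_eq_def by blast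
  moreover have "kernel_op M k (\<lambda>x. complex_of_real (\<phi> l x)) x
      = complex_of_real (\<integral>x'. k x x' * \<phi> l x' \<partial>M)" for x
    by (simp only: kernel_op_def of_real_mult[symmetric] integral_complex_of_real)
  ultimately show ?thesis
    unfolding l2_eq_def continuous_rep_def using assms(3)
    by (elim eventually_mono) (simp flip: of_real_mult)
qed

text \<open>Dominated convergence, as the kernel is bounded on the compact space.\<close>

lemma continuous_rep_continuous:
  fixes k :: "'x::metric_space \<Rightarrow> 'x \<Rightarrow> real"
  assumes compact: "compact (UNIV :: 'x set)" and k: "continuous_symmetric_kernel k"
    and sets: "sets \<mu> = sets borel" and prob: "prob_space \<mu>"
    and \<phi>: "(\<lambda>x. complex_of_real (\<phi> x)) \<in> l2_space \<mu>"
  shows "continuous_on UNIV (continuous_rep \<mu> k lam \<phi>)"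
proof -
  interpret prob_space \<mu> by (rule prob)
  have k_cont: "continuous_on UNIV (\<lambda>(x, y). k x y)"
    using k by (simp add: continuous_symmetric_kernel_def)
  have "compact ((\<lambda>(x, y). k x y) ` (UNIV \<times> UNIV))"
    using k_cont by (intro compact_continuous_image compact_Times compact) simp
  then obtain K where "\<forall>z\<in>(\<lambda>(x, y). k x y) ` (UNIV \<times> UNIV). norm z \<le> K"
    using compact_imp_bounded[of "(\<lambda>(x, y). k x y) ` (UNIV \<times> UNIV)"] unfolding bounded_iff by blast
  then have K: "\<bar>k x y\<bar> \<le> K" for x y by auto
  have kx: "continuous_on UNIV (\<lambda>y. k x y)" for x
  proof -
    have "continuous_on UNIV ((\<lambda>(x, y). k x y) \<circ> (\<lambda>y. (x, y)))"
      by (intro continuous_on_compose continuous_intros) (auto intro: continuous_on_subset[OF k_cont])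
    then show ?thesis by (simp add: o_def)
  qed
  have ky: "continuous_on UNIV (\<lambda>x. k x y)" for y
  proof -
    have "continuous_on UNIV ((\<lambda>(x, y). k x y) \<circ> (\<lambda>x. (x, y)))"
      by (intro continuous_on_compose continuous_intros) (auto intro: continuous_on_subset[OF k_cont])
    then show ?thesis by (simp add: o_def)
  qed
  have k_meas: "(\<lambda>y. k x y) \<in> borel_measurable \<mu>" for x
    using borel_measurable_continuous_onI[OF kx] sets by (simp cong: measurable_cong_sets)
  have \<phi>_meas: "\<phi> \<in> borel_measurable \<mu>"
    using measurable_compose[OF l2_measurable[OF \<phi>] borel_measurable_Re] by simp
  have \<phi>_int: "integrable \<mu> \<phi>"
  proof (rule Bochner_Integration.integrable_bound)
    show "integrable \<mu> (\<lambda>x. 1 + (\<phi> x)\<^sup>2)"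
      using l2_square_integrable[OF \<phi>] by simp
    have "\<bar>\<phi> x\<bar> \<le> 1 + (\<phi> x)\<^sup>2" for x
      using sum_squares_bound[of "\<bar>\<phi> x\<bar>" 1] by (simp add: power2_eq_square)
    then show "AE x in \<mu>. norm (\<phi> x) \<le> norm (1 + (\<phi> x)\<^sup>2)"
      by (intro AE_I2) simp
  qed (rule \<phi>_meas)
  have "continuous_on UNIV (\<lambda>x. \<integral>x'. k x x' * \<phi> x' \<partial>\<mu>)"
    unfolding continuous_on_sequentially
  proof (intro allI ballI impI, elim conjE)
    fix u :: "nat \<Rightarrow> 'x" and a assume u: "u \<longlonglongrightarrow> a"
    have "(\<lambda>n. \<integral>x'. k (u n) x' * \<phi> x' \<partial>\<mu>) \<longlonglongrightarrow> (\<integral>x'. k a x' * \<phi> x' \<partial>\<mu>)"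
    proof (rule integral_dominated_convergence[where w="\<lambda>x'. K * \<bar>\<phi> x'\<bar>"])
      show "integrable \<mu> (\<lambda>x'. K * \<bar>\<phi> x'\<bar>)" using \<phi>_int by simp
      show "AE x' in \<mu>. (\<lambda>n. k (u n) x' * \<phi> x') \<longlonglongrightarrow> k a x' * \<phi> x'"
      proof (rule AE_I2)
        fix x'
        have "(\<lambda>n. k (u n) x') \<longlonglongrightarrow> k a x'"
          by (rule continuous_on_tendsto_compose[OF ky u]) simp_all
        then show "(\<lambda>n. k (u n) x' * \<phi> x') \<longlonglongrightarrow> k a x' * \<phi> x'"
          by (rule tendsto_mult_right)
      qed
      show "AE x' in \<mu>. norm (k (u n) x' * \<phi> x') \<le> K * \<bar>\<phi> x'\<bar>" for n
        using K by (simp add: abs_mult mult_right_mono)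
    qed (use k_meas \<phi>_meas in auto)
    then show "((\<lambda>x. \<integral>x'. k x x' * \<phi> x' \<partial>\<mu>) \<circ> u) \<longlonglongrightarrow> (\<integral>x'. k a x' * \<phi> x' \<partial>\<mu>)"
      by (simp add: o_def)
  qed
  then show ?thesis
    unfolding continuous_rep_def[abs_def] by (cases "lam = 0") (auto intro!: continuous_intros)
qed

section \<open>The sampling limit\<close>

lemma (in real_frame) compressed_expectation_matrix:
  assumes U: "l2_linear M U" and A: "l2_linear M A"
    and \<sigma>: "\<And>f. f \<in> l2_space M \<Longrightarrow> \<sigma> f \<in> l2_space M"
      "\<And>f g. f \<in> l2_space M \<Longrightarrow> g \<in> l2_space M \<Longrightarrow>
        (\<lambda>j. complex_of_real (r j) * l2_inner M g (\<xi> j) * l2_inner M (\<xi> j) f) sums l2_inner M g (\<sigma> f)"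
    and \<xi>: "\<And>j. \<xi> j \<in> l2_space M" "\<And>j. l2_norm M (\<xi> j) \<le> D"
    and r: "summable (\<lambda>j. \<bar>r j\<bar>)"
  shows "transfer_op M V (compression M V U) (density_state M V (compressed_density M V \<sigma>)) (compression M V A)
    = frame_expectation L r (\<lambda>j l. l2_inner M (e l) (\<xi> j)) (\<lambda>l m. l2_inner M (e l) (U (e m)))
        (\<lambda>m n. l2_inner M (e m) (A (e n)))"
  unfolding frame_expectation_eq[OF U A \<xi>(1)] by (rule compressed_expectation[OF U A \<sigma> \<xi> r])

text \<open>For fixed \<open>L\<close> every entry of the two matrices is eventually bounded by its limit plus one, so the
  bound on the coordinates of the state, uniform in \<open>j\<close>, makes the series over the state dominated.\<close>

lemma frame_expectation_tendsto:
  assumes x: "\<And>j l. l < L \<Longrightarrow> (\<lambda>N. xN N j l) \<longlonglongrightarrow> x j l"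
    and u: "\<And>l m. l < L \<Longrightarrow> m < L \<Longrightarrow> (\<lambda>N. uN N l m) \<longlonglongrightarrow> u l m"
    and a: "\<And>m n. m < L \<Longrightarrow> n < L \<Longrightarrow> (\<lambda>N. aN N m n) \<longlonglongrightarrow> a m n"
    and bound: "\<forall>\<^sub>F N in sequentially. \<forall>j. \<forall>l<L. norm (xN N j l) \<le> D"
    and r: "summable (\<lambda>j. \<bar>r j\<bar>)" and nonzero: "frame_weight L r x \<noteq> 0"
  shows "(\<lambda>N. frame_expectation L r (xN N) (uN N) (aN N)) \<longlonglongrightarrow> frame_expectation L r x u a"
proof -
  have coord: "(\<lambda>N. frame_coord L (xN N) (uN N) j m) \<longlonglongrightarrow> frame_coord L x u j m" if "m < L" for j m
    unfolding frame_coord_def using that by (intro tendsto_sum tendsto_mult tendsto_cnj x u) auto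
  have ev_bound: "\<forall>\<^sub>F N in sequentially. \<forall>l<L. \<forall>m<L. norm (v N l m) \<le> norm (w l m) + 1"
    if lim: "\<And>l m. l < L \<Longrightarrow> m < L \<Longrightarrow> (\<lambda>N. v N l m) \<longlonglongrightarrow> w l m"
    for v :: "nat \<Rightarrow> nat \<Rightarrow> nat \<Rightarrow> complex" and w
  proof -
    have "\<forall>\<^sub>F N in sequentially. norm (v N l m) \<le> norm (w l m) + 1" if "l < L" "m < L" for l m
      using order_tendstoD(2)[OF tendsto_norm[OF lim[OF that]], of "norm (w l m) + 1"]
      by (auto elim: eventually_mono)
    then have "\<forall>\<^sub>F N in sequentially. \<forall>l\<in>{..<L}. \<forall>m\<in>{..<L}. norm (v N l m) \<le> norm (w l m) + 1"
      by (intro eventually_ball_finite ballI finite_lessThan) auto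
    then show ?thesis by (rule eventually_mono) auto
  qed
  have ev_u: "\<forall>\<^sub>F N in sequentially. \<forall>l<L. \<forall>m<L. norm (uN N l m) \<le> norm (u l m) + 1"
    by (rule ev_bound) (rule u)
  have ev_a: "\<forall>\<^sub>F N in sequentially. \<forall>m<L. \<forall>n<L. norm (aN N m n) \<le> norm (a m n) + 1"
    by (rule ev_bound) (rule a)
  define c where "c m = (\<Sum>l<L. D * (norm (u l m) + 1))" for m
  have num: "(\<lambda>N. \<Sum>j. complex_of_real (r j) * (\<Sum>m<L. \<Sum>n<L. cnj (frame_coord L (xN N) (uN N) j m)
        * (frame_coord L (xN N) (uN N) j n * aN N m n)))
      \<longlonglongrightarrow> (\<Sum>j. complex_of_real (r j) * (\<Sum>m<L. \<Sum>n<L. cnj (frame_coord L x u j m)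
        * (frame_coord L x u j n * a m n)))"
  proof (rule tendsto_suminf_dominated(1))
    show "(\<lambda>N. complex_of_real (r j) * (\<Sum>m<L. \<Sum>n<L. cnj (frame_coord L (xN N) (uN N) j m)
        * (frame_coord L (xN N) (uN N) j n * aN N m n)))
      \<longlonglongrightarrow> complex_of_real (r j) * (\<Sum>m<L. \<Sum>n<L. cnj (frame_coord L x u j m)
        * (frame_coord L x u j n * a m n))" for j
      by (intro tendsto_mult_left tendsto_sum tendsto_mult tendsto_cnj coord a) auto
    show "summable (\<lambda>j. \<bar>r j\<bar> * (\<Sum>m<L. \<Sum>n<L. c m * (c n * (norm (a m n) + 1))))"
      by (rule summable_mult2[OF r])
    show "\<forall>\<^sub>F N in sequentially. \<forall>j. norm (complex_of_real (r j) *
          (\<Sum>m<L. \<Sum>n<L. cnj (frame_coord L (xN N) (uN N) j m) * (frame_coord L (xN N) (uN N) j n * aN N m n)))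
        \<le> \<bar>r j\<bar> * (\<Sum>m<L. \<Sum>n<L. c m * (c n * (norm (a m n) + 1)))"
      using bound ev_u ev_a
    proof eventually_elim
      case (elim N)
      show ?case
      proof
        fix j
        have fc: "norm (frame_coord L (xN N) (uN N) j m) \<le> c m" if m: "m < L" for m
        proof -
          have "norm (frame_coord L (xN N) (uN N) j m) \<le> (\<Sum>l<L. norm (xN N j l) * norm (uN N l m))"
            unfolding frame_coord_def by (rule order_trans[OF norm_sum]) (simp add: norm_mult)
          also have "\<dots> \<le> c m"
            unfolding c_def
          proof (intro sum_mono mult_mono)
            fix l assume "l \<in> {..<L}"
            then have l: "l < L" by simp
            show "norm (xN N j l) \<le> D" using elim(1) l by blast
            then show "0 \<le> D" using norm_ge_zero order_trans by blast
            show "norm (uN N l m) \<le> norm (u l m) + 1" using elim(2) l m by blast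
          qed simp
          finally show ?thesis .
        qed
        have c0: "0 \<le> c m" if "m < L" for m using fc[OF that] norm_ge_zero order_trans by blast
        have "norm (\<Sum>m<L. \<Sum>n<L. cnj (frame_coord L (xN N) (uN N) j m) * (frame_coord L (xN N) (uN N) j n * aN N m n))
            \<le> (\<Sum>m<L. \<Sum>n<L. norm (frame_coord L (xN N) (uN N) j m) * (norm (frame_coord L (xN N) (uN N) j n) * norm (aN N m n)))"
          by (rule order_trans[OF norm_sum], rule sum_mono, rule order_trans[OF norm_sum]) (simp add: norm_mult)
        also have "\<dots> \<le> (\<Sum>m<L. \<Sum>n<L. c m * (c n * (norm (a m n) + 1)))"
        proof (intro sum_mono)
          fix m n assume "m \<in> {..<L}" "n \<in> {..<L}"
          then have mn: "m < L" "n < L" by simp_all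
          have "norm (aN N m n) \<le> norm (a m n) + 1" using elim(3) mn by blast
          then have "norm (frame_coord L (xN N) (uN N) j n) * norm (aN N m n) \<le> c n * (norm (a m n) + 1)"
            by (rule mult_mono[OF fc[OF mn(2)] _ c0[OF mn(2)]]) simp
          then show "norm (frame_coord L (xN N) (uN N) j m) * (norm (frame_coord L (xN N) (uN N) j n) * norm (aN N m n))
              \<le> c m * (c n * (norm (a m n) + 1))"
            by (rule mult_mono[OF fc[OF mn(1)] _ c0[OF mn(1)]]) simp
        qed
        finally show "norm (complex_of_real (r j) *
          (\<Sum>m<L. \<Sum>n<L. cnj (frame_coord L (xN N) (uN N) j m) * (frame_coord L (xN N) (uN N) j n * aN N m n)))
          \<le> \<bar>r j\<bar> * (\<Sum>m<L. \<Sum>n<L. c m * (c n * (norm (a m n) + 1)))"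
          by (simp add: norm_mult mult_left_mono)
      qed
    qed
  qed simp
  have den: "(\<lambda>N. frame_weight L r (xN N)) \<longlonglongrightarrow> frame_weight L r x"
    unfolding frame_weight_def
  proof (rule tendsto_suminf_dominated(1))
    show "(\<lambda>N. complex_of_real (r j) * (\<Sum>l<L. cnj (xN N j l) * xN N j l))
      \<longlonglongrightarrow> complex_of_real (r j) * (\<Sum>l<L. cnj (x j l) * x j l)" for j
      by (intro tendsto_mult_left tendsto_sum tendsto_mult tendsto_cnj x) auto
    show "summable (\<lambda>j. \<bar>r j\<bar> * (\<Sum>l<L. D * D))" by (rule summable_mult2[OF r])
    show "\<forall>\<^sub>F N in sequentially. \<forall>j. norm (complex_of_real (r j) * (\<Sum>l<L. cnj (xN N j l) * xN N j l))
        \<le> \<bar>r j\<bar> * (\<Sum>l<L. D * D)"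
      using bound
    proof eventually_elim
      case (elim N)
      show ?case
      proof
        fix j
        have "norm (\<Sum>l<L. cnj (xN N j l) * xN N j l) \<le> (\<Sum>l<L. norm (xN N j l) * norm (xN N j l))"
          by (rule order_trans[OF norm_sum]) (simp add: norm_mult)
        also have "\<dots> \<le> (\<Sum>l<L. D * D)"
        proof (intro sum_mono mult_mono)
          fix l assume "l \<in> {..<L}"
          then show *: "norm (xN N j l) \<le> D" "norm (xN N j l) \<le> D" using elim by auto
          then show "0 \<le> D" using norm_ge_zero order_trans by blast
        qed simp
        finally show "norm (complex_of_real (r j) * (\<Sum>l<L. cnj (xN N j l) * xN N j l)) \<le> \<bar>r j\<bar> * (\<Sum>l<L. D * D)"
          unfolding norm_mult by (simp add: mult_left_mono)
      qed
    qed
  qed simp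
  show ?thesis
    unfolding frame_expectation_def by (rule tendsto_divide[OF num den nonzero])
qed

lemma l2_onorm_bound:
  assumes T: "l2_bounded_op M (l2_space M) T" and a: "l2_onorm M (l2_space M) T \<le> a"
    and f: "f \<in> l2_space M"
  shows "l2_norm M (T f) \<le> a * l2_norm M f"
proof -
  obtain C where C: "0 \<le> C" "\<And>f. f \<in> l2_space M \<Longrightarrow> l2_norm M (T f) \<le> C * l2_norm M f"
    by (rule l2_bounded_op_lipschitz[OF T]) (blast intro: that)
  show ?thesis
  proof (cases "l2_norm M f = 0")
    case True
    then show ?thesis using C(2)[OF f] by simp
  next
    case False
    then have pos: "0 < l2_norm M f" using l2_norm_nonneg[of M f] by linarith
    have "bdd_above ((\<lambda>f. l2_norm M (T f) / l2_norm M f) ` l2_space M)"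
    proof (rule bdd_aboveI2)
      fix g assume g: "g \<in> l2_space M"
      show "l2_norm M (T g) / l2_norm M g \<le> C"
      proof (cases "l2_norm M g = 0")
        case False
        then have "0 < l2_norm M g" using l2_norm_nonneg[of M g] by linarith
        then show ?thesis using C(2)[OF g] by (simp add: pos_divide_le_eq)
      qed (use C(1) in simp)
    qed
    then have "l2_norm M (T f) / l2_norm M f \<le> l2_onorm M (l2_space M) T"
      unfolding l2_onorm_def using f by (rule cSUP_upper2[OF _ _ order_refl])
    with a have "l2_norm M (T f) / l2_norm M f \<le> a" by linarith
    then show ?thesis using pos by (simp add: divide_le_eq)
  qed
qed

text \<open>The exceptional null set depends on the two functions. Only countably many pairs occur in the
  matrix elements, so one null set serves all of them without separability of the space of
  continuous functions.\<close>

lemma sampling_inner_tendsto: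
  fixes \<Phi> :: "real \<Rightarrow> 'x::metric_space \<Rightarrow> 'x"
  assumes flow: "continuous_flow \<Phi>" and sets: "sets \<mu> = sets borel" and prob: "prob_space \<mu>"
    and inv: "flow_invariant \<mu> \<Phi>" and erg: "map_ergodic \<mu> (\<Phi> \<Delta>t)"
    and f: "continuous_on UNIV f" "\<And>x. norm (f x) \<le> B"
    and g: "continuous_on UNIV g" "\<And>x. norm (g x) \<le> C"
  shows "AE x0 in \<mu>. (\<lambda>N. l2_inner (sampling_measure \<Phi> \<Delta>t x0 N) f g) \<longlonglongrightarrow> l2_inner \<mu> f g"
proof -
  have fg: "f \<in> borel_measurable borel" "g \<in> borel_measurable borel"
    using f g by (auto intro: borel_measurable_continuous_onI)
  have "AE x in \<mu>. (\<lambda>n. (\<Sum>k<n. cnj (f ((\<Phi> \<Delta>t ^^ k) x)) * g ((\<Phi> \<Delta>t ^^ k) x)) / of_nat n)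
      \<longlonglongrightarrow> (\<integral>x. cnj (f x) * g x \<partial>\<mu>)"
  proof (rule birkhoff_bounded_complex[where f="\<lambda>x. cnj (f x) * g x" and B="B * C"])
    show "prob_space \<mu>" "map_ergodic \<mu> (\<Phi> \<Delta>t)" "\<Phi> \<Delta>t \<in> measurable \<mu> \<mu>" "distr \<mu> \<mu> (\<Phi> \<Delta>t) = \<mu>"
      using prob erg flow_measurable[OF flow sets] inv by (auto simp: flow_invariant_def)
    have "(\<lambda>x. cnj (f x) * g x) \<in> borel_measurable borel"
      by (intro borel_measurable_times measurable_cnj fg)
    then show "(\<lambda>x. cnj (f x) * g x) \<in> borel_measurable \<mu>"
      using sets by (simp cong: measurable_cong_sets)
    fix x
    have "0 \<le> B" using f(2)[of x] norm_ge_zero order_trans by blast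
    then show "norm (cnj (f x) * g x) \<le> B * C"
      unfolding norm_mult complex_mod_cnj using f(2)[of x] g(2)[of x] by (intro mult_mono) auto
  qed
  then show ?thesis
  proof eventually_elim
    case (elim x0)
    then show ?case
      unfolding sampling_inner[OF fg] orbit_pt_def flow_iterate[OF flow] by (simp only: l2_inner_def)
  qed
qed

text \<open>The hypothesis concerns the continuous representatives only; they agree with the eigenfunctions
  at the sample points as soon as the eigenvalue is nonzero, and uniform convergence is stronger than
  convergence in the norms of the varying measures.\<close>

lemma sampled_eigenfunction_tendsto:
  fixes \<Phi> :: "real \<Rightarrow> 'x::metric_space \<Rightarrow> 'x" and \<Delta>t :: real and x0 :: 'x
  defines "\<nu> \<equiv> sampling_measure \<Phi> \<Delta>t x0"
  assumes basis: "\<forall>N\<ge>1. kernel_eigenbasis (\<nu> N) (kN N) {..<N} (\<phi>N N) (eigN N)"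
    and eig: "(\<lambda>N. eigN N l) \<longlonglongrightarrow> lam" "lam \<noteq> 0"
    and lim: "uniform_limit UNIV (\<lambda>N. continuous_rep (\<nu> N) (kN N) (eigN N l) (\<phi>N N l)) p sequentially"
    and p: "continuous_on UNIV p"
  shows "(\<lambda>N. l2_norm (\<nu> N) (\<lambda>x. complex_of_real (\<phi>N N l x) - complex_of_real (p x))) \<longlonglongrightarrow> 0"
proof (rule tendstoI)
  fix \<epsilon> :: real assume \<epsilon>: "\<epsilon> > 0"
  have p_meas: "(\<lambda>x. complex_of_real (p x)) \<in> borel_measurable borel"
    using p by (intro borel_measurable_continuous_onI continuous_intros)
  show "\<forall>\<^sub>F N in sequentially. dist (l2_norm (\<nu> N) (\<lambda>x. complex_of_real (\<phi>N N l x) - complex_of_real (p x))) 0 < \<epsilon>"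
    using eventually_gt_at_top[of l] tendsto_imp_eventually_ne[OF eig]
      uniform_limitD[OF lim half_gt_zero[OF \<epsilon>]]
  proof eventually_elim
    case (elim N)
    then have N: "N \<ge> 1" "l \<in> {..<N}" by auto
    note basis_N = basis[rule_format, OF N(1)]
    have "l2_onb (\<nu> N) (l2_space (\<nu> N)) {..<N} (\<lambda>l x. complex_of_real (\<phi>N N l x))"
      using basis_N by (simp add: kernel_eigenbasis_def)
    then have "(\<lambda>x. complex_of_real (\<phi>N N l x)) \<in> l2_space (\<nu> N)"
      by (rule l2_onb_in[OF _ N(2)])
    then have \<phi>_meas: "(\<lambda>x. complex_of_real (\<phi>N N l x)) \<in> borel_measurable borel"
      unfolding \<nu>_def sampling_l2_iff .
    have "AE x in \<nu> N. complex_of_real (\<phi>N N l x)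
        = complex_of_real (continuous_rep (\<nu> N) (kN N) (eigN N l) (\<phi>N N l) x)"
      using eigenfunction_representative[OF basis_N N(2) elim(2)] unfolding l2_eq_def .
    then have ae: "AE x in \<nu> N. norm (complex_of_real (\<phi>N N l x) - complex_of_real (p x)) \<le> \<epsilon> / 2"
    proof eventually_elim
      fix x
      assume eq: "complex_of_real (\<phi>N N l x) = complex_of_real (continuous_rep (\<nu> N) (kN N) (eigN N l) (\<phi>N N l) x)"
      have "\<bar>continuous_rep (\<nu> N) (kN N) (eigN N l) (\<phi>N N l) x - p x\<bar> < \<epsilon> / 2"
        using elim(3) by (simp add: dist_real_def)
      then show "norm (complex_of_real (\<phi>N N l x) - complex_of_real (p x)) \<le> \<epsilon> / 2"
        unfolding eq of_real_diff[symmetric] norm_of_real by simp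
    qed
    have "l2_norm (\<nu> N) (\<lambda>x. complex_of_real (\<phi>N N l x) - complex_of_real (p x)) \<le> \<epsilon> / 2"
    proof (rule l2_norm_bounded[OF _ _ ae])
      show "prob_space (\<nu> N)" unfolding \<nu>_def by (rule prob_space_sampling[OF N(1)])
      show "(\<lambda>x. complex_of_real (\<phi>N N l x) - complex_of_real (p x)) \<in> borel_measurable (\<nu> N)"
        unfolding \<nu>_def measurable_sampling by (rule borel_measurable_diff[OF \<phi>_meas p_meas])
    qed (use \<epsilon> in simp)
    then show ?case using \<epsilon> by simp
  qed
qed

lemma kernel_eigenbasis_frame:
  assumes "kernel_eigenbasis M k I \<phi> eig" "{..<L} \<subseteq> I"
  shows "real_frame M \<phi> L"
proof -
  have onb: "l2_onb M (l2_space M) I (\<lambda>l x. complex_of_real (\<phi> l x))"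
    using assms(1) by (simp add: kernel_eigenbasis_def)
  show ?thesis
  proof
    fix l assume "l < L"
    then show "(\<lambda>x. complex_of_real (\<phi> l x)) \<in> l2_space M"
      using assms(2) l2_onb_in[OF onb] by blast
  next
    fix l m assume "l < L" "m < L"
    then show "l2_inner M (\<lambda>x. complex_of_real (\<phi> l x)) (\<lambda>x. complex_of_real (\<phi> m x)) = (if l = m then 1 else 0)"
      using assms(2) by (intro l2_onb_inner[OF onb]) auto
  qed
qed

theorem mainTheorem6:
  fixes \<Phi> :: "real \<Rightarrow> 'x::metric_space \<Rightarrow> 'x"
    and \<mu> :: "'x measure"
    and \<Delta>t :: real
    and k :: "'x \<Rightarrow> 'x \<Rightarrow> real"
    and \<phi> :: "nat \<Rightarrow> 'x \<Rightarrow> real"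
    and eig :: "nat \<Rightarrow> real"
    and kN :: "'x \<Rightarrow> nat \<Rightarrow> 'x \<Rightarrow> 'x \<Rightarrow> real"
    and \<phi>N :: "'x \<Rightarrow> nat \<Rightarrow> nat \<Rightarrow> 'x \<Rightarrow> real"
    and eigN :: "'x \<Rightarrow> nat \<Rightarrow> nat \<Rightarrow> real"
    and \<rho> :: "'x l2_op"
    and r :: "nat \<Rightarrow> real"
    and \<xi> :: "nat \<Rightarrow> 'x \<Rightarrow>\<^sub>C complex"
    and A :: "'x l2_op"
    and At :: "('x \<Rightarrow>\<^sub>C complex) \<Rightarrow> ('x \<Rightarrow>\<^sub>C complex)"
    and AN :: "'x \<Rightarrow> nat \<Rightarrow> 'x l2_op"
    and q :: nat
  defines "\<mu>N \<equiv> sampling_measure \<Phi> \<Delta>t"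
    and "H \<equiv> l2_space \<mu>"
    and "HL \<equiv> leading_span \<phi>"
    and "HLN \<equiv> (\<lambda>x0 L N. leading_span (\<phi>N x0 N) L)"
    and "tq \<equiv> real q * \<Delta>t"
  assumes compact_X: "compact (UNIV :: 'x set)"
    and flow: "continuous_flow \<Phi>"
    and borel_\<mu>: "sets \<mu> = sets borel"
    and prob_\<mu>: "prob_space \<mu>"
    and invariant: "flow_invariant \<mu> \<Phi>"
    and ergodic: "flow_ergodic \<mu> \<Phi>"
    and step_pos: "\<Delta>t > 0"
    and ergodic_step: "map_ergodic \<mu> (\<Phi> \<Delta>t)"
    and distinct_orbit: "AE x0 in \<mu>. inj (orbit_pt \<Phi> \<Delta>t x0)"
    and kernel: "continuous_symmetric_kernel k"
    and basis: "kernel_eigenbasis \<mu> k UNIV \<phi> eig"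
    and eig_nonzero: "\<forall>l. eig l \<noteq> 0"
    and kernel_N: "AE x0 in \<mu>. \<forall>N\<ge>1. continuous_symmetric_kernel (kN x0 N)"
    and kernel_lim: "AE x0 in \<mu>.
        uniform_limit UNIV (\<lambda>N (x, y). kN x0 N x y) (\<lambda>(x, y). k x y) sequentially"
    and basis_N: "AE x0 in \<mu>. \<forall>N\<ge>1.
        kernel_eigenbasis (\<mu>N x0 N) (kN x0 N) {..<N} (\<phi>N x0 N) (eigN x0 N)"
    and eig_lim: "AE x0 in \<mu>. \<forall>l. (\<lambda>N. eigN x0 N l) \<longlonglongrightarrow> eig l"
    and basis_lim: "AE x0 in \<mu>. \<forall>l.
        uniform_limit UNIV
          (\<lambda>N. continuous_rep (\<mu>N x0 N) (kN x0 N) (eigN x0 N l) (\<phi>N x0 N l))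
          (continuous_rep \<mu> k (eig l) (\<phi> l)) sequentially"
    and state: "S_C_decomposition \<mu> \<rho> r \<xi>"
    and A_op: "l2_bounded_op \<mu> H A"
    and At_op: "bounded_clinear_C At"
    and AN_op: "AE x0 in \<mu>. \<forall>N\<ge>1. l2_bounded_op (\<mu>N x0 N) (l2_space (\<mu>N x0 N)) (AN x0 N)"
    and A_At: "\<forall>f. l2_eq \<mu> (A (apply_bcontfun f)) (apply_bcontfun (At f))"
    and AN_At: "AE x0 in \<mu>. \<forall>f.
        (\<lambda>N. l2_norm (\<mu>N x0 N)
               (\<lambda>x. AN x0 N (apply_bcontfun f) x - apply_bcontfun (At f) x)) \<longlonglongrightarrow> 0"
    and AN_bound: "AE x0 in \<mu>. \<exists>a. \<forall>N\<ge>1.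
        l2_onorm (\<mu>N x0 N) (l2_space (\<mu>N x0 N)) (AN x0 N) \<le> a"
  shows "AE x0 in \<mu>.
     (\<exists>v. (\<forall>\<^sub>F L in sequentially.
             (\<lambda>N. transfer_op (\<mu>N x0 N) (HLN x0 L N)
                    (compression (\<mu>N x0 N) (HLN x0 L N) (shift_op \<Phi> \<Delta>t x0 N ^^ q))
                    (density_state (\<mu>N x0 N) (HLN x0 L N)
                      (compressed_density (\<mu>N x0 N) (HLN x0 L N)
                        (sampled_density (\<mu>N x0 N) r (\<lambda>j. apply_bcontfun (\<xi> j)))))
                    (compression (\<mu>N x0 N) (HLN x0 L N) (AN x0 N)))
             \<longlonglongrightarrow> v L) \<and>
          v \<longlonglongrightarrow> transfer_op \<mu> H (koopman \<Phi> tq) (density_state \<mu> H \<rho>) A) \<and>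
     (\<lambda>L. transfer_op \<mu> (HL L) (compression \<mu> (HL L) (koopman \<Phi> tq))
            (density_state \<mu> (HL L) (compressed_density \<mu> (HL L) \<rho>))
            (compression \<mu> (HL L) A))
       \<longlonglongrightarrow> transfer_op \<mu> H (koopman \<Phi> tq) (density_state \<mu> H \<rho>) A"
proof -
  interpret \<mu>: prob_space \<mu> by (rule prob_\<mu>)
  have onb: "l2_onb \<mu> (l2_space \<mu>) UNIV (\<lambda>l x. complex_of_real (\<phi> l x))"
    using basis by (simp add: kernel_eigenbasis_def)
  define e where "e l = (\<lambda>x. complex_of_real (\<phi> l x))" for l
  define p where "p l = continuous_rep \<mu> k (eig l) (\<phi> l)" for l
  define ec where "ec l = (\<lambda>x. complex_of_real (p l x))" for l
  have e_l2: "e l \<in> l2_space \<mu>" for l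
    unfolding e_def using l2_onb_in[OF onb, of l] by simp
  have p_cont: "continuous_on UNIV (p l)" for l
    unfolding p_def using e_l2[of l]
    by (intro continuous_rep_continuous[OF compact_X kernel borel_\<mu> prob_\<mu>]) (simp add: e_def)
  have ec_cont: "continuous_on UNIV (ec l)" for l
    unfolding ec_def by (intro continuous_intros p_cont)
  have ec_bcontfun: "ec l \<in> bcontfun" for l
    using ec_cont compact_imp_bounded[OF compact_continuous_image[OF ec_cont compact_X]]
    by (simp add: bcontfun_def)
  have apply_ec: "apply_bcontfun (Bcontfun (ec l)) = ec l" for l
    by (rule Bcontfun_inverse[OF ec_bcontfun])
  define b where "b l = norm (Bcontfun (ec l))" for l
  have ec_bound: "norm (ec l x) \<le> b l" for l x
    using norm_bounded[of "Bcontfun (ec l)" x] by (simp add: apply_ec b_def)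
  have borel_meas: "g \<in> borel_measurable \<mu>" if "g \<in> borel_measurable borel" for g :: "'x \<Rightarrow> complex"
    using that borel_\<mu> by (simp cong: measurable_cong_sets)
  have ec_meas: "ec l \<in> borel_measurable borel" for l
    by (rule borel_measurable_continuous_onI[OF ec_cont])
  have ec_l2: "ec l \<in> l2_space \<mu>" for l
    using ec_bound by (intro bounded_in_l2[OF \<mu>.finite_measure_axioms borel_meas[OF ec_meas]])
  have e_ec: "l2_eq \<mu> (e l) (ec l)" for l
    unfolding e_def ec_def p_def using eig_nonzero by (intro eigenfunction_representative[OF basis]) auto
  define U where "U = koopman \<Phi> tq"
  have U_op: "l2_bounded_op \<mu> (l2_space \<mu>) U" and U'_op: "l2_bounded_op \<mu> (l2_space \<mu>) (koopman \<Phi> (- tq))"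
    unfolding U_def by (rule koopman_bounded_op[OF flow borel_\<mu> invariant])+
  have A_op': "l2_bounded_op \<mu> (l2_space \<mu>) A" using A_op by (simp add: H_def)
  note U_lin = l2_bounded_op_linear[OF U_op]
  note A_lin = l2_bounded_op_linear[OF A_op']
  define f\<xi> where "f\<xi> j = apply_bcontfun (\<xi> j)" for j
  define fA where "fA l = apply_bcontfun (At (Bcontfun (ec l)))" for l
  have \<xi>_cont: "continuous_on UNIV (f\<xi> j)" for j unfolding f\<xi>_def by simp
  have fA_cont: "continuous_on UNIV (fA l)" for l unfolding fA_def by simp
  have \<xi>_meas: "f\<xi> j \<in> borel_measurable borel" for j
    by (rule borel_measurable_continuous_onI[OF \<xi>_cont])
  have fA_meas: "fA l \<in> borel_measurable borel" for l
    by (rule borel_measurable_continuous_onI[OF fA_cont])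
  obtain D where D: "\<And>j. norm (\<xi> j) \<le> D"
    using state unfolding S_C_decomposition_def by blast
  have \<xi>_bound: "norm (f\<xi> j x) \<le> D" for j x
    using norm_bounded[of "\<xi> j" x] D[of j] by (simp add: f\<xi>_def)
  have D_nonneg: "0 \<le> D" using D[of 0] norm_ge_zero order_trans by blast
  have fA_bound: "norm (fA l x) \<le> norm (At (Bcontfun (ec l)))" for l x
    unfolding fA_def by (rule norm_bounded)
  have \<xi>_l2: "f\<xi> j \<in> l2_space \<mu>" for j
    using \<xi>_bound by (intro bounded_in_l2[OF \<mu>.finite_measure_axioms borel_meas[OF \<xi>_meas]])
  have fA_l2: "fA l \<in> l2_space \<mu>" for l
    using fA_bound by (intro bounded_in_l2[OF \<mu>.finite_measure_axioms borel_meas[OF fA_meas]])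
  have \<xi>_norm: "l2_norm \<mu> (f\<xi> j) \<le> D" for j
    using \<xi>_bound D_nonneg by (intro l2_norm_bounded[OF prob_\<mu> borel_meas[OF \<xi>_meas]]) auto
  have onb_\<xi>: "l2_onb \<mu> (l2_space \<mu>) UNIV f\<xi>"
    using state unfolding S_C_decomposition_def f\<xi>_def[abs_def] by blast
  have r_sums: "r sums 1" by (rule S_C_decomposition_weights[OF state])
  have r_abs: "summable (\<lambda>j. \<bar>r j\<bar>)"
    using state unfolding S_C_decomposition_def by (simp add: abs_of_nonneg)
  have \<rho>_lin: "l2_linear \<mu> \<rho>"
    using state unfolding S_C_decomposition_def density_op_def by (blast intro: l2_bounded_op_linear)
  have \<rho>_weak: "(\<lambda>j. complex_of_real (r j) * l2_inner \<mu> g (f\<xi> j) * l2_inner \<mu> (f\<xi> j) f) sums l2_inner \<mu> g (\<rho> f)"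
    if "f \<in> l2_space \<mu>" "g \<in> l2_space \<mu>" for f g
    unfolding f\<xi>_def using that by (rule S_C_decomposition_weak[OF state])
  have total: "(\<Sum>j. complex_of_real (r j) * l2_inner \<mu> (f\<xi> j) (f\<xi> j)) = 1"
    using r_sums sums_of_real[OF r_sums, where 'a=complex]
    by (simp add: l2_onb_inner[OF onb_\<xi>] sums_iff)
  have adj: "l2_inner \<mu> (koopman \<Phi> (- tq) f) g = l2_inner \<mu> f (U g)"
    if "f \<in> l2_space \<mu>" "g \<in> l2_space \<mu>" for f g
    unfolding U_def using that by (rule koopman_adjoint[OF flow borel_\<mu> invariant])

  define v where "v L = transfer_op \<mu> (HL L) (compression \<mu> (HL L) (koopman \<Phi> tq))
            (density_state \<mu> (HL L) (compressed_density \<mu> (HL L) \<rho>)) (compression \<mu> (HL L) A)" for L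
  have v_lim: "v \<longlonglongrightarrow> transfer_op \<mu> H (koopman \<Phi> tq) (density_state \<mu> H \<rho>) A"
    unfolding v_def[abs_def] HL_def H_def U_def[symmetric]
    by (rule compressed_expectation_tendsto[OF U_op U'_op adj A_op' l2_linear_closed[OF \<rho>_lin] \<rho>_weak
          \<xi>_l2 \<xi>_norm r_abs onb total])

  \<comment> \<open>The matrices of the exact dynamics, to which the sampled ones are compared.\<close>
  define x where "x j l = l2_inner \<mu> (e l) (f\<xi> j)" for j l
  define u where "u l m = l2_inner \<mu> (e l) (U (e m))" for l m
  define a where "a m n = l2_inner \<mu> (e m) (A (e n))" for m n
  have frame: "real_frame \<mu> \<phi> L" for L
    by (rule kernel_eigenbasis_frame[OF basis]) simp
  have v_eq: "v L = frame_expectation L r x u a" for L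
    unfolding v_def HL_def U_def[symmetric] x_def[abs_def] u_def[abs_def] a_def[abs_def] e_def
    by (rule real_frame.compressed_expectation_matrix[OF frame U_lin A_lin l2_linear_closed[OF \<rho>_lin] \<rho>_weak
          \<xi>_l2 \<xi>_norm r_abs])
  have "(\<lambda>L. frame_weight L r x) \<longlonglongrightarrow> 1"
    unfolding x_def[abs_def] e_def real_frame.frame_weight_eq[OF frame]
    by (rule frame_weight_tendsto[OF U_op U'_op adj A_op' l2_linear_closed[OF \<rho>_lin] \<rho>_weak
          \<xi>_l2 \<xi>_norm r_abs onb total])
  then have weight: "\<forall>\<^sub>F L in sequentially. frame_weight L r x \<noteq> 0"
    by (rule tendsto_imp_eventually_ne) simp

  \<comment> \<open>Matrix elements in the continuous representatives: these make sense for every measure.\<close>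
  have Uec_cont: "continuous_on UNIV (U (ec m))" for m
    unfolding U_def koopman_def
    by (intro continuous_on_compose flow_continuous[OF flow] continuous_on_subset[OF ec_cont]) simp
  have Uec_bound: "norm (U (ec m) y) \<le> b m" for m y
    by (simp add: U_def koopman_def ec_bound)
  have Uec_l2: "U (ec m) \<in> l2_space \<mu>" for m by (rule l2_linear_closed[OF U_lin ec_l2])
  have x_eq: "l2_inner \<mu> (ec l) (f\<xi> j) = x j l" for j l
    unfolding x_def by (rule l2_inner_cong_left[OF e_ec e_l2 ec_l2 \<xi>_l2, symmetric])
  have u_eq: "l2_inner \<mu> (ec l) (U (ec m)) = u l m" for l m
  proof -
    have "l2_inner \<mu> (e l) (U (e m)) = l2_inner \<mu> (e l) (U (ec m))"
      by (rule l2_inner_cong[OF l2_bounded_op_cong[OF U_op e_l2 ec_l2 e_ec]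
            l2_linear_closed[OF U_lin e_l2] Uec_l2 e_l2])
    also have "\<dots> = l2_inner \<mu> (ec l) (U (ec m))"
      by (rule l2_inner_cong_left[OF e_ec e_l2 ec_l2 Uec_l2])
    finally show ?thesis by (simp add: u_def)
  qed
  have a_eq: "l2_inner \<mu> (ec m) (fA n) = a m n" for m n
  proof -
    have "l2_eq \<mu> (A (e n)) (A (ec n))" by (rule l2_bounded_op_cong[OF A_op' e_l2 ec_l2 e_ec])
    moreover have "l2_eq \<mu> (A (ec n)) (fA n)"
      using A_At[rule_format, of "Bcontfun (ec n)"] by (simp add: apply_ec fA_def)
    ultimately have "l2_eq \<mu> (A (e n)) (fA n)" unfolding l2_eq_def by eventually_elim simp
    then have "l2_inner \<mu> (e m) (A (e n)) = l2_inner \<mu> (e m) (fA n)"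
      by (intro l2_inner_cong l2_linear_closed[OF A_lin] e_l2 fA_l2)
    then show ?thesis
      unfolding a_def using l2_inner_cong_left[OF e_ec e_l2 ec_l2 fA_l2, of m n] by simp
  qed

  note generic = sampling_inner_tendsto[OF flow borel_\<mu> prob_\<mu> invariant ergodic_step]
  have gen_x: "AE x0 in \<mu>. \<forall>j l. (\<lambda>N. l2_inner (\<mu>N x0 N) (ec l) (f\<xi> j)) \<longlonglongrightarrow> x j l"
    unfolding \<mu>N_def AE_all_countable x_eq[symmetric]
    by (intro allI generic[OF ec_cont ec_bound \<xi>_cont \<xi>_bound])
  have gen_u: "AE x0 in \<mu>. \<forall>l m. (\<lambda>N. l2_inner (\<mu>N x0 N) (ec l) (U (ec m))) \<longlonglongrightarrow> u l m"
    unfolding \<mu>N_def AE_all_countable u_eq[symmetric]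
    by (intro allI generic[OF ec_cont ec_bound Uec_cont Uec_bound])
  have gen_a: "AE x0 in \<mu>. \<forall>m n. (\<lambda>N. l2_inner (\<mu>N x0 N) (ec m) (fA n)) \<longlonglongrightarrow> a m n"
    unfolding \<mu>N_def AE_all_countable a_eq[symmetric]
    by (intro allI generic[OF ec_cont ec_bound fA_cont fA_bound])

  show ?thesis
    using distinct_orbit basis_N eig_lim basis_lim AN_op AN_At AN_bound gen_x gen_u gen_a
  proof eventually_elim
    case (elim x0)
    let ?\<nu> = "\<mu>N x0"
    let ?S = "\<lambda>N. shift_op \<Phi> \<Delta>t x0 N ^^ q"
    define eN where "eN N l = (\<lambda>x. complex_of_real (\<phi>N x0 N l x))" for N l
    obtain \<alpha> where \<alpha>: "\<And>N. N \<ge> 1 \<Longrightarrow> l2_onorm (?\<nu> N) (l2_space (?\<nu> N)) (AN x0 N) \<le> \<alpha>"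
      using elim(7) by blast
    have AN_lin: "l2_linear (?\<nu> N) (AN x0 N)" if "N \<ge> 1" for N
      using elim(5) that by (intro l2_bounded_op_linear) blast
    have \<nu>_l2: "g \<in> l2_space (?\<nu> N)" if "g \<in> borel_measurable borel" for g N
      unfolding \<mu>N_def by (rule sampling_l2[OF that])
    have \<nu>_prob: "prob_space (?\<nu> N)" if "N \<ge> 1" for N
      unfolding \<mu>N_def by (rule prob_space_sampling[OF that])
    have \<nu>_norm: "l2_norm (?\<nu> N) g \<le> C" if "N \<ge> 1" "g \<in> borel_measurable borel" "\<And>y. norm (g y) \<le> C" for N g C
    proof (rule l2_norm_bounded[OF \<nu>_prob[OF that(1)]])
      show "g \<in> borel_measurable (?\<nu> N)" unfolding \<mu>N_def measurable_sampling by (rule that(2))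
      show "AE y in ?\<nu> N. norm (g y) \<le> C" using that(3) by simp
      show "0 \<le> C" using that(3)[of x0] norm_ge_zero order_trans by blast
    qed
    have eN_l2: "eN N l \<in> l2_space (?\<nu> N)" if "l < N" for N l
    proof -
      have "l2_onb (?\<nu> N) (l2_space (?\<nu> N)) {..<N} (\<lambda>l x. complex_of_real (\<phi>N x0 N l x))"
        using elim(2) that unfolding kernel_eigenbasis_def by simp
      from l2_onb_in[OF this, of l] that show ?thesis by (simp add: eN_def)
    qed
    have eN_meas: "eN N l \<in> borel_measurable borel" if "l < N" for N l
      using eN_l2[OF that] unfolding \<mu>N_def sampling_l2_iff .
    have eN_lim: "(\<lambda>N. l2_norm (?\<nu> N) (\<lambda>x. eN N l x - ec l x)) \<longlonglongrightarrow> 0" for l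
      unfolding eN_def ec_def \<mu>N_def
    proof (rule sampled_eigenfunction_tendsto)
      show "\<forall>N\<ge>1. kernel_eigenbasis (sampling_measure \<Phi> \<Delta>t x0 N) (kN x0 N) {..<N} (\<phi>N x0 N) (eigN x0 N)"
        using elim(2) unfolding \<mu>N_def .
      show "(\<lambda>N. eigN x0 N l) \<longlonglongrightarrow> eig l" "eig l \<noteq> 0" using elim(3) eig_nonzero by auto
      show "uniform_limit UNIV (\<lambda>N. continuous_rep (sampling_measure \<Phi> \<Delta>t x0 N) (kN x0 N) (eigN x0 N l) (\<phi>N x0 N l))
          (p l) sequentially"
        using elim(4) unfolding \<mu>N_def p_def by blast
      show "continuous_on UNIV (p l)" by (rule p_cont)
    qed
    have S_lim: "(\<lambda>N. l2_norm (?\<nu> N) (\<lambda>x. ?S N (eN N m) x - U (ec m) x)) \<longlonglongrightarrow> 0" for m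
      using shift_power_approx_flow[OF flow elim(1) ec_cont ec_bound, of "Suc m" "\<lambda>N. eN N m" m q]
        eN_meas eN_lim[of m] by (simp add: \<mu>N_def U_def tq_def)
    have A_lim: "(\<lambda>N. l2_norm (?\<nu> N) (\<lambda>x. AN x0 N (eN N n) x - fA n x)) \<longlonglongrightarrow> 0" for n
    proof (rule Lim_null_comparison)
      have At_lim: "(\<lambda>N. l2_norm (?\<nu> N) (\<lambda>x. AN x0 N (ec n) x - fA n x)) \<longlonglongrightarrow> 0"
        using elim(6)[rule_format, of "Bcontfun (ec n)"] by (simp add: apply_ec fA_def)
      show "(\<lambda>N. \<alpha> * l2_norm (?\<nu> N) (\<lambda>x. eN N n x - ec n x) + l2_norm (?\<nu> N) (\<lambda>x. AN x0 N (ec n) x - fA n x)) \<longlonglongrightarrow> 0"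
        using tendsto_add[OF tendsto_mult_left[OF eN_lim, of \<alpha> n] At_lim] by simp
      show "\<forall>\<^sub>F N in sequentially. norm (l2_norm (?\<nu> N) (\<lambda>x. AN x0 N (eN N n) x - fA n x))
          \<le> \<alpha> * l2_norm (?\<nu> N) (\<lambda>x. eN N n x - ec n x) + l2_norm (?\<nu> N) (\<lambda>x. AN x0 N (ec n) x - fA n x)"
        using eventually_gt_at_top[of n]
      proof eventually_elim
        fix N assume nN: "n < N"
        then have N: "N \<ge> 1" by simp
        note lin = AN_lin[OF N]
        have l2: "eN N n \<in> l2_space (?\<nu> N)" "ec n \<in> l2_space (?\<nu> N)" "fA n \<in> l2_space (?\<nu> N)"
          by (rule eN_l2[OF nN], rule \<nu>_l2[OF ec_meas], rule \<nu>_l2[OF fA_meas])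
        note AN_l2 = l2_linear_closed[OF lin]
        have "l2_norm (?\<nu> N) (\<lambda>x. AN x0 N (eN N n) x - AN x0 N (ec n) x)
            = l2_norm (?\<nu> N) (AN x0 N (\<lambda>x. eN N n x - ec n x))"
          by (rule l2_norm_cong[symmetric, OF l2_linear_diff[OF lin l2(1,2)]])
            (intro l2_measurable AN_l2 l2_diff l2)+
        also have "\<dots> \<le> \<alpha> * l2_norm (?\<nu> N) (\<lambda>x. eN N n x - ec n x)"
          using elim(5) N by (intro l2_onorm_bound[OF _ \<alpha>[OF N]] l2_diff l2) blast
        finally show "norm (l2_norm (?\<nu> N) (\<lambda>x. AN x0 N (eN N n) x - fA n x))
            \<le> \<alpha> * l2_norm (?\<nu> N) (\<lambda>x. eN N n x - ec n x) + l2_norm (?\<nu> N) (\<lambda>x. AN x0 N (ec n) x - fA n x)"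
          using l2_triangle_diff[OF AN_l2[OF l2(1)] AN_l2[OF l2(2)] l2(3)] by simp
      qed
    qed
    define xN where "xN N j l = l2_inner (?\<nu> N) (eN N l) (f\<xi> j)" for N j l
    define uN where "uN N l m = l2_inner (?\<nu> N) (eN N l) (?S N (eN N m))" for N l m
    define aN where "aN N m n = l2_inner (?\<nu> N) (eN N m) (AN x0 N (eN N n))" for N m n
    have zero_diff: "(\<lambda>N. l2_norm (?\<nu> N) (\<lambda>x. g x - g x)) \<longlonglongrightarrow> 0" for g
      by (simp add: l2_norm_def)
    \<comment> \<open>In each matrix element both vectors are replaced by fixed continuous functions.\<close>
    have matrix_lim: "(\<lambda>N. l2_inner (?\<nu> N) (eN N l) (gN N)) \<longlonglongrightarrow> c"
      if gN: "\<And>N. N \<ge> first \<Longrightarrow> gN N \<in> l2_space (?\<nu> N)" and g: "g \<in> borel_measurable borel" "\<And>y. norm (g y) \<le> C"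
        and lim: "(\<lambda>N. l2_norm (?\<nu> N) (\<lambda>x. gN N x - g x)) \<longlonglongrightarrow> 0"
        and inner: "(\<lambda>N. l2_inner (?\<nu> N) (ec l) g) \<longlonglongrightarrow> c"
      for l gN first g C c
    proof (rule tendsto_l2_inner_perturb[OF _ eN_lim lim _ _ inner])
      show "\<forall>\<^sub>F N in sequentially. eN N l \<in> l2_space (?\<nu> N) \<and> ec l \<in> l2_space (?\<nu> N)
          \<and> gN N \<in> l2_space (?\<nu> N) \<and> g \<in> l2_space (?\<nu> N)"
        using eventually_ge_at_top[of "max (Suc l) first"]
        by eventually_elim (simp add: eN_l2 \<nu>_l2[OF ec_meas] \<nu>_l2[OF g(1)] gN)
      show "\<forall>\<^sub>F N in sequentially. l2_norm (?\<nu> N) (ec l) \<le> max (b l) C"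
        using eventually_ge_at_top[of 1]
        by eventually_elim (use \<nu>_norm[OF _ ec_meas ec_bound] in \<open>auto intro: max.coboundedI1\<close>)
      show "\<forall>\<^sub>F N in sequentially. l2_norm (?\<nu> N) g \<le> max (b l) C"
        using eventually_ge_at_top[of 1]
        by eventually_elim (use \<nu>_norm[OF _ g] in \<open>auto intro: max.coboundedI2\<close>)
    qed
    have x_lim: "(\<lambda>N. xN N j l) \<longlonglongrightarrow> x j l" for j l
      unfolding xN_def using elim(8)
      by (intro matrix_lim[OF _ \<xi>_meas \<xi>_bound zero_diff]) (auto intro: \<nu>_l2[OF \<xi>_meas])
    have u_lim: "(\<lambda>N. uN N l m) \<longlonglongrightarrow> u l m" for l m
      unfolding uN_def
    proof (rule matrix_lim[OF _ borel_measurable_continuous_onI[OF Uec_cont] Uec_bound S_lim])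
      fix N assume "N \<ge> Suc m"
      then show "?S N (eN N m) \<in> l2_space (?\<nu> N)"
        by (intro \<nu>_l2 shift_power_measurable eN_meas) simp
    qed (use elim(9) in blast)
    have a_lim: "(\<lambda>N. aN N m n) \<longlonglongrightarrow> a m n" for m n
      unfolding aN_def
    proof (rule matrix_lim[OF _ fA_meas fA_bound A_lim])
      fix N assume "N \<ge> Suc n"
      then show "AN x0 N (eN N n) \<in> l2_space (?\<nu> N)"
        by (intro l2_linear_closed[OF AN_lin] eN_l2) simp_all
    qed (use elim(10) in blast)
    have "(\<lambda>N. transfer_op (?\<nu> N) (HLN x0 L N) (compression (?\<nu> N) (HLN x0 L N) (?S N))
                (density_state (?\<nu> N) (HLN x0 L N) (compressed_density (?\<nu> N) (HLN x0 L N)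
                   (sampled_density (?\<nu> N) r (\<lambda>j. apply_bcontfun (\<xi> j)))))
                (compression (?\<nu> N) (HLN x0 L N) (AN x0 N))) \<longlonglongrightarrow> v L"
      if weight_L: "frame_weight L r x \<noteq> 0" for L
    proof (rule Lim_transform_eventually)
      have "\<forall>\<^sub>F N in sequentially. \<forall>j. \<forall>l<L. norm (xN N j l) \<le> D"
        using eventually_ge_at_top[of "max 1 L"]
      proof (eventually_elim, intro allI impI)
        fix N j l assume N: "max 1 L \<le> N" and l: "l < L"
        have "norm (xN N j l) \<le> l2_norm (?\<nu> N) (eN N l) * l2_norm (?\<nu> N) (f\<xi> j)"
          unfolding xN_def using N l by (intro l2_cauchy_schwarz eN_l2 \<nu>_l2[OF \<xi>_meas]) simp
        moreover have "l2_norm (?\<nu> N) (eN N l) = 1"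
        proof -
          have "real_frame (?\<nu> N) (\<phi>N x0 N) L"
            using elim(2) N by (intro kernel_eigenbasis_frame[where I="{..<N}"]) auto
          from real_frame.frame_orthonormal[OF this l l]
          have "complex_of_real ((l2_norm (?\<nu> N) (eN N l))\<^sup>2) = 1"
            unfolding l2_inner_self[symmetric] eN_def by simp
          then show ?thesis
            by (metis of_real_eq_1_iff l2_norm_nonneg power2_eq_1_iff neg_0_le_iff_le not_one_le_zero)
        qed
        moreover have "l2_norm (?\<nu> N) (f\<xi> j) \<le> D"
          using N by (intro \<nu>_norm[OF _ \<xi>_meas \<xi>_bound]) simp
        ultimately show "norm (xN N j l) \<le> D" by simp
      qed
      then show "(\<lambda>N. frame_expectation L r (xN N) (uN N) (aN N)) \<longlonglongrightarrow> v L"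
        unfolding v_eq by (intro frame_expectation_tendsto[OF x_lim u_lim a_lim _ r_abs weight_L])
      show "\<forall>\<^sub>F N in sequentially. frame_expectation L r (xN N) (uN N) (aN N)
          = transfer_op (?\<nu> N) (HLN x0 L N) (compression (?\<nu> N) (HLN x0 L N) (?S N))
                (density_state (?\<nu> N) (HLN x0 L N) (compressed_density (?\<nu> N) (HLN x0 L N)
                   (sampled_density (?\<nu> N) r (\<lambda>j. apply_bcontfun (\<xi> j)))))
                (compression (?\<nu> N) (HLN x0 L N) (AN x0 N))"
        using eventually_ge_at_top[of "max 1 L"]
      proof eventually_elim
        fix N assume N': "max 1 L \<le> N"
        then have N: "N \<ge> 1" by simp
        have frame_N: "real_frame (?\<nu> N) (\<phi>N x0 N) L"
          using elim(2) N' by (intro kernel_eigenbasis_frame[where I="{..<N}"]) auto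
        have S_lin: "l2_linear (?\<nu> N) (?S N)" unfolding \<mu>N_def by (rule shift_power_linear)
        have sd_l2: "sampled_density (?\<nu> N) r f\<xi> f \<in> l2_space (?\<nu> N)" for f
          unfolding \<mu>N_def by (rule sampled_density_l2[OF \<xi>_meas])
        have sd_weak: "(\<lambda>j. complex_of_real (r j) * l2_inner (?\<nu> N) g (f\<xi> j) * l2_inner (?\<nu> N) (f\<xi> j) f)
            sums l2_inner (?\<nu> N) g (sampled_density (?\<nu> N) r f\<xi> f)"
          if "f \<in> l2_space (?\<nu> N)" "g \<in> l2_space (?\<nu> N)" for f g
          using that unfolding \<mu>N_def by (intro sampled_density_weak[OF N \<xi>_meas \<xi>_bound r_abs])
        have \<xi>N_norm: "l2_norm (?\<nu> N) (f\<xi> j) \<le> D" for j by (rule \<nu>_norm[OF N \<xi>_meas \<xi>_bound])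
        show "frame_expectation L r (xN N) (uN N) (aN N)
          = transfer_op (?\<nu> N) (HLN x0 L N) (compression (?\<nu> N) (HLN x0 L N) (?S N))
                (density_state (?\<nu> N) (HLN x0 L N) (compressed_density (?\<nu> N) (HLN x0 L N)
                   (sampled_density (?\<nu> N) r (\<lambda>j. apply_bcontfun (\<xi> j)))))
                (compression (?\<nu> N) (HLN x0 L N) (AN x0 N))"
          unfolding HLN_def f\<xi>_def[symmetric] xN_def[abs_def] uN_def[abs_def] aN_def[abs_def] eN_def
          by (rule real_frame.compressed_expectation_matrix[symmetric, OF frame_N S_lin AN_lin[OF N] sd_l2 sd_weak
                \<nu>_l2[OF \<xi>_meas] \<xi>N_norm r_abs])
      qed
    qed
    then have "\<forall>\<^sub>F L in sequentially. (\<lambda>N. transfer_op (?\<nu> N) (HLN x0 L N) (compression (?\<nu> N) (HLN x0 L N) (?S N))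
                (density_state (?\<nu> N) (HLN x0 L N) (compressed_density (?\<nu> N) (HLN x0 L N)
                   (sampled_density (?\<nu> N) r (\<lambda>j. apply_bcontfun (\<xi> j)))))
                (compression (?\<nu> N) (HLN x0 L N) (AN x0 N))) \<longlonglongrightarrow> v L"
      using weight by (auto elim: eventually_mono)
    then show ?case
      by (intro conjI exI[of _ v] v_lim v_lim[unfolded v_def[abs_def]])
  qed
qed

end
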